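(* Let $a$ be a properly embedded smooth arc in $D^3$, and let $D_{a,\phi}$ and $D_{a,\psi}$ be deform-spun slice disks. Then $D_{a,\phi}$ and $D_{a,\psi}$ are diffeomorphic.
   Context: Let $\phi\colon I\times D^3\to D^3$ be an isotopy with $\phi_0=\mathrm{Id}_{D^3}$, $\phi_t|_{S^2}=\mathrm{Id}_{S^2}$ for every $t\in I=[0,1]$, and $\phi_1(a)=a$. The deform-spun slice disk $D_{a,\phi}\subset D^4$ is obtained by taking $\bigcup_{t\in I}\{t\}\times\phi_t(a)\subset I\times D^3$ and rounding the corners along $\{0,1\}\times\partial D^3$ (so that $I\times D^3$ becomes $D^4$). Similarly $D_{a,\psi}$ for another such isotopy $\psi$. Slice disks $D,D'\subset D^4$ are diffeomorphic if there is an orientation preserving diffeomorphism $f$ of $D^4$ with $f(D)=D'$. *)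

theory Defs
  imports "HOL-Analysis.Analysis"
begin

primrec Ck_on :: "nat \<Rightarrow> ('a::euclidean_space \<Rightarrow> 'b::euclidean_space) \<Rightarrow> 'a set \<Rightarrow> bool" where
  "Ck_on 0 = (\<lambda>f U. continuous_on U f)"
| "Ck_on (Suc k) = (\<lambda>f U. f differentiable_on U \<and>
      (\<forall>v. Ck_on k (\<lambda>x. frechet_derivative f (at x) v) U))"

text \<open>
  Smoothness on an arbitrary subset \<open>S\<close> of a Euclidean space: near every point of \<open>S\<close> the map is the
  restriction of a map that is smooth on an open set. For \<open>D\<^sup>3\<close>, \<open>D\<^sup>4\<close> and \<open>I \<times> D\<^sup>3\<close> this is the
  usual smoothness up to the boundary (and corners).
\<close>

definition smooth_on :: "'a set \<Rightarrow> ('a::euclidean_space \<Rightarrow> 'b::euclidean_space) \<Rightarrow> bool" where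
  "smooth_on S f \<longleftrightarrow>
     (\<forall>x\<in>S. \<exists>U g. open U \<and> x \<in> U \<and> (\<forall>k. Ck_on k g U) \<and> (\<forall>y\<in>S \<inter> U. f y = g y))"

definition diffeo :: "'a set \<Rightarrow> 'b set \<Rightarrow> ('a::euclidean_space \<Rightarrow> 'b::euclidean_space) \<Rightarrow> bool" where
  "diffeo S T f \<longleftrightarrow> bij_betw f S T \<and> smooth_on S f \<and> smooth_on T (inv_into S f)"

text \<open>
  Intended for full-dimensional \<open>S\<close> whose interior is dense in it.
\<close>

definition oriented_diffeo :: "(real^'n) set \<Rightarrow> (real^'n) set \<Rightarrow> (real^'n \<Rightarrow> real^'n) \<Rightarrow> bool" where
  "oriented_diffeo S T f \<longleftrightarrow> diffeo S T f \<and> (\<forall>p\<in>interior S. det (jacobian f (at p)) > 0)"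

abbreviation D3 :: "(real^3) set" where "D3 \<equiv> cball 0 1"
abbreviation S2 :: "(real^3) set" where "S2 \<equiv> sphere 0 1"
abbreviation D4 :: "(real^4) set" where "D4 \<equiv> cball 0 1"

text \<open>
  Properly embedded is meant in the usual smooth sense: the arc meets \<open>S\<^sup>2\<close> exactly in its end points,
  and does so transversely (the velocity is not orthogonal to the radius vector).
\<close>

definition properly_embedded_arc :: "(real^3) set \<Rightarrow> bool" where
  "properly_embedded_arc a \<longleftrightarrow> (\<exists>\<gamma>::real \<Rightarrow> real^3.
     smooth_on {0..1} \<gamma> \<and> inj_on \<gamma> {0..1} \<and>
     (\<forall>s\<in>{0..1}. vector_derivative \<gamma> (at s within {0..1}) \<noteq> 0) \<and>
     \<gamma> ` {0..1} \<subseteq> D3 \<and>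
     (\<forall>s\<in>{0..1}. \<gamma> s \<in> S2 \<longleftrightarrow> s = 0 \<or> s = 1) \<and>
     (\<forall>s\<in>{0,1}. vector_derivative \<gamma> (at s within {0..1}) \<bullet> \<gamma> s \<noteq> 0) \<and>
     a = \<gamma> ` {0..1})"

definition spinning_isotopy :: "(real^3) set \<Rightarrow> (real \<Rightarrow> real^3 \<Rightarrow> real^3) \<Rightarrow> bool" where
  "spinning_isotopy a \<phi> \<longleftrightarrow>
     smooth_on ({0..1} \<times> D3) (\<lambda>(t, x). \<phi> t x) \<and>
     (\<forall>t\<in>{0..1}. diffeo D3 D3 (\<phi> t)) \<and>
     (\<forall>x\<in>D3. \<phi> 0 x = x) \<and>
     (\<forall>t\<in>{0..1}. \<forall>x\<in>S2. \<phi> t x = x) \<and>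
     \<phi> 1 ` a = a"

text \<open>\<open>\<real> \<times> \<real>\<^sup>3\<close> is identified with \<open>\<real>\<^sup>4\<close>, time being the first coordinate.\<close>

definition pt :: "real \<Rightarrow> real^3 \<Rightarrow> real^4" where
  "pt t x = vector [t, x $ 1, x $ 2, x $ 3]"

lemma pt_nth [simp]:
  "pt t x $ 1 = t" "pt t x $ 2 = x $ 1" "pt t x $ 3 = x $ 2" "pt t x $ 4 = x $ 3"
  by (simp_all add: pt_def vector_def)

definition cylinder :: "(real^4) set" where
  "cylinder = {pt t x |t x. t \<in> {0..1} \<and> x \<in> D3}"

definition corners :: "(real^4) set" where
  "corners = {pt t x |t x. t \<in> {0, 1} \<and> x \<in> S2}"

definition spun_trace :: "(real^3) set \<Rightarrow> (real \<Rightarrow> real^3 \<Rightarrow> real^3) \<Rightarrow> (real^4) set" where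
  "spun_trace a \<phi> = (\<Union>t\<in>{0..1}. pt t ` \<phi> t ` a)"

text \<open>
  Rounding the corners of \<open>I \<times> D\<^sup>3\<close> at scale \<open>\<delta>\<close>: a part of the cylinder within distance \<open>\<delta>\<close> of
  \<open>{0,1} \<times> \<partial>D\<^sup>3\<close> is cut away, so that the remaining region \<open>W\<close> is a smooth 4-ball, which \<open>\<rho>\<close> identifies
  with \<open>D\<^sup>4\<close>. Smoothness of the boundary of \<open>W\<close> is contained in the existence of \<open>\<rho>\<close>. Convexity
  and symmetry under rotations of \<open>D\<^sup>3\<close> make the new boundary piece a convex quarter-round profile in
  the \<open>(t, |x|)\<close>-plane, swept around \<open>S\<^sup>2\<close>.
\<close>

definition corner_rounding :: "real \<Rightarrow> (real^4) set \<Rightarrow> (real^4 \<Rightarrow> real^4) \<Rightarrow> bool" where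
  "corner_rounding \<delta> W \<rho> \<longleftrightarrow>
     W \<subseteq> cylinder \<and>
     (\<forall>p\<in>cylinder - W. \<exists>c\<in>corners. dist p c < \<delta>) \<and>
     convex W \<and>
     (\<forall>A t x. orthogonal_transformation A \<longrightarrow> pt t x \<in> W \<longrightarrow> pt t (A x) \<in> W) \<and>
     oriented_diffeo W D4 \<rho>"

text \<open>
  The trace of the arc itself has corners at \<open>{0,1} \<times> \<partial>a\<close>; it is rounded together with the ambient
  cylinder. As usual the disk is well defined up to diffeomorphism only, and only for small \<open>\<delta>\<close>; hence
  this is a predicate on sets, to be used for all sufficiently small \<open>\<delta> > 0\<close>. It is monotone in \<open>\<delta>\<close>.
\<close>

definition deform_spun_slice_disk ::
  "real \<Rightarrow> (real^3) set \<Rightarrow> (real \<Rightarrow> real^3 \<Rightarrow> real^3) \<Rightarrow> (real^4) set \<Rightarrow> bool" where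
  "deform_spun_slice_disk \<delta> a \<phi> D \<longleftrightarrow>
     (\<exists>W \<rho>. corner_rounding \<delta> W \<rho> \<and> D = \<rho> ` (W \<inter> spun_trace a \<phi>))"

definition slice_disks_diffeomorphic :: "(real^4) set \<Rightarrow> (real^4) set \<Rightarrow> bool" where
  "slice_disks_diffeomorphic D D' \<longleftrightarrow> (\<exists>f. oriented_diffeo D4 D4 f \<and> f ` D = D')"

end

theory Submission
  imports Defs
begin

text \<open>
  After a diffeomorphism of \<open>D\<^sup>3\<close> fixing the sphere, the arc is radial near its end points. The level
  preserving map \<open>(t, x) \<mapsto> (t, \<phi>\<^sub>t x)\<close> carries \<open>I \<times> a\<close> to the trace of the isotopy; since \<open>\<phi>\<^sub>t\<close>
  fixes the sphere, composing with a reparametrisation of the rays makes this map preserve the distance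
  to the boundary \<open>I \<times> S\<^sup>2\<close> near that boundary. It then preserves every rotationally symmetric rounding
  at a small scale, so both disks are copies of \<open>I \<times> a\<close> in two roundings. Two roundings have convex,
  hence transverse, smooth profiles in the \<open>(t, |x|)\<close>-plane, and sliding along the diagonals of that
  plane carries one profile to the other while preserving every ray of \<open>D\<^sup>3\<close>, in particular the radial
  ends of the arc.
\<close>

section \<open>Smooth maps on open sets\<close>

text \<open>Two obstacles shape the estimates. At boundary points of a closed region a map has a
  usable differential only through a local smooth extension, so diffeomorphisms are obtained from a
  compact domain, injectivity, and an injective differential of such an extension; a bound
  \<open>m * norm (x - y) \<le> norm (f x - f y)\<close> delivers the last two together. Moreover no
  modification is a small perturbation of the identity: the tangential slope of the arc, the isotopy
  at the sphere and the slopes of the profiles are arbitrary. Each modification preserves some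
  quantity exactly or nearly (the depth, the ray, the coordinate \<open>tau\<close>), and this
  controls the large part of the displacement, as for a shear. The scales are chosen in the order: a
  shell \<open>e1\<close> in which the arc is radial; a depth at which the unwinding maps preserve
  the radius; the width \<open>e1 / 4\<close> of the slide; and last \<open>\<delta>\<close>,
  without reference to the roundings. Orientation costs one point only, since the domains are convex
  and a Jacobian cannot vanish.\<close>

lemma Ck_on_subset: "Ck_on k f U \<Longrightarrow> V \<subseteq> U \<Longrightarrow> Ck_on k f V"
  by (induction k arbitrary: f) (auto intro: continuous_on_subset differentiable_on_subset)

lemma Ck_on_cong:
  assumes "open U" "\<And>x. x \<in> U \<Longrightarrow> f x = g x" "Ck_on k f U"
  shows "Ck_on k g U"
  using assms(2,3)
proof (induction k arbitrary: f g)
  case 0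
  from 0(2) have "continuous_on U f" by simp
  then have "continuous_on U g" by (rule continuous_on_eq) (rule 0(1))
  then show ?case by simp
next
  case (Suc k)
  have d: "f differentiable at x" if "x \<in> U" for x
    using Suc.prems(2) that assms(1) by (auto simp: differentiable_on_eq_differentiable_at)
  have eq: "frechet_derivative f (at x) v = frechet_derivative g (at x) v" if "x \<in> U" for x v
    using frechet_derivative_transform_within_open[OF d[OF that] assms(1) that Suc.prems(1)] by simp
  have "Ck_on k (\<lambda>x. frechet_derivative f (at x) v) U" for v
    using Suc.prems(2) by simp
  then have "Ck_on k (\<lambda>x. frechet_derivative g (at x) v) U" for v
    using Suc.IH[of "\<lambda>x. frechet_derivative f (at x) v", OF eq] by blast
  moreover have "g differentiable_on U"
    unfolding differentiable_on_eq_differentiable_at[OF assms(1)]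
  proof
    fix x assume x: "x \<in> U"
    obtain D where "(f has_derivative D) (at x)" using d[OF x] by (auto simp: differentiable_def)
    then have "(g has_derivative D) (at x)"
      by (rule has_derivative_transform_within_open[OF _ assms(1) x Suc.prems(1)])
    then show "g differentiable at x" by (auto simp: differentiable_def)
  qed
  ultimately show ?case by simp
qed

text \<open>Any derivative \<open>f'\<close> may be supplied, so each calculus rule below only has
  to exhibit its formula; \<open>frechet_derivative\<close> is recovered by uniqueness of the
  derivative.\<close>

lemma Ck_on_SucI':
  assumes "open U" "\<And>x. x \<in> U \<Longrightarrow> (f has_derivative f' x) (at x)"
    and "\<And>v. Ck_on k (\<lambda>x. f' x v) U"
  shows "Ck_on (Suc k) f U"
proof -
  have eq: "f' x = frechet_derivative f (at x)" if "x \<in> U" for x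
    using assms(2)[OF that] by (rule frechet_derivative_at)
  have "f differentiable_on U"
    using assms(2) by (meson differentiable_at_imp_differentiable_on differentiable_def)
  moreover have "Ck_on k (\<lambda>x. frechet_derivative f (at x) v) U" for v
    by (rule Ck_on_cong[OF assms(1) _ assms(3)[of v]]) (simp add: eq)
  ultimately show ?thesis by simp
qed

lemma Ck_on_SucD:
  assumes "Ck_on (Suc k) f U" "open U"
  shows "\<And>x. x \<in> U \<Longrightarrow> (f has_derivative frechet_derivative f (at x)) (at x)"
    and "\<And>v. Ck_on k (\<lambda>x. frechet_derivative f (at x) v) U"
  using assms by (auto simp: differentiable_on_eq_differentiable_at frechet_derivative_works)

lemma Ck_on_lower: "Ck_on (Suc k) f U \<Longrightarrow> Ck_on k f U"
  by (induction k arbitrary: f) (auto intro: differentiable_imp_continuous_on)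

lemma Ck_on_local:
  assumes "\<And>x. x \<in> U \<Longrightarrow> \<exists>V. open V \<and> x \<in> V \<and> Ck_on k f V"
  shows "Ck_on k f U"
  using assms
proof (induction k arbitrary: f)
  case 0
  have "isCont f x" if "x \<in> U" for x
    using 0[OF that] continuous_on_eq_continuous_at by (auto simp: continuous_on_eq_continuous_at)
  then show ?case by (simp add: continuous_at_imp_continuous_on)
next
  case (Suc k)
  have "f differentiable_on U"
    unfolding differentiable_on_def
  proof
    fix x assume "x \<in> U"
    then obtain V where V: "open V" "x \<in> V" "Ck_on (Suc k) f V" using Suc.prems by blast
    then show "f differentiable at x within U"
      using Ck_on_SucD(1)[OF V(3,1,2)] differentiableI differentiable_at_withinI by blast
  qed
  moreover have "Ck_on k (\<lambda>x. frechet_derivative f (at x) v) U" for v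
  proof (rule Suc.IH)
    fix x assume "x \<in> U"
    then obtain V where V: "open V" "x \<in> V" "Ck_on (Suc k) f V" using Suc.prems by blast
    then show "\<exists>V. open V \<and> x \<in> V \<and> Ck_on k (\<lambda>x. frechet_derivative f (at x) v) V"
      using Ck_on_SucD(2)[OF V(3,1)] by blast
  qed
  ultimately show ?case by simp
qed

lemma Ck_on_const: "open U \<Longrightarrow> Ck_on k (\<lambda>x. c) U"
proof (induction k arbitrary: c)
  case (Suc k)
  show ?case
    by (rule Ck_on_SucI'[OF Suc.prems, where f' = "\<lambda>_ _. 0"]) (auto simp: Suc)
qed simp

lemma Ck_on_bounded_linear:
  assumes "bounded_linear f" "open U" shows "Ck_on k f U"
proof (cases k)
  case 0 then show ?thesis using assms by (simp add: linear_continuous_on)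
next
  case (Suc j)
  show ?thesis unfolding Suc
    by (rule Ck_on_SucI'[OF assms(2), where f' = "\<lambda>_. f"])
      (auto simp: assms Ck_on_const bounded_linear_imp_has_derivative)
qed

lemma Ck_on_add:
  assumes "open U" "Ck_on k f U" "Ck_on k g U"
  shows "Ck_on k (\<lambda>x. f x + g x) U"
  using assms(2,3)
proof (induction k arbitrary: f g)
  case 0 then show ?case by (auto intro: continuous_on_add)
next
  case (Suc k)
  show ?case
    by (rule Ck_on_SucI'[OF assms(1), where
          f' = "\<lambda>x v. frechet_derivative f (at x) v + frechet_derivative g (at x) v"])
      (use Ck_on_SucD[OF Suc.prems(1) assms(1)] Ck_on_SucD[OF Suc.prems(2) assms(1)] in
        \<open>auto intro!: has_derivative_add Suc.IH\<close>)
qed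

lemma Ck_on_bilinear:
  assumes B: "bounded_bilinear B" and "open U" "Ck_on k f U" "Ck_on k g U"
  shows "Ck_on k (\<lambda>x. B (f x) (g x)) U"
  using assms(3,4)
proof (induction k arbitrary: f g)
  case 0 then show ?case by (auto intro: bounded_bilinear.continuous_on[OF B])
next
  case (Suc k)
  show ?case
    by (rule Ck_on_SucI'[OF assms(2), where
          f' = "\<lambda>x v. B (f x) (frechet_derivative g (at x) v) + B (frechet_derivative f (at x) v) (g x)"])
      (use Ck_on_SucD[OF Suc.prems(1) assms(2)] Ck_on_SucD[OF Suc.prems(2) assms(2)]
           Ck_on_lower[OF Suc.prems(1)] Ck_on_lower[OF Suc.prems(2)] in
        \<open>auto intro!: bounded_bilinear.FDERIV[OF B] Ck_on_add assms(2) Suc.IH\<close>)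
qed

lemma Ck_on_sum:
  assumes "open U" "\<And>i. i \<in> I \<Longrightarrow> Ck_on k (f i) U"
  shows "Ck_on k (\<lambda>x. \<Sum>i\<in>I. f i x) U"
  using assms(2)
  by (induction I rule: infinite_finite_induct) (auto intro!: Ck_on_const Ck_on_add assms(1))

lemma Ck_on_prod:
  fixes f :: "'i \<Rightarrow> 'a::euclidean_space \<Rightarrow> real"
  assumes "open U" "\<And>i. i \<in> I \<Longrightarrow> Ck_on k (f i) U"
  shows "Ck_on k (\<lambda>x. \<Prod>i\<in>I. f i x) U"
  using assms(2)
  by (induction I rule: infinite_finite_induct)
    (auto intro!: Ck_on_const Ck_on_bilinear[OF bounded_bilinear_mult] assms(1))

lemma Ck_on_compose:
  assumes "open U" "open V" "Ck_on k f U" "Ck_on k g V" "f ` U \<subseteq> V"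
  shows "Ck_on k (\<lambda>x. g (f x)) U"
  using assms(3-)
proof (induction k arbitrary: f g)
  case 0 then show ?case by (auto intro: continuous_on_compose2)
next
  case (Suc k)
  note f = Ck_on_SucD[OF Suc.prems(1) assms(1)] and g = Ck_on_SucD[OF Suc.prems(2) assms(2)]
  \<comment> \<open>The direction \<open>frechet_derivative f (at x) v\<close> varies with
    \<open>x\<close>, whereas the induction hypothesis speaks of derivatives of \<open>g\<close> in
    a fixed direction. Expansion in the basis turns it into scalar coefficients times derivatives of
    \<open>g\<close> along fixed basis vectors.\<close>
  define f' where "f' x v = (\<Sum>i\<in>Basis. (frechet_derivative f (at x) v \<bullet> i) *\<^sub>R
      frechet_derivative g (at (f x)) i)" for x v
  have "f' x = frechet_derivative g (at (f x)) \<circ> frechet_derivative f (at x)" if "x \<in> U" for x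
  proof -
    have "linear (frechet_derivative g (at (f x)))"
      using g(1)[of "f x"] that Suc.prems(3) has_derivative_linear by blast
    then have eq: "frechet_derivative g (at (f x)) w =
        (\<Sum>i\<in>Basis. (w \<bullet> i) *\<^sub>R frechet_derivative g (at (f x)) i)" for w
      by (subst euclidean_representation[symmetric, of w]) (simp only: linear_sum linear_scale)
    show ?thesis
      unfolding f'_def o_def by (intro ext) (rule eq[symmetric])
  qed
  then have "((\<lambda>x. g (f x)) has_derivative f' x) (at x)" if "x \<in> U" for x
    using diff_chain_at[OF f(1)[OF that] g(1)[of "f x"]] that Suc.prems(3) by (auto simp: o_def)
  moreover have "Ck_on k (\<lambda>x. f' x v) U" for v
    unfolding f'_def
    by (intro Ck_on_sum Ck_on_bilinear[OF bounded_bilinear_scaleR] assms Suc.IH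
        Ck_on_bilinear[OF bounded_bilinear_inner] Ck_on_const f g Ck_on_lower[OF Suc.prems(1)] Suc.prems(3))
  ultimately show ?case by (rule Ck_on_SucI'[OF assms(1)])
qed

lemma Ck_on_real:
  fixes f :: "real \<Rightarrow> real"
  assumes "open U" "\<And>x. x \<in> U \<Longrightarrow> (f has_field_derivative f' x) (at x)" "Ck_on k f' U"
  shows "Ck_on (Suc k) f U"
  by (rule Ck_on_SucI'[OF assms(1), where f' = "\<lambda>x v. f' x * v"])
    (use assms in \<open>auto simp: has_field_derivative_def
       intro!: Ck_on_bilinear[OF bounded_bilinear_mult] Ck_on_const\<close>)

text \<open>Openness is built in so that a local extension is a single fact and the rules applied to
  smooth arguments need no openness premise.\<close>

definition Cinf_on :: "('a::euclidean_space \<Rightarrow> 'b::euclidean_space) \<Rightarrow> 'a set \<Rightarrow> bool" where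
  "Cinf_on f U \<longleftrightarrow> open U \<and> (\<forall>k. Ck_on k f U)"

lemma Cinf_on_open: "Cinf_on f U \<Longrightarrow> open U" by (simp add: Cinf_on_def)

lemma Cinf_on_subset: "Cinf_on f U \<Longrightarrow> open V \<Longrightarrow> V \<subseteq> U \<Longrightarrow> Cinf_on f V"
  by (meson Cinf_on_def Ck_on_subset)

lemma Cinf_on_cong: "Cinf_on f U \<Longrightarrow> (\<And>x. x \<in> U \<Longrightarrow> f x = g x) \<Longrightarrow> Cinf_on g U"
  by (meson Cinf_on_def Ck_on_cong)

lemma Cinf_on_local:
  assumes "\<And>x. x \<in> U \<Longrightarrow> \<exists>V. x \<in> V \<and> Cinf_on f V" "open U"
  shows "Cinf_on f U"
  using assms unfolding Cinf_on_def by (meson Ck_on_local)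

lemma Cinf_on_const: "open U \<Longrightarrow> Cinf_on (\<lambda>x. c) U"
  by (simp add: Cinf_on_def Ck_on_const)

lemma Cinf_on_bounded_linear: "bounded_linear f \<Longrightarrow> open U \<Longrightarrow> Cinf_on f U"
  by (simp add: Cinf_on_def Ck_on_bounded_linear)

lemma Cinf_on_id: "open U \<Longrightarrow> Cinf_on (\<lambda>x. x) U"
  by (simp add: Cinf_on_bounded_linear bounded_linear_ident)

lemma Cinf_on_add: "Cinf_on f U \<Longrightarrow> Cinf_on g U \<Longrightarrow> Cinf_on (\<lambda>x. f x + g x) U"
  by (simp add: Cinf_on_def Ck_on_add)

lemma Cinf_on_compose:
  "Cinf_on g V \<Longrightarrow> Cinf_on f U \<Longrightarrow> f ` U \<subseteq> V \<Longrightarrow> Cinf_on (\<lambda>x. g (f x)) U"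
  unfolding Cinf_on_def using Ck_on_compose by blast

lemma Cinf_on_compose_linear:
  "bounded_linear g \<Longrightarrow> Cinf_on f U \<Longrightarrow> Cinf_on (\<lambda>x. g (f x)) U"
  by (rule Cinf_on_compose[where V = UNIV]) (auto intro: Cinf_on_bounded_linear)

lemma Cinf_on_bilinear:
  "bounded_bilinear B \<Longrightarrow> Cinf_on f U \<Longrightarrow> Cinf_on g U \<Longrightarrow> Cinf_on (\<lambda>x. B (f x) (g x)) U"
  by (simp add: Cinf_on_def Ck_on_bilinear)

lemmas Cinf_on_scaleR = Cinf_on_bilinear[OF bounded_bilinear_scaleR]
  and Cinf_on_mult = Cinf_on_bilinear[OF bounded_bilinear_mult]
  and Cinf_on_inner = Cinf_on_bilinear[OF bounded_bilinear_inner]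

lemma Cinf_on_minus: "Cinf_on f U \<Longrightarrow> Cinf_on (\<lambda>x. - f x) U"
  by (rule Cinf_on_compose_linear[OF bounded_linear_minus[OF bounded_linear_ident]])

lemma Cinf_on_diff: "Cinf_on f U \<Longrightarrow> Cinf_on g U \<Longrightarrow> Cinf_on (\<lambda>x. f x - g x) U"
  using Cinf_on_add[of f U "\<lambda>x. - g x"] Cinf_on_minus[of g U] by simp

lemma Cinf_on_sum: "open U \<Longrightarrow> (\<And>i. i \<in> I \<Longrightarrow> Cinf_on (f i) U) \<Longrightarrow> Cinf_on (\<lambda>x. \<Sum>i\<in>I. f i x) U"
  by (simp add: Cinf_on_def Ck_on_sum)

lemmas Cinf_intros = Cinf_on_const Cinf_on_id Cinf_on_add Cinf_on_scaleR Cinf_on_mult Cinf_on_inner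
  Cinf_on_minus Cinf_on_diff Cinf_on_sum

lemma Cinf_on_has_derivative:
  "Cinf_on f U \<Longrightarrow> x \<in> U \<Longrightarrow> (f has_derivative frechet_derivative f (at x)) (at x)"
  unfolding Cinf_on_def by (meson Ck_on_SucD(1))

lemma Cinf_on_frechet_derivative: "Cinf_on f U \<Longrightarrow> Cinf_on (\<lambda>x. frechet_derivative f (at x) v) U"
  unfolding Cinf_on_def using Ck_on_SucD(2) by blast

lemma Cinf_on_continuous_on: "Cinf_on f U \<Longrightarrow> continuous_on U f"
  unfolding Cinf_on_def by (metis Ck_on.simps(1))

text \<open>The derivative \<open>- (inverse x * inverse x)\<close> is a polynomial in the function
  itself, so each order of smoothness yields the next.\<close>

lemma Ck_on_inverse: "Ck_on k (inverse :: real \<Rightarrow> real) (- {0})"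
proof (induction k)
  case (Suc k)
  have "Ck_on k (\<lambda>x::real. - (inverse x * inverse x)) (- {0})"
    by (rule Ck_on_compose[where V=UNIV and g = uminus and f = "\<lambda>x. inverse x * inverse x"])
      (auto intro!: Ck_on_bilinear[OF bounded_bilinear_mult] Suc open_Compl
          Ck_on_bounded_linear[OF bounded_linear_minus[OF bounded_linear_ident]])
  then show ?case
    by (intro Ck_on_real[where f' = "\<lambda>x. - (inverse x * inverse x)"])
      (auto simp: open_Compl power2_eq_square intro!: derivative_eq_intros)
qed (auto intro!: continuous_intros)

lemma Cinf_on_inverse: "Cinf_on f U \<Longrightarrow> (\<And>x. x \<in> U \<Longrightarrow> f x \<noteq> (0::real)) \<Longrightarrow> Cinf_on (\<lambda>x. inverse (f x)) U"
  by (rule Cinf_on_compose[where V = "- {0}"]) (auto simp: Cinf_on_def Ck_on_inverse open_Compl)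

lemma Cinf_on_divide:
  "Cinf_on f U \<Longrightarrow> Cinf_on g U \<Longrightarrow> (\<And>x. x \<in> U \<Longrightarrow> g x \<noteq> (0::real)) \<Longrightarrow> Cinf_on (\<lambda>x. f x / g x) U"
  unfolding divide_inverse by (intro Cinf_on_mult Cinf_on_inverse)

lemma Ck_on_exp: "Ck_on k (exp :: real \<Rightarrow> real) UNIV"
  by (induction k) (auto intro!: continuous_intros Ck_on_real[where f' = exp] DERIV_exp simp del: Ck_on.simps(2))

lemma Cinf_on_exp: "Cinf_on f U \<Longrightarrow> Cinf_on (\<lambda>x. exp (f x :: real)) U"
  by (rule Cinf_on_compose[where V = "UNIV"]) (auto simp: Cinf_on_def Ck_on_exp)

lemma Ck_on_ln: "Ck_on k (ln :: real \<Rightarrow> real) {0<..}"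
proof (cases k)
  case (Suc j)
  show ?thesis unfolding Suc
    by (rule Ck_on_real[where f' = inverse])
      (auto intro!: DERIV_ln Ck_on_subset[OF Ck_on_inverse])
qed (auto intro!: continuous_intros)

lemma Cinf_on_ln: "Cinf_on f U \<Longrightarrow> (\<And>x. x \<in> U \<Longrightarrow> f x > (0::real)) \<Longrightarrow> Cinf_on (\<lambda>x. ln (f x)) U"
  by (rule Cinf_on_compose[where V = "{0<..}"]) (auto simp: Cinf_on_def Ck_on_ln)

lemma Cinf_on_norm:
  assumes "Cinf_on f U" "\<And>x. x \<in> U \<Longrightarrow> f x \<noteq> 0" shows "Cinf_on (\<lambda>x. norm (f x)) U"
proof (rule Cinf_on_cong)
  \<comment> \<open>Away from zero the norm is half a logarithm exponentiated, so smoothness of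
    \<open>exp\<close> and \<open>ln\<close> replaces a separate treatment of the square
    root.\<close>
  show "Cinf_on (\<lambda>x. exp (1/2 * ln (f x \<bullet> f x))) U"
    using assms by (intro Cinf_on_exp Cinf_on_mult Cinf_on_const Cinf_on_ln Cinf_on_inner) (auto simp: Cinf_on_def)
  show "exp (1/2 * ln (f x \<bullet> f x)) = norm (f x)" if "x \<in> U" for x
  proof -
    have pos: "f x \<bullet> f x > 0" using assms(2)[OF that] by simp
    then have "exp (1/2 * ln (f x \<bullet> f x)) = exp (ln (sqrt (f x \<bullet> f x)))" by (simp add: ln_sqrt)
    also have "\<dots> = sqrt (f x \<bullet> f x)" using pos by simp
    finally show ?thesis by (simp add: norm_eq_sqrt_inner)
  qed
qed

section \<open>Smooth maps on arbitrary subsets\<close>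

lemma smooth_onI_Cinf_on: "Cinf_on f U \<Longrightarrow> S \<subseteq> U \<Longrightarrow> smooth_on S f"
  unfolding smooth_on_def Cinf_on_def by blast

lemma smooth_on_iff:
  "smooth_on S f \<longleftrightarrow> (\<forall>x\<in>S. \<exists>U g. x \<in> U \<and> Cinf_on g U \<and> (\<forall>y\<in>S \<inter> U. f y = g y))"
  unfolding smooth_on_def Cinf_on_def by (simp only: conj_assoc conj_left_commute)

lemma smooth_onE:
  assumes "smooth_on S f" "x \<in> S"
  obtains U g where "x \<in> U" "Cinf_on g U" "\<And>y. y \<in> S \<Longrightarrow> y \<in> U \<Longrightarrow> f y = g y"
  using assms unfolding smooth_on_iff by fast

lemma smooth_onI:
  assumes "\<And>x. x \<in> S \<Longrightarrow> \<exists>U g. x \<in> U \<and> Cinf_on g U \<and> (\<forall>y\<in>S. y \<in> U \<longrightarrow> f y = g y)"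
  shows "smooth_on S f"
  unfolding smooth_on_iff
proof
  fix x assume "x \<in> S"
  then obtain U g where "x \<in> U" "Cinf_on g U" "\<forall>y\<in>S. y \<in> U \<longrightarrow> f y = g y"
    using assms[OF \<open>x \<in> S\<close>] by auto
  then show "\<exists>U g. x \<in> U \<and> Cinf_on g U \<and> (\<forall>y\<in>S \<inter> U. f y = g y)"
    by (intro exI[of _ U] exI[of _ g]) simp
qed

lemma smooth_on_cong:
  assumes "smooth_on S f" "\<And>x. x \<in> S \<Longrightarrow> f x = g x"
  shows "smooth_on S g"
proof (rule smooth_onI)
  fix x assume "x \<in> S"
  then obtain U h where "x \<in> U" "Cinf_on h U" "\<And>y. y \<in> S \<Longrightarrow> y \<in> U \<Longrightarrow> f y = h y"
    using smooth_onE[OF assms(1)] by metis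
  then show "\<exists>U h. x \<in> U \<and> Cinf_on h U \<and> (\<forall>y\<in>S. y \<in> U \<longrightarrow> g y = h y)"
    using assms(2) by (intro exI[of _ U] exI[of _ h]) simp
qed

lemma smooth_on_subset:
  assumes "smooth_on S f" "T \<subseteq> S" shows "smooth_on T f"
proof (rule smooth_onI)
  fix x assume "x \<in> T"
  then obtain U h where "x \<in> U" "Cinf_on h U" "\<And>y. y \<in> S \<Longrightarrow> y \<in> U \<Longrightarrow> f y = h y"
    using smooth_onE[OF assms(1)] assms(2) by (metis subsetD)
  then show "\<exists>U h. x \<in> U \<and> Cinf_on h U \<and> (\<forall>y\<in>T. y \<in> U \<longrightarrow> f y = h y)"
    using assms(2) by (intro exI[of _ U] exI[of _ h]) auto
qed

lemma smooth_on_continuous_on: assumes "smooth_on S f" shows "continuous_on S f"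
  unfolding continuous_on_eq_continuous_within
proof
  fix x assume x: "x \<in> S"
  then obtain U g where U: "x \<in> U" "Cinf_on g U" "\<forall>y\<in>S \<inter> U. f y = g y"
    using assms unfolding smooth_on_iff by blast
  have o: "open U" using U(2) Cinf_on_open by blast
  have "continuous (at x) g" using Cinf_on_continuous_on[OF U(2)] o U(1) continuous_on_eq_continuous_at by blast
  then have "continuous (at x within S) g" by (rule continuous_at_imp_continuous_at_within)
  moreover obtain d where "d > 0" "ball x d \<subseteq> U" using o U(1) openE by blast
  ultimately show "continuous (at x within S) f"
    using U x by (intro continuous_transform_within[of x S g d f]) (auto simp: subset_iff dist_commute)
qed

lemma smooth_on_compose:
  assumes g: "smooth_on T g" and f: "smooth_on S f" and "f ` S \<subseteq> T"
  shows "smooth_on S (\<lambda>x. g (f x))"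
  unfolding smooth_on_iff
proof
  fix x assume x: "x \<in> S"
  then obtain U f' where U: "x \<in> U" "Cinf_on f' U" "\<forall>y\<in>S \<inter> U. f y = f' y"
    using f unfolding smooth_on_iff by blast
  obtain V g' where V: "f x \<in> V" "Cinf_on g' V" "\<forall>y\<in>T \<inter> V. g y = g' y"
    using g x assms(3) unfolding smooth_on_iff by blast
  have o: "open (U \<inter> f' -` V)"
    using Cinf_on_open[OF U(2)] Cinf_on_open[OF V(2)] Cinf_on_continuous_on[OF U(2)]
    by (metis Int_commute continuous_on_open_vimage)
  show "\<exists>W h. x \<in> W \<and> Cinf_on h W \<and> (\<forall>y\<in>S \<inter> W. g (f y) = h y)"
  proof (intro exI conjI)
    show "x \<in> U \<inter> f' -` V" using U V x by auto
    show "Cinf_on (\<lambda>x. g' (f' x)) (U \<inter> f' -` V)"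
      by (rule Cinf_on_compose[OF V(2) Cinf_on_subset[OF U(2) o]]) auto
    show "\<forall>y\<in>S \<inter> (U \<inter> f' -` V). g (f y) = g' (f' y)"
      using U V assms(3) by auto
  qed
qed

lemma smooth_on_binop:
  fixes f :: "'a::euclidean_space \<Rightarrow> 'b::euclidean_space" and g :: "'a \<Rightarrow> 'c::euclidean_space"
    and B :: "'b \<Rightarrow> 'c \<Rightarrow> 'd::euclidean_space"
  assumes op: "\<And>(f :: 'a \<Rightarrow> 'b) g U. Cinf_on f U \<Longrightarrow> Cinf_on g U \<Longrightarrow> Cinf_on (\<lambda>x. B (f x) (g x)) U"
    and "smooth_on S f" "smooth_on S g"
  shows "smooth_on S (\<lambda>x. B (f x) (g x))"
  unfolding smooth_on_iff
proof
  fix x assume x: "x \<in> S"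
  obtain U f' where U: "x \<in> U" "Cinf_on f' U" "\<forall>y\<in>S \<inter> U. f y = f' y"
    using assms(2) x unfolding smooth_on_iff by blast
  obtain V g' where V: "x \<in> V" "Cinf_on g' V" "\<forall>y\<in>S \<inter> V. g y = g' y"
    using assms(3) x unfolding smooth_on_iff by blast
  have "Cinf_on f' (U \<inter> V)" "Cinf_on g' (U \<inter> V)"
    using U V by (auto intro: Cinf_on_subset simp: Cinf_on_open open_Int)
  then have "Cinf_on (\<lambda>x. B (f' x) (g' x)) (U \<inter> V)" by (rule op)
  then show "\<exists>W h. x \<in> W \<and> Cinf_on h W \<and> (\<forall>y\<in>S \<inter> W. B (f y) (g y) = h y)"
    using U V by (intro exI[of _ "U \<inter> V"] exI[of _ "\<lambda>x. B (f' x) (g' x)"]) auto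
qed

lemma smooth_on_add: "smooth_on S f \<Longrightarrow> smooth_on S g \<Longrightarrow> smooth_on S (\<lambda>x. f x + g x)"
  by (rule smooth_on_binop[of "(+)"]) (rule Cinf_on_add)

lemma smooth_on_mult:
  fixes f g :: "'a::euclidean_space \<Rightarrow> real"
  shows "smooth_on S f \<Longrightarrow> smooth_on S g \<Longrightarrow> smooth_on S (\<lambda>x. f x * g x)"
  by (rule smooth_on_binop[of "(*)"]) (rule Cinf_on_mult)

lemma smooth_on_bounded_linear: "bounded_linear f \<Longrightarrow> smooth_on S f"
  by (rule smooth_onI_Cinf_on[of _ UNIV]) (auto intro: Cinf_on_bounded_linear)

section \<open>Inverse functions and nondegenerate maps\<close>

lemma Ck_on_vec_nth: "open U \<Longrightarrow> Ck_on k f U \<Longrightarrow> Ck_on k (\<lambda>x. (f x :: real^'n) $ i) U"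
  by (rule Ck_on_compose[where V = UNIV])
    (auto intro!: Ck_on_bounded_linear bounded_linear_vec_nth)

lemma Ck_on_vec_lambda:
  assumes "open U" "\<And>i. Ck_on k (f i) U"
  shows "Ck_on k (\<lambda>x. (\<chi> i. f i x) :: real^'n) U"
proof -
  have "Ck_on k (\<lambda>x. \<Sum>i\<in>UNIV. f i x *\<^sub>R axis i (1::real) :: real^'n) U"
    by (intro Ck_on_sum assms Ck_on_bilinear[OF bounded_bilinear_scaleR] Ck_on_const)
  moreover have "(\<Sum>i\<in>UNIV. f i x *\<^sub>R axis i (1::real)) = (\<chi> i. f i x)" for x
    by (simp add: vec_eq_iff axis_def if_distrib cong: if_cong)
  ultimately show ?thesis by simp
qed

lemma Ck_on_det:
  fixes A :: "'a::euclidean_space \<Rightarrow> real^'n^'n"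
  assumes "open U" "\<And>i j. Ck_on k (\<lambda>x. A x $ i $ j) U"
  shows "Ck_on k (\<lambda>x. det (A x)) U"
  unfolding det_def
  by (intro Ck_on_sum Ck_on_bilinear[OF bounded_bilinear_mult] Ck_on_prod Ck_on_const assms)

text \<open>Cramer's rule makes the derivative of the inverse a rational expression in the partial
  derivatives of \<open>f\<close> composed with the inverse, so the order of smoothness can be bootstrapped.\<close>

lemma Ck_on_inverse_function:
  fixes f :: "real^'n \<Rightarrow> real^'n"
  assumes f: "Cinf_on f U" and V: "open V" "continuous_on V g" "g ` V \<subseteq> U"
    and g: "\<And>y. y \<in> V \<Longrightarrow> (g has_derivative g' y) (at y)"
    and inv: "\<And>y v. y \<in> V \<Longrightarrow> frechet_derivative f (at (g y)) (g' y v) = v"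
    and bij: "\<And>y. y \<in> V \<Longrightarrow> bij (frechet_derivative f (at (g y)))"
  shows "Ck_on k g V"
proof (induction k)
  case 0 then show ?case using V by simp
next
  case (Suc k)
  define A where "A y = matrix (frechet_derivative f (at (g y)))" for y
  have lin: "linear (frechet_derivative f (at (g y)))" if "y \<in> V" for y
    using that V(3) Cinf_on_has_derivative[OF f] by (meson has_derivative_linear image_subset_iff)
  have A: "A y *v v = frechet_derivative f (at (g y)) v" if "y \<in> V" for y v
    unfolding A_def using matrix_vector_mul(2)[OF lin[OF that]] by metis
  have inj: "det (A y) \<noteq> 0" if "y \<in> V" for y
    using bij[OF that] lin[OF that] unfolding A_def
    by (simp add: bij_def det_nz_iff_inj)
  have CA: "Ck_on k (\<lambda>y. A y $ i $ j) V" for i j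
  proof -
    have "Ck_on k (\<lambda>y. frechet_derivative f (at (g y)) (axis j 1)) V"
      using Cinf_on_frechet_derivative[OF f, of "axis j 1"] Suc V f
      by (intro Ck_on_compose[of V U k g "\<lambda>x. frechet_derivative f (at x) (axis j 1)"])
        (auto simp: Cinf_on_def)
    then show ?thesis
      unfolding A_def matrix_def by (simp add: Ck_on_vec_nth V)
  qed
  define G where "G y v = (\<chi> k. det (\<chi> i j. if j = k then v $ i else A y $ i $ j) * inverse (det (A y)))"
    for y v
  have eq: "g' y v = G y v" if "y \<in> V" for y v
  proof -
    have "A y *v g' y v = v" using A inv that by simp
    then show ?thesis unfolding G_def using cramer[OF inj[OF that]] by (simp add: divide_inverse)
  qed
  have "Ck_on k (\<lambda>y. G y v) V" for v
    unfolding G_def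
  proof (intro Ck_on_vec_lambda Ck_on_bilinear[OF bounded_bilinear_mult] Ck_on_det V)
    show "Ck_on k (\<lambda>y. (\<chi> i j. if j = l then v $ i else A y $ i $ j) $ i $ j) V" for i j l
      by (cases "j = l") (simp_all add: Ck_on_const V CA)
    show "Ck_on k (\<lambda>y. inverse (det (A y))) V"
      by (rule Ck_on_compose[of V "-{0}" k "\<lambda>y. det (A y)" inverse])
        (auto intro!: Ck_on_det CA V Ck_on_inverse simp: inj open_Compl)
  qed
  then have "Ck_on k (\<lambda>y. g' y v) V" for v
    by (rule Ck_on_cong[OF V(1), rotated]) (simp add: eq)
  with g show ?case using Ck_on_SucI'[OF V(1), of g g' k] by blast
qed

text \<open>The inverse function theorem asks for a derivative that is continuous in operator norm;
  in finite dimension, continuity of the derivative along each basis vector suffices.\<close>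

lemma Cinf_on_blinfun_derivative:
  fixes f :: "'a::euclidean_space \<Rightarrow> 'b::euclidean_space"
  assumes f: "Cinf_on f U"
  shows "x \<in> U \<Longrightarrow> blinfun_apply (Blinfun (frechet_derivative f (at x))) = frechet_derivative f (at x)"
    and "continuous_on U (\<lambda>x. Blinfun (frechet_derivative f (at x)))"
proof -
  have *: "blinfun_apply (Blinfun (frechet_derivative f (at x))) = frechet_derivative f (at x)" if "x \<in> U" for x
    using has_derivative_bounded_linear[OF Cinf_on_has_derivative[OF f that]] by (rule bounded_linear_Blinfun_apply)
  then show "x \<in> U \<Longrightarrow> blinfun_apply (Blinfun (frechet_derivative f (at x))) = frechet_derivative f (at x)" .
  show "continuous_on U (\<lambda>x. Blinfun (frechet_derivative f (at x)))"
  proof (rule continuous_on_blinfun_componentwise)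
    fix i :: 'a
    have "continuous_on U (\<lambda>x. frechet_derivative f (at x) i)"
      using Cinf_on_frechet_derivative[OF f] Cinf_on_continuous_on by blast
    then show "continuous_on U (\<lambda>x. blinfun_apply (Blinfun (frechet_derivative f (at x))) i)"
      by (rule continuous_on_eq) (simp add: *)
  qed
qed

text \<open>An injective differential has a linear left inverse, which starts the inverse function
  theorem. That theorem gives a differentiable inverse; smoothness of all orders comes from
  \<open>Ck_on_inverse_function\<close>.\<close>

lemma Cinf_on_local_inverse:
  fixes f :: "real^'n \<Rightarrow> real^'n"
  assumes f: "Cinf_on f U" and "x \<in> U" and inj: "inj (frechet_derivative f (at x))"
  obtains U' V g where "open U'" "U' \<subseteq> U" "x \<in> U'" "f x \<in> V" "Cinf_on g V"
    "\<And>y. y \<in> U' \<Longrightarrow> f y \<in> V" "\<And>y. y \<in> U' \<Longrightarrow> g (f y) = y"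
    "\<And>y. y \<in> V \<Longrightarrow> g y \<in> U'" "\<And>y. y \<in> V \<Longrightarrow> f (g y) = y"
proof -
  define f' where "f' y = Blinfun (frechet_derivative f (at y))" for y
  note f' = Cinf_on_blinfun_derivative(1)[OF f, folded f'_def]
    and cont = Cinf_on_blinfun_derivative(2)[OF f, folded f'_def]
  have lin: "linear (frechet_derivative f (at x))"
    using Cinf_on_has_derivative[OF f \<open>x \<in> U\<close>] by (rule has_derivative_linear)
  obtain h where h: "linear h" "h \<circ> frechet_derivative f (at x) = id"
    using linear_injective_left_inverse[OF lin inj] by blast
  have "Blinfun h o\<^sub>L f' x = id_blinfun"
    by (rule blinfun_eqI) (use h f'[OF \<open>x \<in> U\<close>] in
      \<open>simp add: bounded_linear_Blinfun_apply linear_conv_bounded_linear o_def id_def fun_eq_iff\<close>)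
  then obtain U' V g g' where I: "open U'" "U' \<subseteq> U" "x \<in> U'" "open V" "f x \<in> V" "homeomorphism U' V f g"
    "\<And>y. y \<in> V \<Longrightarrow> (g has_derivative (g' y)) (at y)"
    "\<And>y. y \<in> V \<Longrightarrow> g' y = inv (blinfun_apply (f'(g y)))"
    "\<And>y. y \<in> V \<Longrightarrow> bij (blinfun_apply (f'(g y)))"
    using inverse_function_theorem[OF Cinf_on_open[OF f] _ cont \<open>x \<in> U\<close>, of f "Blinfun h"]
      f' Cinf_on_has_derivative[OF f] by metis
  note hom = homeomorphism_apply1[OF I(6)] homeomorphism_apply2[OF I(6)]
    homeomorphism_image1[OF I(6)] homeomorphism_image2[OF I(6)] homeomorphism_cont2[OF I(6)]
  have gU: "g y \<in> U" if "y \<in> V" for y using hom(4) I(2) that by blast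
  have bij: "bij (frechet_derivative f (at (g y)))" if "y \<in> V" for y
    using I(9)[OF that] f'[OF gU[OF that]] by simp
  have "Ck_on k g V" for k
  proof (rule Ck_on_inverse_function[OF f I(4) hom(5) _ I(7)])
    show "frechet_derivative f (at (g y)) (g' y v) = v" if "y \<in> V" for y v
      using I(8)[OF that] f'[OF gU[OF that]] bij[OF that] by (simp add: bij_is_surj surj_f_inv_f)
  qed (use gU bij in auto)
  then have "Cinf_on g V" using I(4) by (simp add: Cinf_on_def)
  then show ?thesis
    using that[OF I(1-3,5)] hom by blast
qed

section \<open>Diffeomorphisms and injective differentials\<close>

lemma diffeoI:
  assumes "bij_betw f S T" "smooth_on S f" "smooth_on T g" "\<And>x. x \<in> S \<Longrightarrow> g (f x) = x"
  shows "diffeo S T f"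
proof -
  have "inv_into S f y = g y" if "y \<in> T" for y
    using assms(1,4) that by (metis bij_betw_imp_surj_on f_inv_into_f inv_into_into)
  then have "smooth_on T (inv_into S f)"
    by (intro smooth_on_cong[OF assms(3)]) simp
  then show ?thesis using assms by (simp add: diffeo_def)
qed

text \<open>The differential is read off a local extension because
  \<open>frechet_derivative f\<close> carries no information at boundary points of \<open>S\<close>.
  If \<open>S\<close> lies in the closure of its interior, the choice of the extension does not
  matter, by \<open>frechet_derivative_unique_extension\<close>.\<close>

definition nondegenerate_on :: "(real^'n) set \<Rightarrow> (real^'n \<Rightarrow> real^'n) \<Rightarrow> bool" where
  "nondegenerate_on S f \<longleftrightarrow> (\<forall>x\<in>S. \<exists>U g. x \<in> U \<and> Cinf_on g U \<and> (\<forall>y\<in>S \<inter> U. f y = g y) \<and>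
     inj (frechet_derivative g (at x)))"

lemma nondegenerate_onE:
  assumes "nondegenerate_on S f" "x \<in> S"
  obtains U g where "x \<in> U" "Cinf_on g U" "\<And>y. y \<in> S \<Longrightarrow> y \<in> U \<Longrightarrow> f y = g y"
    "inj (frechet_derivative g (at x))"
  using assms unfolding nondegenerate_on_def by (metis IntI)

lemma nondegenerate_on_smooth_on: "nondegenerate_on S f \<Longrightarrow> smooth_on S f"
  unfolding nondegenerate_on_def smooth_on_iff by meson

lemma diffeo_if_nondegenerate:
  assumes "compact S" "inj_on f S" and nd: "nondegenerate_on S f"
  shows "diffeo S (f ` S) f"
proof -
  have sm: "smooth_on S f" using nd by (rule nondegenerate_on_smooth_on)
  define h where "h = inv_into S f"
  have hf: "h (f x) = x" if "x \<in> S" for x using that assms(2) by (simp add: h_def)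
  have hc: "continuous_on (f ` S) h"
    by (intro continuous_on_inv[OF smooth_on_continuous_on[OF sm] assms(1)]) (simp add: hf)
  have "smooth_on (f ` S) h"
  proof (rule smooth_onI)
    fix y assume "y \<in> f ` S"
    then obtain x where x: "x \<in> S" "y = f x" by blast
    obtain U g where U: "x \<in> U" "Cinf_on g U" "\<And>y. y \<in> S \<Longrightarrow> y \<in> U \<Longrightarrow> f y = g y"
      "inj (frechet_derivative g (at x))"
      using nondegenerate_onE[OF nd x(1)] by metis
    obtain U' V k where I: "open U'" "U' \<subseteq> U" "x \<in> U'" "g x \<in> V" "Cinf_on k V"
      "\<And>y. y \<in> U' \<Longrightarrow> g y \<in> V" "\<And>y. y \<in> U' \<Longrightarrow> k (g y) = y"
      using Cinf_on_local_inverse[OF U(2,1,4)] by metis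
    obtain B where B: "open B" "B \<inter> f ` S = h -` U' \<inter> f ` S"
      using hc I(1) unfolding continuous_on_open_invariant by metis
    show "\<exists>W j. y \<in> W \<and> Cinf_on j W \<and> (\<forall>z\<in>f ` S. z \<in> W \<longrightarrow> h z = j z)"
    proof (intro exI conjI ballI impI)
      have "y \<in> h -` U' \<inter> f ` S" using x hf[OF x(1)] I(3) by simp
      then have "y \<in> B" using B(2) by (metis IntD1)
      then show "y \<in> B \<inter> V" using I(4) x U(1,3) by simp
      show "Cinf_on k (B \<inter> V)"
        by (rule Cinf_on_subset[OF I(5)]) (use B(1) I(5) Cinf_on_open in auto)
      fix z assume "z \<in> f ` S" "z \<in> B \<inter> V"
      then obtain w where w: "w \<in> S" "z = f w" by blast
      have "z \<in> h -` U'" using \<open>z \<in> B \<inter> V\<close> \<open>z \<in> f ` S\<close> B(2) by (metis IntD1 IntI)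
      then have "w \<in> U'" using w hf[OF w(1)] by simp
      then have "k (f w) = w" using I(2,7) U(3)[OF w(1)] by (metis subsetD)
      then show "h z = k z" using w hf[OF w(1)] by simp
    qed
  qed
  then show ?thesis
    using sm assms(2) by (simp add: diffeo_def h_def bij_betw_imageI)
qed

text \<open>The limit is one-sided because at a boundary point of a region only increments pointing
  inwards can be tested; as \<open>D\<close> is the derivative of an extension, this still
  determines \<open>D v\<close>.\<close>

lemma directional_derivative_tendsto:
  assumes "(f has_derivative D) (at x)"
  shows "((\<lambda>s::real. (f (x + s *\<^sub>R v) - f x) /\<^sub>R s) \<longlongrightarrow> D v) (at_right 0)"
proof -
  have lin: "linear D" using assms by (rule has_derivative_linear)
  have "((\<lambda>s. f (x + s *\<^sub>R v)) has_derivative (\<lambda>s. D (s *\<^sub>R v))) (at 0)"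
    by (rule diff_chain_at[where g = f and f = "\<lambda>s. x + s *\<^sub>R v", unfolded o_def])
      (auto intro!: derivative_eq_intros assms)
  then have "((\<lambda>s. norm (f (x + s *\<^sub>R v) - f x - s *\<^sub>R D v) / \<bar>s\<bar>) \<longlongrightarrow> 0) (at_right 0)"
    using has_derivative_at_withinI[of "\<lambda>s. f (x + s *\<^sub>R v)" _ 0 "{0<..}"]
    by (simp add: has_derivative_iff_norm linear_scale[OF lin])
  then have "((\<lambda>s. norm ((f (x + s *\<^sub>R v) - f x) /\<^sub>R s - D v)) \<longlongrightarrow> 0) (at_right 0)"
  proof (rule Lim_transform_eventually)
    show "\<forall>\<^sub>F s in at_right 0. norm (f (x + s *\<^sub>R v) - f x - s *\<^sub>R D v) / \<bar>s\<bar> =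
        norm ((f (x + s *\<^sub>R v) - f x) /\<^sub>R s - D v)"
      using eventually_at_right_less[of 0]
    proof eventually_elim
      case (elim s)
      then have "(f (x + s *\<^sub>R v) - f x) /\<^sub>R s - D v = (f (x + s *\<^sub>R v) - f x - s *\<^sub>R D v) /\<^sub>R s"
        by (simp add: scaleR_diff_right)
      then show ?case using elim by (simp only: norm_scaleR) (simp add: field_simps)
    qed
  qed
  then show ?thesis by (simp add: tendsto_norm_zero_iff LIM_zero_iff)
qed

lemma directional_derivative_lower_bound:
  assumes "(f has_derivative D) (at x)" "e > 0"
    and "\<And>s::real. 0 < s \<Longrightarrow> s < e \<Longrightarrow> c * s \<le> norm (f (x + s *\<^sub>R v) - f x)"
  shows "c \<le> norm (D v)"
proof (rule tendsto_lowerbound[OF tendsto_norm[OF directional_derivative_tendsto[OF assms(1)]]])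
  show "\<forall>\<^sub>F s in at_right 0. c \<le> norm ((f (x + s *\<^sub>R v) - f x) /\<^sub>R s)"
    using eventually_at_right_less[of 0] eventually_at_right_real[OF assms(2)]
  proof eventually_elim
    case (elim s)
    then show ?case
      using assms(3)[of s] by (simp only: norm_scaleR) (simp add: field_simps)
  qed
qed simp

text \<open>Dividing the lower bound by the length of a shrinking increment leaves the same bound
  for the differential, so no kernel survives.\<close>

lemma nondegenerate_on_if_lower_bound:
  fixes f :: "real^'n \<Rightarrow> real^'n"
  assumes "Cinf_on f UNIV" "m > 0" "\<And>x y. m * norm (x - y) \<le> norm (f x - f y)"
  shows "nondegenerate_on S f"
  unfolding nondegenerate_on_def
proof
  fix x
  let ?D = "frechet_derivative f (at x)"
  have d: "(f has_derivative ?D) (at x)" using Cinf_on_has_derivative[OF assms(1)] by simp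
  have lin: "linear ?D" using d by (rule has_derivative_linear)
  have "v = 0" if "?D v = 0" for v
  proof -
    have "m * norm v \<le> norm (?D v)"
    proof (rule directional_derivative_lower_bound[OF d, of 1])
      fix s :: real assume "0 < s" "s < 1"
      then show "m * norm v * s \<le> norm (f (x + s *\<^sub>R v) - f x)"
        using assms(3)[of "x + s *\<^sub>R v" x] by (simp add: mult_ac)
    qed simp
    then show ?thesis using that assms(2) by (simp add: mult_le_0_iff)
  qed
  then have "inj ?D" using linear_injective_0[OF lin] by blast
  then show "\<exists>U g. x \<in> U \<and> Cinf_on g U \<and> (\<forall>y\<in>S \<inter> U. f y = g y) \<and> inj (frechet_derivative g (at x))"
    using assms(1) by (intro exI[of _ UNIV] exI[of _ f]) simp
qed

lemma vanishes_by_density: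
  fixes h :: "'a::metric_space \<Rightarrow> 'b::real_normed_vector"
  assumes "x \<in> closure A" "isCont h x" "\<And>y. y \<in> A \<Longrightarrow> h y = 0"
  shows "h x = 0"
proof -
  obtain y where y: "\<And>n. y n \<in> A" "y \<longlonglongrightarrow> x"
    using assms(1) unfolding closure_sequential by blast
  have "(\<lambda>n. h (y n)) \<longlonglongrightarrow> h x" using isCont_tendsto_compose[OF assms(2) y(2)] .
  moreover have "(\<lambda>n. h (y n)) = (\<lambda>n. 0)" using assms(3) y(1) by simp
  ultimately show ?thesis using LIMSEQ_unique tendsto_const by metis
qed

lemma interior_dense_convex:
  fixes S :: "'a::euclidean_space set"
  shows "convex S \<Longrightarrow> interior S \<noteq> {} \<Longrightarrow> S \<subseteq> closure (interior S)"
  using closure_subset convex_closure_interior[of S] by simp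

text \<open>Near interior points of \<open>S\<close> the two extensions agree on open sets, so their
  derivatives coincide there; both derivatives are continuous and \<open>x\<close> is a limit of
  such points.\<close>

lemma frechet_derivative_unique_extension:
  assumes g: "Cinf_on g U" "x \<in> U" and k: "Cinf_on k V" "x \<in> V"
    and x: "x \<in> closure (interior S)" and eq: "\<And>y. y \<in> S \<Longrightarrow> y \<in> U \<Longrightarrow> y \<in> V \<Longrightarrow> g y = k y"
  shows "frechet_derivative g (at x) = frechet_derivative k (at x)"
proof
  fix v
  define W where "W = U \<inter> V"
  have oW: "open W" "x \<in> W" using g k Cinf_on_open by (auto simp: W_def)
  have W: "Cinf_on g W" "Cinf_on k W"
    by (rule Cinf_on_subset[OF g(1)] Cinf_on_subset[OF k(1)]; use oW in \<open>auto simp: W_def\<close>)+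
  let ?h = "\<lambda>y. frechet_derivative g (at y) v - frechet_derivative k (at y) v"
  have "?h y = 0" if y: "y \<in> W \<inter> interior S" for y
  proof -
    have gd: "(g has_derivative frechet_derivative g (at y)) (at y)"
      using Cinf_on_has_derivative[OF W(1)] y by blast
    have "(k has_derivative frechet_derivative g (at y)) (at y)"
      by (rule has_derivative_transform_within_open[OF gd, of "W \<inter> interior S"])
        (use oW y eq subsetD[OF interior_subset] in \<open>auto simp: W_def\<close>)
    then show ?thesis using frechet_derivative_at by force
  qed
  moreover have "x \<in> closure (W \<inter> interior S)"
    using x oW open_Int_closure_subset by blast
  moreover have "continuous_on W ?h"
    by (intro continuous_intros Cinf_on_continuous_on[OF Cinf_on_frechet_derivative[OF W(1)]]
        Cinf_on_continuous_on[OF Cinf_on_frechet_derivative[OF W(2)]])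
  then have "isCont ?h x" using oW continuous_on_eq_continuous_at by blast
  ultimately have "?h x = 0" by (intro vanishes_by_density[of x _ ?h])
  then show "frechet_derivative g (at x) v = frechet_derivative k (at x) v" by simp
qed

text \<open>At points outside the interior the value of \<open>frechet_derivative f\<close> is junk; there the argument has
  to pass to a local extension and use that the interior is dense.\<close>

lemma diffeo_nondegenerate:
  fixes f :: "real^'n \<Rightarrow> real^'n"
  assumes "diffeo S T f" "S \<subseteq> closure (interior S)"
  shows "nondegenerate_on S f"
  unfolding nondegenerate_on_def
proof
  fix x assume x: "x \<in> S"
  have bij: "bij_betw f S T" and f: "smooth_on S f" and h: "smooth_on T (inv_into S f)"
    using assms(1) by (auto simp: diffeo_def)
  let ?h = "inv_into S f"
  have hf: "?h (f y) = y" and fT: "f y \<in> T" if "y \<in> S" for y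
    using bij that by (auto simp: bij_betw_def)
  obtain U g where U: "x \<in> U" "Cinf_on g U" "\<And>y. y \<in> S \<Longrightarrow> y \<in> U \<Longrightarrow> f y = g y"
    using smooth_onE[OF f x] by metis
  obtain V k where V: "f x \<in> V" "Cinf_on k V" "\<And>y. y \<in> T \<Longrightarrow> y \<in> V \<Longrightarrow> ?h y = k y"
    using smooth_onE[OF h fT[OF x]] by metis
  define W where "W = U \<inter> g -` V"
  have oW: "open W"
    unfolding W_def using Cinf_on_open[OF U(2)] Cinf_on_open[OF V(2)] Cinf_on_continuous_on[OF U(2)]
    by (metis Int_commute continuous_on_open_vimage)
  have xW: "x \<in> W" using U V x by (simp add: W_def)
  define c where "c = (\<lambda>y. k (g y))"
  have c: "Cinf_on c W"
    unfolding c_def by (rule Cinf_on_compose[OF V(2) Cinf_on_subset[OF U(2) oW]]) (auto simp: W_def)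
  have cid: "c y = y" if "y \<in> S" "y \<in> W" for y
    using that U(3) V(3) hf fT unfolding c_def W_def by (metis IntD1 IntD2 vimageE)
  have "frechet_derivative (\<lambda>y::real^'n. y) (at x) = (\<lambda>v. v)"
    by (rule frechet_derivative_at[symmetric]) simp
  then have Dc: "frechet_derivative c (at x) v = v" for v
    using frechet_derivative_unique_extension[OF c xW Cinf_on_id[OF open_UNIV], of S] assms(2) x cid by auto
  have gx: "(g has_derivative frechet_derivative g (at x)) (at x)"
    using Cinf_on_has_derivative[OF U(2,1)] .
  have "g x \<in> V" using V(1) U x by simp
  then have "(k has_derivative frechet_derivative k (at (g x))) (at (g x))"
    using Cinf_on_has_derivative[OF V(2)] by blast
  then have "(c has_derivative frechet_derivative k (at (g x)) \<circ> frechet_derivative g (at x)) (at x)"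
    unfolding c_def using diff_chain_at[OF gx] by (simp add: o_def)
  then have "frechet_derivative k (at (g x)) (frechet_derivative g (at x) v) = v" for v
    using Dc[of v] by (metis comp_apply frechet_derivative_at)
  then have "inj (frechet_derivative g (at x))" by (metis injI)
  then show "\<exists>U g. x \<in> U \<and> Cinf_on g U \<and> (\<forall>y\<in>S \<inter> U. f y = g y) \<and> inj (frechet_derivative g (at x))"
    using U by blast
qed

lemma smooth_on_has_derivative_interior:
  assumes "smooth_on S f" "x \<in> interior S"
  shows "(f has_derivative frechet_derivative f (at x)) (at x)"
    and "\<exists>W. open W \<and> x \<in> W \<and> W \<subseteq> S \<and> Cinf_on f W"
proof -
  obtain U g where U: "x \<in> U" "Cinf_on g U" "\<And>y. y \<in> S \<Longrightarrow> y \<in> U \<Longrightarrow> f y = g y"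
    using smooth_onE[OF assms(1)] assms(2) interior_subset by (metis subsetD)
  have o: "open (U \<inter> interior S)" using Cinf_on_open[OF U(2)] by blast
  have "Cinf_on g (U \<inter> interior S)" by (rule Cinf_on_subset[OF U(2) o]) auto
  then have "Cinf_on f (U \<inter> interior S)"
    by (rule Cinf_on_cong) (use U(3) interior_subset in force)
  then show "(f has_derivative frechet_derivative f (at x)) (at x)"
    "\<exists>W. open W \<and> x \<in> W \<and> W \<subseteq> S \<and> Cinf_on f W"
    using Cinf_on_has_derivative[of f "U \<inter> interior S" x] U(1) assms(2) o interior_subset by blast+
qed

section \<open>Orientation and cut-off functions\<close>

lemma diffeo_compose:
  assumes "diffeo S T f" "diffeo T U g" shows "diffeo S U (\<lambda>x. g (f x))"
proof (rule diffeoI)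
  have f: "bij_betw f S T" "smooth_on S f" "smooth_on T (inv_into S f)"
    and g: "bij_betw g T U" "smooth_on T g" "smooth_on U (inv_into T g)"
    using assms by (auto simp: diffeo_def)
  show "bij_betw (\<lambda>x. g (f x)) S U" using bij_betw_trans[OF f(1) g(1)] by (simp add: o_def)
  show "smooth_on S (\<lambda>x. g (f x))"
    by (rule smooth_on_compose[OF g(2) f(2)]) (use f(1) in \<open>simp add: bij_betw_def\<close>)
  show "smooth_on U (\<lambda>x. inv_into S f (inv_into T g x))"
    by (rule smooth_on_compose[OF f(3) g(3)])
      (use g(1) bij_betw_inv_into bij_betw_imp_surj_on in blast)
  show "inv_into S f (inv_into T g (g (f x))) = x" if "x \<in> S" for x
    using f(1) g(1) that by (simp add: bij_betw_inv_into_left bij_betwE)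
qed

lemma diffeo_inv_into:
  assumes "diffeo S T f" shows "diffeo T S (inv_into S f)"
proof (rule diffeoI)
  have f: "bij_betw f S T" "smooth_on S f" "smooth_on T (inv_into S f)"
    using assms by (auto simp: diffeo_def)
  show "bij_betw (inv_into S f) T S" using bij_betw_inv_into[OF f(1)] .
  show "smooth_on T (inv_into S f)" "smooth_on S f" using f by auto
  show "f (inv_into S f y) = y" if "y \<in> T" for y
    using f(1) that by (simp add: bij_betw_inv_into_right)
qed

lemma diffeo_subset:
  assumes "diffeo S T f" "S' \<subseteq> S" "f ` S' = T'" shows "diffeo S' T' f"
proof (rule diffeoI)
  have f: "bij_betw f S T" "smooth_on S f" "smooth_on T (inv_into S f)"
    using assms by (auto simp: diffeo_def)
  show "bij_betw f S' T'"
    using f(1) assms(2,3) by (meson bij_betw_subset bij_betw_imp_inj_on inj_on_subset bij_betw_def)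
  show "smooth_on S' f" using f(2) assms(2) by (rule smooth_on_subset)
  show "smooth_on T' (inv_into S f)"
    using f(3) by (rule smooth_on_subset) (use assms f(1) in \<open>auto simp: bij_betw_def\<close>)
  show "inv_into S f (f x) = x" if "x \<in> S'" for x
    using f(1) assms(2) that by (meson bij_betw_inv_into_left subsetD)
qed

text \<open>Invariance of domain. It is needed because orientation is tested only at interior
  points, and a composition must hand such points on.\<close>

lemma diffeo_interior_subset:
  fixes f :: "'a::euclidean_space \<Rightarrow> 'a"
  assumes "diffeo S T f" shows "f ` interior S \<subseteq> interior T"
proof (rule interior_maximal)
  have "bij_betw f S T" "continuous_on S f"
    using assms smooth_on_continuous_on by (auto simp: diffeo_def)
  then show "f ` interior S \<subseteq> T" "open (f ` interior S)"
    using interior_subset[of S]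
    by (auto simp: bij_betw_def intro!: invariance_of_domain intro: continuous_on_subset inj_on_subset)
qed

lemma jacobian_compose:
  fixes f g :: "real^'n \<Rightarrow> real^'n"
  assumes "(f has_derivative frechet_derivative f (at x)) (at x)"
    "(g has_derivative frechet_derivative g (at (f x))) (at (f x))"
  shows "det (jacobian (\<lambda>x. g (f x)) (at x)) = det (jacobian g (at (f x))) * det (jacobian f (at x))"
proof -
  have "((\<lambda>x. g (f x)) has_derivative frechet_derivative g (at (f x)) \<circ> frechet_derivative f (at x)) (at x)"
    using diff_chain_at[OF assms] by (simp add: o_def)
  then have "frechet_derivative (\<lambda>x. g (f x)) (at x) = frechet_derivative g (at (f x)) \<circ> frechet_derivative f (at x)"
    by (rule frechet_derivative_at[symmetric])
  then show ?thesis
    using assms by (simp add: jacobian_def matrix_compose has_derivative_linear det_mul)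
qed

lemma diffeo_jacobian_inverse:
  fixes f :: "real^'n \<Rightarrow> real^'n"
  assumes "diffeo S T f" "x \<in> interior S"
  shows "det (jacobian (inv_into S f) (at (f x))) * det (jacobian f (at x)) = 1"
proof -
  let ?h = "inv_into S f"
  have f: "bij_betw f S T" "smooth_on S f" "smooth_on T ?h"
    using assms by (auto simp: diffeo_def)
  have fx: "f x \<in> interior T" using diffeo_interior_subset[OF assms(1)] assms(2) by blast
  have hf: "y = ?h (f y)" if "y \<in> interior S" for y
    using bij_betw_inv_into_left[OF f(1) subsetD[OF interior_subset that]] by simp
  have "((\<lambda>x. ?h (f x)) has_derivative (\<lambda>v. v)) (at x)"
    by (rule has_derivative_transform_within_open[of "\<lambda>y. y" _ x _ "interior S"])
      (use assms(2) hf in \<open>auto simp: has_derivative_ident\<close>)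
  then have "frechet_derivative (\<lambda>x. ?h (f x)) (at x) = (\<lambda>v. v)" by (rule frechet_derivative_at[symmetric])
  then have "det (jacobian (\<lambda>x. ?h (f x)) (at x)) = 1"
    by (simp add: jacobian_def matrix_id_mat_1[unfolded id_def])
  then show ?thesis
    using jacobian_compose[of f x ?h] smooth_on_has_derivative_interior(1)[OF f(2) assms(2)]
      smooth_on_has_derivative_interior(1)[OF f(3) fx] by simp
qed

lemma oriented_diffeo_compose:
  assumes "oriented_diffeo S T f" "oriented_diffeo T U g" shows "oriented_diffeo S U (\<lambda>x. g (f x))"
proof -
  have d: "diffeo S T f" "diffeo T U g" using assms by (auto simp: oriented_diffeo_def)
  then have s: "smooth_on S f" "smooth_on T g" by (auto simp: diffeo_def)
  have "det (jacobian (\<lambda>x. g (f x)) (at p)) > 0" if p: "p \<in> interior S" for p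
  proof -
    have "f p \<in> interior T" using diffeo_interior_subset[OF d(1)] p by blast
    then show ?thesis
      using assms p jacobian_compose[OF smooth_on_has_derivative_interior(1)[OF s(1) p]
          smooth_on_has_derivative_interior(1)[OF s(2)]]
      by (simp add: oriented_diffeo_def)
  qed
  then show ?thesis using diffeo_compose[OF d] by (simp add: oriented_diffeo_def)
qed

lemma oriented_diffeo_inv_into:
  assumes "oriented_diffeo S T f" shows "oriented_diffeo T S (inv_into S f)"
proof -
  have d: "diffeo S T f" using assms by (auto simp: oriented_diffeo_def)
  have "det (jacobian (inv_into S f) (at p)) > 0" if p: "p \<in> interior T" for p
  proof -
    let ?q = "inv_into S f p"
    have q: "?q \<in> interior S" using diffeo_interior_subset[OF diffeo_inv_into[OF d]] p by blast
    have "f ?q = p" using d p interior_subset[of T]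
      by (metis bij_betw_inv_into_right diffeo_def subsetD)
    then have "det (jacobian (inv_into S f) (at p)) * det (jacobian f (at ?q)) = 1"
      using diffeo_jacobian_inverse[OF d q] by simp
    moreover have "det (jacobian f (at ?q)) > 0" using assms q by (simp add: oriented_diffeo_def)
    ultimately show ?thesis by (metis zero_less_mult_pos2 zero_less_one)
  qed
  then show ?thesis using diffeo_inv_into[OF d] by (simp add: oriented_diffeo_def)
qed

lemma oriented_diffeo_subset:
  assumes "oriented_diffeo S T f" "S' \<subseteq> S" "f ` S' = T'" shows "oriented_diffeo S' T' f"
  using assms diffeo_subset interior_mono unfolding oriented_diffeo_def by blast

lemma Cinf_on_isCont_det_jacobian:
  fixes f :: "real^'n \<Rightarrow> real^'n"
  assumes "Cinf_on f U" "x \<in> U" shows "isCont (\<lambda>x. det (jacobian f (at x))) x"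
proof -
  have o: "open U" using assms(1) Cinf_on_open by blast
  have "Ck_on 0 (\<lambda>x. det (jacobian f (at x))) U"
    unfolding jacobian_def matrix_def
    by (rule Ck_on_det[OF o])
      (use Cinf_on_frechet_derivative[OF assms(1)] in \<open>auto simp: Cinf_on_def simp del: Ck_on.simps intro!: Ck_on_vec_nth\<close>)
  then show ?thesis using o assms(2) continuous_on_eq_continuous_at by (simp add: continuous_on_eq_continuous_at)
qed

text \<open>The Jacobian has no zero in the interior, by \<open>diffeo_jacobian_inverse\<close>, and
  the interior of a convex set is connected. Orientation then has to be checked at one point,
  usually one near which the map is the identity.\<close>

lemma oriented_diffeo_if_positive_somewhere:
  fixes f :: "real^'n \<Rightarrow> real^'n"
  assumes d: "diffeo S T f" and "convex S" and p: "p \<in> interior S" "det (jacobian f (at p)) > 0"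
  shows "oriented_diffeo S T f"
proof -
  let ?J = "\<lambda>x. det (jacobian f (at x))"
  have nz: "?J x \<noteq> 0" if "x \<in> interior S" for x
    using diffeo_jacobian_inverse[OF d that] by force
  have "isCont ?J x" if "x \<in> interior S" for x
    using smooth_on_has_derivative_interior(2)[OF _ that, of f] d Cinf_on_isCont_det_jacobian
    unfolding diffeo_def by blast
  then have "continuous_on (interior S) ?J" by (simp add: continuous_at_imp_continuous_on)
  moreover have "connected (interior S)" using assms(2) by (simp add: convex_connected)
  ultimately have "connected (?J ` interior S)" by (rule connected_continuous_image)
  then have "?J q > 0" if "q \<in> interior S" for q
    using connectedD_interval[of "?J ` interior S" "?J q" "?J p" 0] that p nz
    by (force simp: not_less)
  then show ?thesis using d by (simp add: oriented_diffeo_def)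
qed

lemma jacobian_eq_id:
  fixes f :: "real^'n \<Rightarrow> real^'n"
  assumes "open U" "p \<in> U" "\<And>x. x \<in> U \<Longrightarrow> f x = x"
  shows "det (jacobian f (at p)) = 1"
proof -
  have "(f has_derivative (\<lambda>v. v)) (at p)"
    by (rule has_derivative_transform_within_open[of "\<lambda>y. y" _ p _ U])
      (use assms in \<open>auto simp: has_derivative_ident\<close>)
  then have "frechet_derivative f (at p) = (\<lambda>v. v)" by (rule frechet_derivative_at[symmetric])
  then show ?thesis by (simp add: jacobian_def matrix_id_mat_1[unfolded id_def])
qed

section \<open>Smooth cut-off functions of a real variable\<close>

definition flat :: "nat \<Rightarrow> real \<Rightarrow> real" where
  "flat n x = (if x > 0 then exp (- inverse x) * inverse x ^ n else 0)"

lemma flat_tendsto_0: "(flat n \<longlongrightarrow> 0) (at_right 0)"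
proof (rule Lim_transform_eventually)
  have "((\<lambda>x::real. x ^ n / exp x) \<longlongrightarrow> 0) at_top" by (rule tendsto_power_div_exp_0)
  then show "((\<lambda>x::real. inverse x ^ n / exp (inverse x)) \<longlongrightarrow> 0) (at_right 0)"
    by (rule filterlim_compose) (rule filterlim_inverse_at_top_right)
  show "\<forall>\<^sub>F x in at_right 0. inverse x ^ n / exp (inverse x) = flat n x"
    using eventually_at_right_less[of 0] by eventually_elim (simp add: flat_def exp_minus divide_inverse mult.commute)
qed

text \<open>The powers of \<open>inverse x\<close> make the family \<open>flat n\<close> closed
  under differentiation up to linear combinations, which turns smoothness of
  \<open>exp (- inverse x)\<close> at \<open>0\<close> into an induction. At \<open>0\<close> the
  difference quotient of \<open>flat n\<close> from the right is \<open>flat (n + 1)\<close>, which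
  tends to \<open>0\<close>.\<close>

lemma flat_deriv: "(flat n has_field_derivative flat (n + 2) x - n * flat (n + 1) x) (at x)"
proof -
  consider "x > 0" | "x < 0" | "x = 0" by linarith
  then show ?thesis
  proof cases
    case 1
    have "((\<lambda>x. exp (- inverse x) * inverse x ^ n) has_field_derivative flat (n + 2) x - n * flat (n + 1) x) (at x)"
    proof (rule DERIV_cong)
      show "((\<lambda>x. exp (- inverse x) * inverse x ^ n) has_field_derivative
          exp (- inverse x) * (real n * inverse x ^ (n - 1) * - (inverse x * inverse x)) +
          exp (- inverse x) * (inverse x * inverse x) * inverse x ^ n) (at x)"
        using 1 by (auto intro!: derivative_eq_intros simp: power2_eq_square)
    qed (use 1 in \<open>cases n; auto simp: flat_def algebra_simps\<close>)
    then show ?thesis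
      by (rule has_field_derivative_transform_within_open[of _ _ _ "{0<..}"]) (use 1 in \<open>auto simp: flat_def\<close>)
  next
    case 2
    have "((\<lambda>x. 0) has_field_derivative flat (n + 2) x - n * flat (n + 1) x) (at x)"
      using 2 by (simp add: flat_def)
    then show ?thesis
      by (rule has_field_derivative_transform_within_open[of _ _ _ "{..<0}"]) (use 2 in \<open>auto simp: flat_def\<close>)
  next
    case 3
    have "((\<lambda>y. (flat n y - flat n 0) / (y - 0)) \<longlongrightarrow> 0) (at 0)"
    proof (rule filterlim_split_at)
      show "((\<lambda>y. (flat n y - flat n 0) / (y - 0)) \<longlongrightarrow> 0) (at_left 0)"
        by (rule Lim_transform_eventually[of "\<lambda>_. 0"])
          (auto simp: eventually_at_filter flat_def intro!: always_eventually)
      show "((\<lambda>y. (flat n y - flat n 0) / (y - 0)) \<longlongrightarrow> 0) (at_right 0)"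
        by (rule Lim_transform_eventually[OF flat_tendsto_0[of "Suc n"]])
          (auto simp: eventually_at_filter flat_def divide_inverse mult_ac intro!: always_eventually)
    qed
    then show ?thesis using 3 by (simp add: has_field_derivative_iff flat_def)
  qed
qed

lemma Ck_on_flat: "Ck_on k (flat n) UNIV"
proof (induction k arbitrary: n)
  case 0
  have "isCont (flat n) x" for x using flat_deriv DERIV_isCont by blast
  then show ?case by (simp add: continuous_at_imp_continuous_on)
next
  case (Suc k)
  have "Ck_on k (\<lambda>x. flat (n + 2) x + (- real n) * flat (n + 1) x) UNIV"
    by (intro Ck_on_add Ck_on_bilinear[OF bounded_bilinear_mult] Ck_on_const Suc open_UNIV)
  then show ?case
    by (intro Ck_on_real[OF open_UNIV flat_deriv]) simp
qed

definition step :: "real \<Rightarrow> real" where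
  "step x = flat 0 x / (flat 0 x + flat 0 (1 - x))"

lemma flat_nonneg: "flat 0 x \<ge> 0" and flat_pos: "x > 0 \<Longrightarrow> flat 0 x > 0" and flat_eq_0: "x \<le> 0 \<Longrightarrow> flat 0 x = 0"
  by (auto simp: flat_def)

lemma step_denominator: "flat 0 x + flat 0 (1 - x) > 0"
  using flat_nonneg[of x] flat_nonneg[of "1 - x"] flat_pos[of x] flat_pos[of "1 - x"] by linarith

lemma step_eq_0: "x \<le> 0 \<Longrightarrow> step x = 0"
  by (simp add: step_def flat_eq_0)

lemma step_eq_1: "x \<ge> 1 \<Longrightarrow> step x = 1"
  using flat_pos[of x] by (simp add: step_def flat_eq_0)

lemma step_nonneg: "0 \<le> step x"
  using flat_nonneg[of x] step_denominator[of x] by (simp add: step_def)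

lemma step_le_1: "step x \<le> 1"
  using flat_nonneg[of "1 - x"] step_denominator[of x] by (simp add: step_def)

lemma Cinf_on_step: "Cinf_on step UNIV"
proof -
  have f: "Cinf_on (flat 0) UNIV" by (simp add: Cinf_on_def Ck_on_flat)
  have "Cinf_on (\<lambda>x. flat 0 (1 - x)) UNIV"
    by (rule Cinf_on_compose[OF f]) (auto intro!: Cinf_intros)
  then have "Cinf_on (\<lambda>x. flat 0 x / (flat 0 x + flat 0 (1 - x))) UNIV"
    by (intro Cinf_on_divide Cinf_on_add f) (use step_denominator in \<open>simp_all add: less_imp_neq[symmetric]\<close>)
  then show ?thesis unfolding step_def .
qed

text \<open>The derivative vanishes outside \<open>{a..b}\<close>, where the function is locally
  constant, and is bounded on \<open>{a..b}\<close> by compactness.\<close>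

lemma lipschitz_if_compact_support_1:
  fixes f :: "real \<Rightarrow> 'a::euclidean_space"
  assumes f: "Cinf_on f UNIV" and c: "\<And>x. x \<le> a \<Longrightarrow> f x = c" "\<And>x. x \<ge> b \<Longrightarrow> f x = d"
  obtains K where "K > 0" "\<And>x y. norm (f x - f y) \<le> K * \<bar>x - y\<bar>"
proof -
  let ?D = "\<lambda>x. frechet_derivative f (at x) 1"
  have der: "(f has_vector_derivative ?D x) (at x)" for x
  proof -
    have h: "(f has_derivative frechet_derivative f (at x)) (at x)"
      using Cinf_on_has_derivative[OF f] by simp
    have "frechet_derivative f (at x) s = s *\<^sub>R ?D x" for s
      using linear_scale[OF has_derivative_linear[OF h], of s 1] by simp
    then show ?thesis using h by (metis has_vector_derivative_def ext)
  qed
  have cont: "continuous_on {a..b} ?D"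
    using Cinf_on_continuous_on[OF Cinf_on_frechet_derivative[OF f]] continuous_on_subset by blast
  then have "bounded (?D ` {a..b})" by (intro compact_imp_bounded compact_continuous_image) auto
  then obtain K where K: "K > 0" "\<And>x. x \<in> {a..b} \<Longrightarrow> norm (?D x) \<le> K"
    unfolding bounded_pos by blast
  have "norm (?D x) \<le> K" for x
  proof -
    have 1: "?D x = 0" if "x \<in> U" "open U" "\<And>y. y \<in> U \<Longrightarrow> e = f y" for U and e :: 'a
    proof -
      have "((\<lambda>_. e) has_derivative (\<lambda>_. 0)) (at x)" by simp
      then have "(f has_derivative (\<lambda>_. 0)) (at x)"
        by (rule has_derivative_transform_within_open[OF _ that(2,1,3)])
      then have "frechet_derivative f (at x) = (\<lambda>_. 0)" using frechet_derivative_at by metis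
      then show ?thesis by simp
    qed
    show ?thesis
      using 1[of "{..<a}" c] 1[of "{b<..}" d] c K by (cases "x \<in> {a..b}") force+
  qed
  then have "onorm (\<lambda>s. s *\<^sub>R ?D x) \<le> K" for x
    by (intro onorm_le) (simp add: mult.commute[of K] mult_left_mono)
  then have "norm (f x - f y) \<le> K * \<bar>x - y\<bar>" for x y
    using differentiable_bound[of UNIV f "\<lambda>x s. s *\<^sub>R ?D x" K x y] der
    by (simp add: has_vector_derivative_def)
  then show ?thesis using K(1) that by blast
qed

lemma step_lipschitz: obtains K where "K > 0" "\<And>x y. \<bar>step x - step y\<bar> \<le> K * \<bar>x - y\<bar>"
  using lipschitz_if_compact_support_1[OF Cinf_on_step step_eq_0 step_eq_1] by (metis real_norm_def)

text \<open>The norm is smooth only away from its centre; constancy of \<open>f\<close> below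
  \<open>e\<close> covers the centre itself.\<close>

lemma Cinf_on_radial:
  fixes f :: "real \<Rightarrow> 'b::euclidean_space"
  assumes f: "Cinf_on f UNIV" and c: "\<And>r. r < e \<Longrightarrow> f r = c" "e > 0"
  shows "Cinf_on (\<lambda>x::'a::euclidean_space. f (norm (x - p))) UNIV"
proof (rule Cinf_on_local)
  fix x :: 'a
  show "\<exists>V. x \<in> V \<and> Cinf_on (\<lambda>x. f (norm (x - p))) V"
  proof (cases "x = p")
    case True
    have "Cinf_on (\<lambda>x. f (norm (x - p))) (ball p e)"
      by (rule Cinf_on_cong[OF Cinf_on_const[of _ c]]) (auto simp: c dist_norm norm_minus_commute)
    then show ?thesis using True c by (intro exI[of _ "ball p e"]) auto
  next
    case False
    have "Cinf_on (\<lambda>x. f (norm (x - p))) (- {p})"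
      by (rule Cinf_on_compose[OF f]) (auto intro!: Cinf_on_norm Cinf_intros simp: open_Compl)
    then show ?thesis using False by (intro exI[of _ "- {p}"]) auto
  qed
qed simp

section \<open>Level preserving maps of the cylinder\<close>

definition xs :: "real^4 \<Rightarrow> real^3" where
  "xs p = vector [p $ 2, p $ 3, p $ 4]"

lemma xs_nth [simp]: "xs p $ 1 = p $ 2" "xs p $ 2 = p $ 3" "xs p $ 3 = p $ 4"
  by (simp_all add: xs_def)

lemma xs_pt [simp]: "xs (pt t x) = x"
  by (simp add: vec_eq_iff forall_3)

lemma pt_xs [simp]: "pt (p $ 1) (xs p) = p"
  by (simp add: vec_eq_iff forall_4)

lemma pt_eq_iff: "pt t x = pt s y \<longleftrightarrow> t = s \<and> x = y"
  by (metis pt_nth(1) xs_pt)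

lemma eq_pt_iff: "p = pt t x \<longleftrightarrow> p $ 1 = t \<and> xs p = x"
  by (metis pt_nth(1) xs_pt pt_xs)

lemma pt_cases: obtains t x where "p = pt t x" by (metis pt_xs)

lemma linear_xs: "linear xs"
  by (rule linearI) (simp_all add: vec_eq_iff forall_3)

lemma linear_pt: "linear (\<lambda>(t, x). pt t x)"
  by (rule linearI) (auto simp: vec_eq_iff forall_4)

lemma linear_pt_0: "linear (pt 0)"
  by (rule linearI) (simp_all add: vec_eq_iff forall_4)

lemma pt_add: "pt t x + pt s y = pt (t + s) (x + y)"
  and pt_diff: "pt t x - pt s y = pt (t - s) (x - y)"
  and pt_scaleR: "c *\<^sub>R pt t x = pt (c * t) (c *\<^sub>R x)"
  by (simp_all add: vec_eq_iff forall_4)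

lemma xs_add [simp]: "xs (p + q) = xs p + xs q"
  and xs_diff [simp]: "xs (p - q) = xs p - xs q"
  and xs_scaleR [simp]: "xs (c *\<^sub>R p) = c *\<^sub>R xs p"
  and xs_0 [simp]: "xs 0 = 0"
  by (simp_all add: vec_eq_iff forall_3)

lemmas bounded_linear_xs = linear_xs[unfolded linear_conv_bounded_linear]
  and bounded_linear_pt = linear_pt[unfolded linear_conv_bounded_linear]
  and bounded_linear_pt_0 = linear_pt_0[unfolded linear_conv_bounded_linear]

lemma norm_pt: "norm (pt t x) = sqrt (t\<^sup>2 + (norm x)\<^sup>2)"
  unfolding norm_eq_sqrt_inner by (simp add: inner_vec_def sum_4 sum_3 power2_eq_square add.assoc)

lemma norm_pt_0 [simp]: "norm (pt 0 x) = norm x"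
  by (simp add: norm_pt)

lemma norm_xs_le: "norm (xs p) \<le> norm p"
  by (cases p rule: pt_cases) (simp add: norm_pt real_le_rsqrt)

lemma norm_pt_le: "norm (pt t x) \<le> \<bar>t\<bar> + norm x"
  unfolding norm_pt by (metis abs_norm_cancel sqrt_sum_squares_le_sum_abs)

lemma Cinf_on_pt:
  assumes "Cinf_on f U" "Cinf_on g U" shows "Cinf_on (\<lambda>x. pt (f x) (g x)) U"
proof -
  have "Cinf_on (\<lambda>x. f x *\<^sub>R pt 1 0 + pt 0 (g x)) U"
    by (intro Cinf_intros assms Cinf_on_compose_linear[OF bounded_linear_pt_0] Cinf_on_open[OF assms(1)])
  then show ?thesis by (simp add: pt_scaleR pt_add)
qed

lemma smooth_on_pt: "smooth_on S f \<Longrightarrow> smooth_on S g \<Longrightarrow> smooth_on S (\<lambda>x. pt (f x) (g x))"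
  by (rule smooth_on_binop[of pt]) (rule Cinf_on_pt)

lemma Cinf_on_xs: "Cinf_on f U \<Longrightarrow> Cinf_on (\<lambda>x. xs (f x)) U"
  by (rule Cinf_on_compose_linear[OF bounded_linear_xs])

lemma Cinf_on_nth: "Cinf_on f U \<Longrightarrow> Cinf_on (\<lambda>x. f x $ i) U"
  by (rule Cinf_on_compose_linear[OF bounded_linear_vec_nth])

lemma mem_cylinder: "p \<in> cylinder \<longleftrightarrow> 0 \<le> p $ 1 \<and> p $ 1 \<le> 1 \<and> norm (xs p) \<le> 1"
proof
  assume "0 \<le> p $ 1 \<and> p $ 1 \<le> 1 \<and> norm (xs p) \<le> 1"
  then have "p = pt (p $ 1) (xs p) \<and> p $ 1 \<in> {0..1} \<and> xs p \<in> D3" by simp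
  then show "p \<in> cylinder" unfolding cylinder_def by blast
qed (auto simp: cylinder_def)

lemma pt_mem_cylinder: "pt t x \<in> cylinder \<longleftrightarrow> 0 \<le> t \<and> t \<le> 1 \<and> norm x \<le> 1"
  by (simp add: mem_cylinder)

lemma cylinder_eq: "cylinder = (\<lambda>(t, x). pt t x) ` ({0..1} \<times> D3)"
  by (auto simp: mem_cylinder image_iff eq_pt_iff)

lemma compact_cylinder: "compact cylinder"
  unfolding cylinder_eq
  by (intro compact_continuous_image linear_continuous_on bounded_linear_pt compact_Times) auto

lemma convex_cylinder: "convex cylinder"
  unfolding cylinder_eq by (intro convex_linear_image linear_pt convex_Times) auto

lemma mem_interior_cylinder:
  assumes "0 < p $ 1" "p $ 1 < 1" "norm (xs p) < 1" shows "p \<in> interior cylinder"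
proof (rule interiorI)
  show "open {p. 0 < p $ 1 \<and> p $ 1 < 1 \<and> norm (xs p) < 1}"
    by (intro open_Collect_conj open_Collect_less continuous_intros
        linear_continuous_on[OF bounded_linear_xs])
qed (use assms in \<open>auto simp: mem_cylinder\<close>)

lemma cylinder_subset_closure_interior: "cylinder \<subseteq> closure (interior cylinder)"
  by (rule interior_dense_convex[OF convex_cylinder])
    (use mem_interior_cylinder[of "pt (1/2) 0"] in auto)

section \<open>Level preserving maps and their differentials\<close>

definition lift :: "(real \<Rightarrow> real^3 \<Rightarrow> real^3) \<Rightarrow> real^4 \<Rightarrow> real^4" where
  "lift F p = pt (p $ 1) (F (p $ 1) (xs p))"

lemma lift_pt [simp]: "lift F (pt t x) = pt t (F t x)"
  by (simp add: lift_def)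

lemma smooth_on_lift:
  assumes "smooth_on ({0..1} \<times> D3) (\<lambda>(t, x). F t x)" shows "smooth_on cylinder (lift F)"
proof -
  have "bounded_linear (\<lambda>p::real^4. (p $ 1, xs p))"
    by (intro bounded_linear_Pair bounded_linear_vec_nth bounded_linear_xs)
  then have "smooth_on cylinder (\<lambda>p. case (p $ 1, xs p) of (t, x) \<Rightarrow> F t x)"
    by (intro smooth_on_compose[OF assms] smooth_on_bounded_linear) (auto simp: mem_cylinder)
  then show ?thesis
    unfolding lift_def
    using smooth_on_pt[OF smooth_on_bounded_linear[OF bounded_linear_vec_nth]] by simp
qed

lemma inj_on_lift:
  assumes "\<And>t. t \<in> {0..1} \<Longrightarrow> inj_on (F t) D3" shows "inj_on (lift F) cylinder"
proof (rule inj_onI)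
  fix p q assume pq: "p \<in> cylinder" "q \<in> cylinder" "lift F p = lift F q"
  then have "p $ 1 = q $ 1" "F (p $ 1) (xs p) = F (p $ 1) (xs q)" by (auto simp: lift_def pt_eq_iff)
  then have "xs p = xs q" using inj_onD[OF assms[of "p $ 1"]] pq by (simp add: mem_cylinder)
  then show "p = q" using \<open>p $ 1 = q $ 1\<close> by (metis pt_xs)
qed

lemma lift_image_cylinder:
  assumes "\<And>t. t \<in> {0..1} \<Longrightarrow> F t ` D3 = D3" shows "lift F ` cylinder = cylinder"
proof (intro subset_antisym subsetI)
  fix p assume p: "p \<in> cylinder"
  then have "p $ 1 \<in> {0..1}" "xs p \<in> D3" by (auto simp: mem_cylinder)
  then obtain y where "y \<in> D3" "F (p $ 1) y = xs p" using assms[of "p $ 1"] by (metis imageE)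
  then show "p \<in> lift F ` cylinder"
    using p by (intro image_eqI[of _ _ "pt (p $ 1) y"]) (simp_all add: mem_cylinder)
next
  fix p assume "p \<in> lift F ` cylinder"
  then obtain q where q: "q \<in> cylinder" "p = lift F q" by blast
  then have "q $ 1 \<in> {0..1}" "xs q \<in> D3" by (auto simp: mem_cylinder)
  then have "F (q $ 1) (xs q) \<in> D3" using assms by blast
  then show "p \<in> cylinder" using q by (simp add: lift_def mem_cylinder)
qed

text \<open>The time coordinate \<open>q $ 1\<close> is itself a smooth extension of the first
  coordinate of \<open>lift F\<close>. Uniqueness of the derivative of an extension settles the
  first row of the differential, even at boundary points and for any extension
  \<open>g\<close>.\<close>

lemma lift_derivative_time:
  assumes "Cinf_on g U" "p \<in> U" "p \<in> cylinder" "\<And>q. q \<in> cylinder \<Longrightarrow> q \<in> U \<Longrightarrow> lift F q = g q"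
  shows "frechet_derivative g (at p) v $ 1 = v $ 1"
proof -
  have g1: "Cinf_on (\<lambda>q. g q $ 1) U" using assms(1) by (rule Cinf_on_nth)
  have "frechet_derivative (\<lambda>q. g q $ 1) (at p) = frechet_derivative (\<lambda>q::real^4. q $ 1) (at p)"
  proof (rule frechet_derivative_unique_extension[OF g1 assms(2)])
    show "Cinf_on (\<lambda>q::real^4. q $ 1) UNIV" by (intro Cinf_on_nth Cinf_intros open_UNIV)
    show "p \<in> closure (interior cylinder)" using assms(3) cylinder_subset_closure_interior by blast
    show "g q $ 1 = q $ 1" if "q \<in> cylinder" "q \<in> U" for q
      using assms(4)[OF that] by (metis lift_def pt_nth(1))
  qed simp
  moreover have "((\<lambda>q. g q $ 1) has_derivative (\<lambda>v. frechet_derivative g (at p) v $ 1)) (at p)"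
    by (rule bounded_linear.has_derivative[OF bounded_linear_vec_nth Cinf_on_has_derivative[OF assms(1,2)]])
  moreover have "((\<lambda>q::real^4. q $ 1) has_derivative (\<lambda>v. v $ 1)) (at p)"
    by (rule bounded_linear_imp_has_derivative[OF bounded_linear_vec_nth])
  ultimately show ?thesis by (metis frechet_derivative_at)
qed

text \<open>Restricting \<open>g\<close> to one level gives an extension of the slice map
  \<open>F (p $ 1)\<close>, whose differential does not depend on the extension either. Thus the
  spatial block of the differential is that of the slice.\<close>

lemma lift_derivative_space:
  assumes "Cinf_on g U" "p \<in> U" "p \<in> cylinder" "\<And>q. q \<in> cylinder \<Longrightarrow> q \<in> U \<Longrightarrow> lift F q = g q"
    and k: "Cinf_on k V" "xs p \<in> V" "\<And>y. y \<in> D3 \<Longrightarrow> y \<in> V \<Longrightarrow> F (p $ 1) y = k y"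
  shows "xs (frechet_derivative g (at p) (pt 0 w)) = frechet_derivative k (at (xs p)) w"
proof -
  define t where "t = p $ 1"
  have p: "p = pt t (xs p)" "t \<in> {0..1}" "xs p \<in> D3" using assms(3) by (auto simp: t_def mem_cylinder)
  define U' where "U' = (\<lambda>x. pt t x) -` U"
  have der: "((\<lambda>x. pt t x) has_derivative pt 0) (at x)" for x
  proof -
    have "((\<lambda>x. pt t 0 + pt 0 x) has_derivative (\<lambda>v. pt 0 v)) (at x)"
      by (auto intro!: derivative_eq_intros bounded_linear_imp_has_derivative bounded_linear_pt_0)
    then show ?thesis by (simp add: pt_add)
  qed
  have "open U'"
    unfolding U'_def using Cinf_on_open[OF assms(1)] der
    by (intro continuous_open_vimage has_derivative_continuous) 
  have c: "Cinf_on (\<lambda>x. xs (g (pt t x))) U'"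
    by (intro Cinf_on_xs Cinf_on_compose[OF assms(1)] Cinf_on_pt Cinf_intros \<open>open U'\<close>) (auto simp: U'_def)
  have pU: "xs p \<in> U'" using assms(2) p by (simp add: U'_def)
  have "frechet_derivative (\<lambda>x. xs (g (pt t x))) (at (xs p)) = frechet_derivative k (at (xs p))"
  proof (rule frechet_derivative_unique_extension[OF c pU k(1,2)])
    show "xs p \<in> closure (interior D3)" using p(3) by simp
    fix y assume "y \<in> D3" "y \<in> U'" "y \<in> V"
    then have "lift F (pt t y) = g (pt t y)" "F t y = k y"
      using assms(4)[of "pt t y"] k(3)[of y] p(2) by (simp_all add: U'_def t_def pt_mem_cylinder)
    then show "xs (g (pt t y)) = k y" by (metis lift_pt xs_pt)
  qed
  moreover have "((\<lambda>x. xs (g (pt t x))) has_derivative (\<lambda>w. xs (frechet_derivative g (at p) (pt 0 w)))) (at (xs p))"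
  proof (rule bounded_linear.has_derivative[OF bounded_linear_xs])
    show "((\<lambda>x. g (pt t x)) has_derivative (\<lambda>w. frechet_derivative g (at p) (pt 0 w))) (at (xs p))"
      using diff_chain_at[OF der, of g "frechet_derivative g (at p)" "xs p"]
        Cinf_on_has_derivative[OF assms(1,2)] p(1)[symmetric] by (simp add: o_def)
  qed
  note frechet_derivative_at[OF this]
  ultimately show ?thesis by metis
qed

text \<open>The differential is block triangular: a kernel vector has no time component, hence is
  spatial, and there the slice differential is injective.\<close>

lemma nondegenerate_on_lift:
  assumes "smooth_on cylinder (lift F)" "\<And>t. t \<in> {0..1} \<Longrightarrow> nondegenerate_on D3 (F t)"
  shows "nondegenerate_on cylinder (lift F)"
  unfolding nondegenerate_on_def
proof
  fix p assume p: "p \<in> cylinder"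
  obtain U g where U: "p \<in> U" "Cinf_on g U" "\<And>y. y \<in> cylinder \<Longrightarrow> y \<in> U \<Longrightarrow> lift F y = g y"
    using smooth_onE[OF assms(1) p] by metis
  have pc: "p $ 1 \<in> {0..1}" "xs p \<in> D3" using p by (auto simp: mem_cylinder)
  obtain V k where V: "xs p \<in> V" "Cinf_on k V" "\<And>y. y \<in> D3 \<Longrightarrow> y \<in> V \<Longrightarrow> F (p $ 1) y = k y"
    "inj (frechet_derivative k (at (xs p)))"
    using nondegenerate_onE[OF assms(2)[OF pc(1)] pc(2)] by metis
  have lin: "linear (frechet_derivative g (at p))"
    using Cinf_on_has_derivative[OF U(2,1)] has_derivative_linear by blast
  have link: "linear (frechet_derivative k (at (xs p)))"
    using Cinf_on_has_derivative[OF V(2,1)] has_derivative_linear by blast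
  have "v = 0" if v: "frechet_derivative g (at p) v = 0" for v
  proof -
    have "v $ 1 = 0" using lift_derivative_time[OF U(2,1) p U(3), of v] v by simp
    then have eq: "v = pt 0 (xs v)" by (simp add: eq_pt_iff)
    then have "frechet_derivative k (at (xs p)) (xs v) = 0"
      using lift_derivative_space[OF U(2,1) p U(3) V(2,1,3), of "xs v"] v by simp
    then have "xs v = 0" using V(4) linear_injective_0[OF link] by blast
    then show ?thesis using eq linear_0[OF linear_pt_0] by simp
  qed
  then have "inj (frechet_derivative g (at p))" using linear_injective_0[OF lin] by blast
  then show "\<exists>U g. p \<in> U \<and> Cinf_on g U \<and> (\<forall>y\<in>cylinder \<inter> U. lift F y = g y) \<and>
      inj (frechet_derivative g (at p))"
    using U by blast
qed

lemma diffeo_lift: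
  assumes "smooth_on cylinder (lift F)" "\<And>t. t \<in> {0..1} \<Longrightarrow> nondegenerate_on D3 (F t)"
    and "\<And>t. t \<in> {0..1} \<Longrightarrow> bij_betw (F t) D3 D3"
  shows "diffeo cylinder cylinder (lift F)"
  using diffeo_if_nondegenerate[OF compact_cylinder inj_on_lift nondegenerate_on_lift[OF assms(1,2)]]
    lift_image_cylinder[of F] assms(3) by (simp add: bij_betw_def)

text \<open>The Jacobian of a local extension at \<open>(0, 0)\<close> is a shear, which is the square of a linear map;
  this makes its determinant positive.\<close>

lemma lift_oriented_if_start_id:
  assumes d: "diffeo cylinder cylinder (lift F)" and id: "\<And>x. x \<in> D3 \<Longrightarrow> F 0 x = x"
  shows "oriented_diffeo cylinder cylinder (lift F)"
proof -
  let ?p = "pt 0 0"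
  have p: "?p \<in> cylinder" by (simp add: pt_mem_cylinder)
  obtain U g where U: "?p \<in> U" "Cinf_on g U" "\<And>y. y \<in> cylinder \<Longrightarrow> y \<in> U \<Longrightarrow> lift F y = g y"
    using smooth_onE[of cylinder "lift F", OF _ p] d unfolding diffeo_def by metis
  let ?D = "frechet_derivative g (at ?p)"
  have D1: "?D v $ 1 = v $ 1" for v using lift_derivative_time[OF U(2,1) p U(3)] .
  have Dx: "?D (pt 0 w) = pt 0 w" for w
  proof -
    have "((\<lambda>x::real^3. x) has_derivative (\<lambda>v. v)) (at 0)" by simp
    then have "frechet_derivative (\<lambda>x::real^3. x) (at 0) = (\<lambda>v. v)" by (rule frechet_derivative_at[symmetric])
    then have "xs (?D (pt 0 w)) = w"
      using lift_derivative_space[OF U(2,1) p U(3) Cinf_on_id[OF open_UNIV]] id by simp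
    then show ?thesis using D1[of "pt 0 w"] by (simp add: eq_pt_iff)
  qed
  have linD: "linear ?D"
    using Cinf_on_has_derivative[OF U(2,1)] has_derivative_linear by blast
  define c where "c = ?D (pt 1 0) - pt 1 0"
  have c1: "c $ 1 = 0" using D1[of "pt 1 0"] by (simp add: c_def)
  have D: "?D v = v + (v $ 1) *\<^sub>R c" for v
  proof -
    have "v = (v $ 1) *\<^sub>R pt 1 0 + pt 0 (xs v)" by (simp add: pt_scaleR pt_add)
    then have "?D v = (v $ 1) *\<^sub>R ?D (pt 1 0) + pt 0 (xs v)"
      using linear_add[OF linD] linear_scale[OF linD] Dx by metis
    also have "\<dots> = (v $ 1) *\<^sub>R c + ((v $ 1) *\<^sub>R pt 1 0 + pt 0 (xs v))"
      by (simp add: c_def algebra_simps)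
    finally show ?thesis by (simp add: pt_scaleR pt_add)
  qed
  define B where "B v = v + (v $ 1 / 2) *\<^sub>R c" for v
  have linB: "linear B"
    by (rule linearI) (simp_all add: B_def algebra_simps add_divide_distrib)
  have "?D = B \<circ> B"
    by (rule ext) (simp add: D B_def c1 vec_eq_iff field_simps)
  then have detD: "det (jacobian g (at ?p)) = det (matrix B) * det (matrix B)"
    by (simp add: jacobian_def matrix_compose linB det_mul)
  moreover have "inj ?D"
  proof (rule linear_injective_0[OF linD, THEN iffD2], intro allI impI)
    fix v assume v: "?D v = 0"
    then have "v $ 1 = 0" using D1[of v] by simp
    then show "v = 0" using v D[of v] by simp
  qed
  then have "det (jacobian g (at ?p)) \<noteq> 0"
    using linD by (simp add: jacobian_def det_nz_iff_inj)
  ultimately have "det (jacobian g (at ?p)) > 0"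
    by (metis mult_zero_left not_square_less_zero not_less_iff_gr_or_eq)
  moreover have "((\<lambda>q. det (jacobian g (at q))) \<longlongrightarrow> det (jacobian g (at ?p))) (nhds ?p)"
    using Cinf_on_isCont_det_jacobian[OF U(2,1)]
      tendsto_at_iff_tendsto_nhds[of "\<lambda>q. det (jacobian g (at q))" ?p] by (simp only: isCont_def)
  ultimately have "\<forall>\<^sub>F q in nhds ?p. det (jacobian g (at q)) > 0"
    using order_tendstoD(1)[of "\<lambda>q. det (jacobian g (at q))" _ _ 0] by blast
  then obtain W where W: "open W" "?p \<in> W" "\<And>q. q \<in> W \<Longrightarrow> det (jacobian g (at q)) > 0"
    unfolding eventually_nhds by blast
  \<comment> \<open>The point \<open>?p\<close> lies on the face \<open>t = 0\<close>, where
    \<open>jacobian (lift F)\<close> itself carries no information. For the extension, positivity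
    spreads to a neighbourhood of \<open>?p\<close>, and this contains interior points, at which
    extension and map have the same derivative.\<close>
  have "?p \<in> closure (interior cylinder)" using p cylinder_subset_closure_interior by blast
  then obtain q where q: "q \<in> interior cylinder" "q \<in> U \<inter> W"
    using W(1,2) U(1) Cinf_on_open[OF U(2)] by (metis IntI disjoint_iff open_Int open_Int_closure_eq_empty)
  have "frechet_derivative g (at q) = frechet_derivative (lift F) (at q)"
  proof (rule frechet_derivative_transform_within_open)
    show "g differentiable at q"
      using Cinf_on_has_derivative[OF U(2)] q(2) by (auto simp: differentiable_def)
    show "open (U \<inter> interior cylinder)" "q \<in> U \<inter> interior cylinder"
      using Cinf_on_open[OF U(2)] q by auto
    show "g y = lift F y" if "y \<in> U \<inter> interior cylinder" for y
      using U(3) that subsetD[OF interior_subset] by fastforce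
  qed
  then have "det (jacobian (lift F) (at q)) > 0" using W(3)[of q] q by (simp add: jacobian_def)
  then show ?thesis using oriented_diffeo_if_positive_somewhere[OF d convex_cylinder q(1)] by simp
qed

section \<open>Straightening the arc near the sphere\<close>

text \<open>The operator norm of the derivative is continuous, so the strict bound at
  \<open>x\<close> persists on a ball; balls are convex, so the mean value inequality applies
  there.\<close>

lemma Cinf_on_lipschitz_at:
  fixes f :: "'a::euclidean_space \<Rightarrow> 'b::euclidean_space"
  assumes f: "Cinf_on f U" "x \<in> U" and c: "onorm (frechet_derivative f (at x)) < c"
  obtains e where "e > 0" "ball x e \<subseteq> U"
    "\<And>y z. y \<in> ball x e \<Longrightarrow> z \<in> ball x e \<Longrightarrow> norm (f y - f z) \<le> c * norm (y - z)"
proof -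
  define f' where "f' y = Blinfun (frechet_derivative f (at y))" for y
  have d: "(f has_derivative frechet_derivative f (at y)) (at y)" if "y \<in> U" for y
    using Cinf_on_has_derivative[OF f(1) that] .
  note f' = Cinf_on_blinfun_derivative(1)[OF f(1), folded f'_def]
  have "continuous_on U f'" using Cinf_on_blinfun_derivative(2)[OF f(1)] by (simp add: f'_def[abs_def])
  then have "continuous_on U (\<lambda>y. norm (f' y))" by (intro continuous_intros)
  then have "open (U \<inter> (\<lambda>y. norm (f' y)) -` {..<c})"
    using Cinf_on_open[OF f(1)] by (metis Int_commute continuous_on_open_vimage open_lessThan)
  moreover have "x \<in> U \<inter> (\<lambda>y. norm (f' y)) -` {..<c}"
    using f(2) c f' by (simp add: norm_blinfun.rep_eq)
  ultimately obtain e where e: "e > 0" "ball x e \<subseteq> U \<inter> (\<lambda>y. norm (f' y)) -` {..<c}"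
    by (meson openE)
  show ?thesis
  proof (rule that[OF e(1)])
    show "ball x e \<subseteq> U" using e(2) by blast
    fix y z assume yz: "y \<in> ball x e" "z \<in> ball x e"
    show "norm (f y - f z) \<le> c * norm (y - z)"
    proof (rule differentiable_bound[OF convex_ball _ _ yz])
      fix w assume w: "w \<in> ball x e"
      then show "(f has_derivative frechet_derivative f (at w)) (at w within ball x e)"
        using d e(2) has_derivative_at_withinI by blast
      have "w \<in> U" "norm (f' w) < c" using w e(2) by auto
      then show "onorm (frechet_derivative f (at w)) \<le> c"
        using f' by (simp add: norm_blinfun.rep_eq)
    qed
  qed
qed

text \<open>For \<open>e > 0\<close> an even bump, equal to \<open>1\<close> for
  \<open>\<bar>s\<bar> \<le> e / 2\<close> and to \<open>0\<close> for
  \<open>\<bar>s\<bar> \<ge> e\<close>. Writing it as a product of two steps avoids a case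
  distinction at \<open>s = 0\<close>.\<close>

definition plateau :: "real \<Rightarrow> real \<Rightarrow> real" where
  "plateau e s = step (2 - (2 / e) * s) * step (2 + (2 / e) * s)"

lemma plateau_eq_1: "e > 0 \<Longrightarrow> \<bar>s\<bar> \<le> e / 2 \<Longrightarrow> plateau e s = 1"
  unfolding plateau_def by (subst (1 2) step_eq_1) (auto simp: field_simps abs_le_iff)

lemma plateau_eq_0: assumes "e > 0" "\<bar>s\<bar> \<ge> e" shows "plateau e s = 0"
proof (cases "s \<ge> 0")
  case True
  then have "2 - (2 / e) * s \<le> 0" using assms by (simp add: field_simps)
  then show ?thesis by (simp add: plateau_def step_eq_0)
next
  case False
  then have "2 + (2 / e) * s \<le> 0" using assms by (simp add: field_simps)
  then show ?thesis by (simp add: plateau_def step_eq_0)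
qed

lemma plateau_nonneg: "0 \<le> plateau e s" and plateau_le_1: "plateau e s \<le> 1"
  by (simp_all add: plateau_def step_nonneg step_le_1 mult_le_one)

lemma Cinf_on_plateau: "Cinf_on (plateau e) UNIV"
  unfolding plateau_def
  by (intro Cinf_on_mult Cinf_on_compose[OF Cinf_on_step] Cinf_intros) auto

text \<open>One constant serves all scales. This matters because \<open>e\<close> is later chosen
  depending on \<open>K\<close>.\<close>

lemma plateau_lipschitz:
  obtains K where "K > 0" "\<And>e s t. e > 0 \<Longrightarrow> \<bar>plateau e s - plateau e t\<bar> \<le> K / e * \<bar>s - t\<bar>"
proof -
  obtain K where K: "K > 0" "\<And>x y. \<bar>step x - step y\<bar> \<le> K * \<bar>x - y\<bar>" using step_lipschitz by blast
  have "\<bar>plateau e s - plateau e t\<bar> \<le> (4 * K) / e * \<bar>s - t\<bar>" if "e > 0" for e s t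
  proof -
    let ?a = "\<lambda>s. step (2 - (2 / e) * s)" and ?b = "\<lambda>s. step (2 + (2 / e) * s)"
    have abs: "\<bar>(2 / e) * t - (2 / e) * s\<bar> = 2 / e * \<bar>s - t\<bar>"
    proof -
      have "(2 / e) * t - (2 / e) * s = 2 / e * (t - s)" by (simp add: right_diff_distrib)
      then show ?thesis using that by (simp only: abs_mult) (simp add: abs_minus_commute)
    qed
    have a: "\<bar>?a s - ?a t\<bar> \<le> K * (2 / e * \<bar>s - t\<bar>)"
      using K(2)[of "2 - (2 / e) * s" "2 - (2 / e) * t"] abs by simp
    have b: "\<bar>?b s - ?b t\<bar> \<le> K * (2 / e * \<bar>s - t\<bar>)"
      using K(2)[of "2 + (2 / e) * s" "2 + (2 / e) * t"] abs by (simp add: abs_minus_commute)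
    have "plateau e s - plateau e t = (?a s - ?a t) * ?b s + ?a t * (?b s - ?b t)"
      by (simp add: plateau_def algebra_simps)
    then have "\<bar>plateau e s - plateau e t\<bar> \<le> \<bar>?a s - ?a t\<bar> * \<bar>?b s\<bar> + \<bar>?a t\<bar> * \<bar>?b s - ?b t\<bar>"
      by (metis abs_mult abs_triangle_ineq)
    also have "\<dots> \<le> \<bar>?a s - ?a t\<bar> * 1 + 1 * \<bar>?b s - ?b t\<bar>"
      by (intro add_mono mult_left_mono mult_right_mono) (simp_all add: step_nonneg step_le_1)
    finally show ?thesis using a b by simp
  qed
  then show ?thesis using K(1) that[of "4 * K"] by simp
qed

text \<open>The next bound is what makes the straightening map injective: a cut-off at scale \<open>e\<close> costs only a
  constant factor in the Lipschitz bound because the function being cut off vanishes at \<open>0\<close>.\<close>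

lemma cutoff_lipschitz:
  fixes h :: "real \<Rightarrow> 'a::real_normed_vector"
  assumes "e > 0" "c \<ge> 0" and h0: "h 0 = 0"
    and h: "\<And>s t. \<bar>s\<bar> \<le> e \<Longrightarrow> \<bar>t\<bar> \<le> e \<Longrightarrow> norm (h s - h t) \<le> c * \<bar>s - t\<bar>"
    and K: "K \<ge> 0" "\<And>s t. \<bar>plateau e s - plateau e t\<bar> \<le> K / e * \<bar>s - t\<bar>"
  shows "norm (plateau e s *\<^sub>R h s - plateau e t *\<^sub>R h t) \<le> c * (K + 1) * \<bar>s - t\<bar>"
    and "norm (plateau e s *\<^sub>R h s) \<le> c * e"
proof -
  have b: "norm (h s) \<le> c * e" if "\<bar>s\<bar> \<le> e" for s
    using h[of s 0] that assms(1,2) h0 mult_left_mono[OF that assms(2)] by simp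
  have one: "norm ((plateau e s - plateau e t) *\<^sub>R h s) \<le> c * K * \<bar>s - t\<bar>" if "\<bar>s\<bar> \<le> e" for s t
  proof -
    have "norm ((plateau e s - plateau e t) *\<^sub>R h s) \<le> (K / e * \<bar>s - t\<bar>) * (c * e)"
      unfolding norm_scaleR using K b[OF that] assms by (intro mult_mono) auto
    also have "\<dots> = c * K * \<bar>s - t\<bar>" using assms(1) by (simp add: field_simps)
    finally show ?thesis .
  qed
  have half: "norm (plateau e s *\<^sub>R h s - plateau e t *\<^sub>R h t) \<le> c * (K + 1) * \<bar>s - t\<bar>"
    if s: "\<bar>s\<bar> \<le> e" for s t
  proof (cases "\<bar>t\<bar> \<le> e")
    case True
    have "plateau e s *\<^sub>R h s - plateau e t *\<^sub>R h t =
        (plateau e s - plateau e t) *\<^sub>R h s + plateau e t *\<^sub>R (h s - h t)"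
      by (simp add: algebra_simps)
    then have "norm (plateau e s *\<^sub>R h s - plateau e t *\<^sub>R h t) \<le>
        norm ((plateau e s - plateau e t) *\<^sub>R h s) + plateau e t * norm (h s - h t)"
      by (metis abs_of_nonneg norm_scaleR norm_triangle_ineq plateau_nonneg)
    also have "\<dots> \<le> c * K * \<bar>s - t\<bar> + 1 * (c * \<bar>s - t\<bar>)"
      using one[OF s] h[OF s True] plateau_nonneg plateau_le_1
      by (intro add_mono mult_mono) auto
    finally show ?thesis by (simp add: algebra_simps)
  next
    case False
    then have "plateau e t = 0" using assms(1) by (intro plateau_eq_0) auto
    then have "norm (plateau e s *\<^sub>R h s - plateau e t *\<^sub>R h t) \<le> c * K * \<bar>s - t\<bar>"
      using one[OF s, of t] by simp
    also have "\<dots> \<le> c * (K + 1) * \<bar>s - t\<bar>" using assms(2) by (intro mult_right_mono mult_left_mono) auto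
    finally show ?thesis .
  qed
  show "norm (plateau e s *\<^sub>R h s - plateau e t *\<^sub>R h t) \<le> c * (K + 1) * \<bar>s - t\<bar>"
  proof (cases "\<bar>s\<bar> \<le> e")
    case False
    show ?thesis
    proof (cases "\<bar>t\<bar> \<le> e")
      case True
      show ?thesis using half[OF True, of s] by (metis abs_minus_commute norm_minus_commute)
    next
      case F: False
      then have "plateau e s = 0" "plateau e t = 0" using \<open>\<not> \<bar>s\<bar> \<le> e\<close> assms(1) by (auto intro: plateau_eq_0)
      then show ?thesis using assms(2) K(1) by simp
    qed
  qed (rule half)
  show "norm (plateau e s *\<^sub>R h s) \<le> c * e"
  proof (cases "\<bar>s\<bar> \<le> e")
    case True
    then have "plateau e s * norm (h s) \<le> 1 * (c * e)"
      using b plateau_nonneg plateau_le_1 by (intro mult_mono) auto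
    then show ?thesis by (simp add: plateau_nonneg)
  next
    case False
    then show ?thesis using assms by (simp add: plateau_eq_0)
  qed
qed

text \<open>From \<open>(norm x - norm y) * S = (x - y) \<bullet> (x + y)\<close> with
  \<open>S = norm x + norm y\<close>, where \<open>x + y\<close> differs from
  \<open>S *\<^sub>R p\<close> by a vector of norm at most \<open>4 * r\<close>. Near
  \<open>p\<close> the radius thus varies like the component along \<open>p\<close>, up to an error
  whose factor shrinks with \<open>r\<close>.\<close>

lemma norm_diff_near_unit_vector:
  fixes p x y :: "'a::real_inner"
  assumes p: "norm p = 1" and b: "norm (x - p) \<le> r" "norm (y - p) \<le> r" "r \<le> 1 / 2"
  shows "\<bar>norm x - norm y\<bar> \<le> \<bar>(x - y) \<bullet> p\<bar> + 4 * r * norm (x - y)"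
proof -
  have nx: "\<bar>norm x - 1\<bar> \<le> r" and ny: "\<bar>norm y - 1\<bar> \<le> r"
    using norm_triangle_ineq3[of x p] norm_triangle_ineq3[of y p] p b by auto
  define S where "S = norm x + norm y"
  have S: "S \<ge> 1" using nx ny b(3) by (auto simp: S_def)
  define q where "q = x + y - S *\<^sub>R p"
  have "q = (x - p) + (y - p) - (norm x - 1) *\<^sub>R p - (norm y - 1) *\<^sub>R p"
    by (simp add: q_def S_def algebra_simps)
  then have "norm q \<le> norm (x - p) + norm (y - p) + \<bar>norm x - 1\<bar> + \<bar>norm y - 1\<bar>"
    using norm_triangle_ineq4[of "(x - p) + (y - p) - (norm x - 1) *\<^sub>R p" "(norm y - 1) *\<^sub>R p"]
      norm_triangle_ineq4[of "(x - p) + (y - p)" "(norm x - 1) *\<^sub>R p"] norm_triangle_ineq[of "x - p" "y - p"] p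
    by simp
  then have q: "norm q \<le> 4 * r" using b nx ny by simp
  have "(norm x - norm y) * S = (x - y) \<bullet> (x + y)"
    by (simp add: S_def algebra_simps power2_norm_eq_inner[symmetric] inner_commute power2_eq_square[symmetric])
  also have "\<dots> = S * ((x - y) \<bullet> p) + (x - y) \<bullet> q"
    by (simp add: q_def inner_diff_right)
  finally have "\<bar>norm x - norm y\<bar> * S = \<bar>S * ((x - y) \<bullet> p) + (x - y) \<bullet> q\<bar>"
    using S by (metis abs_mult abs_of_nonneg le_numeral_extra(4) order_trans zero_le_one)
  also have "\<dots> \<le> S * \<bar>(x - y) \<bullet> p\<bar> + norm (x - y) * norm q"
    using Cauchy_Schwarz_ineq2[of "x - y" q] S abs_triangle_ineq[of "S * ((x - y) \<bullet> p)" "(x - y) \<bullet> q"]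
    by (simp add: abs_mult)
  also have "norm (x - y) * norm q \<le> S * (4 * r * norm (x - y))"
  proof -
    have "norm (x - y) * norm q \<le> 1 * (4 * r * norm (x - y))"
      using mult_left_mono[OF q, of "norm (x - y)"] by (simp add: mult_ac)
    also have "\<dots> \<le> S * (4 * r * norm (x - y))"
      using S order_trans[OF norm_ge_zero b(1)] by (intro mult_right_mono) auto
    finally show ?thesis .
  qed
  finally have "\<bar>norm x - norm y\<bar> * S \<le> (\<bar>(x - y) \<bullet> p\<bar> + 4 * r * norm (x - y)) * S"
    by (simp add: algebra_simps)
  then show ?thesis using S by simp
qed

text \<open>The map adds to \<open>x\<close> the deviation \<open>h (1 - norm x)\<close> of the
  curve from the radial segment, cut off in depth by \<open>plateau\<close> and around the end point
  by \<open>\<beta>\<close>. Since \<open>h 0 = 0\<close>, the sphere stays fixed. The deviation has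
  an arbitrary tangential slope, so it is not small in the Lipschitz sense. The normalisation
  \<open>w \<bullet> g 0 = -1\<close> makes the component of \<open>h\<close> along the end point
  vanish to first order: the map is a shear that almost preserves depth, and the difference in depth
  in turn bounds the tangential displacement.\<close>

lemma straighten_endpoint:
  fixes g :: "real \<Rightarrow> 'a::euclidean_space"
  assumes g: "Cinf_on g U" "0 \<in> U" and p: "norm (g 0) = 1"
    and w: "(g has_vector_derivative w) (at 0)" "w \<bullet> g 0 = -1" and "r > 0"
  obtains Z m e where "Cinf_on Z UNIV" "m > 0" "\<And>x y. m * norm (x - y) \<le> norm (Z x - Z y)"
    "\<And>x. norm x = 1 \<Longrightarrow> Z x = x" "\<And>x. norm x \<le> 1/2 \<Longrightarrow> Z x = x"
    "\<And>x. norm (x - g 0) \<ge> r \<Longrightarrow> Z x = x"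
    "e > 0" "\<And>s. 0 \<le> s \<Longrightarrow> s \<le> e \<Longrightarrow> s \<in> U \<and> Z ((1 - s) *\<^sub>R g 0) = g s"
proof -
  define p where "p = g 0"
  have p1: "norm p = 1" using p by (simp add: p_def)
  define h where "h s = g s - (1 - s) *\<^sub>R p" for s
  have hC: "Cinf_on h U" unfolding h_def using g Cinf_on_open by (intro Cinf_intros) blast+
  have hd: "(h has_derivative (\<lambda>s. s *\<^sub>R (w + p))) (at 0)"
    using w(1) unfolding h_def has_vector_derivative_def
    by (auto intro!: derivative_eq_intros simp: algebra_simps)
  have h0: "h 0 = 0" by (simp add: h_def p_def)
  obtain K1 where K1: "K1 > 0" "\<And>x y. \<bar>step x - step y\<bar> \<le> K1 * \<bar>x - y\<bar>" using step_lipschitz by blast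
  obtain K where K: "K > 0" "\<And>e s t. e > 0 \<Longrightarrow> \<bar>plateau e s - plateau e t\<bar> \<le> K / e * \<bar>s - t\<bar>"
    using plateau_lipschitz by blast
  define C where "C = norm (w + p) + 1"
  have C: "C \<ge> 1" by (simp add: C_def)
  define C1 where "C1 = C * (K + 1)"
  have C1: "C1 > 0" using C K(1) by (simp add: C1_def)
  have on: "onorm (\<lambda>s::real. s *\<^sub>R v) \<le> norm v" for v :: "'b::real_normed_vector"
    by (rule onorm_le) (simp add: mult.commute)
  have "frechet_derivative h (at 0) = (\<lambda>s. s *\<^sub>R (w + p))" using frechet_derivative_at[OF hd] by simp
  then have "onorm (frechet_derivative h (at 0)) < C" using on[of "w + p"] by (simp add: C_def)
  from Cinf_on_lipschitz_at[OF hC g(2) this]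
  obtain e1 where e1: "e1 > 0" "ball 0 e1 \<subseteq> U"
    "\<And>s t. s \<in> ball 0 e1 \<Longrightarrow> t \<in> ball 0 e1 \<Longrightarrow> norm (h s - h t) \<le> C * norm (s - t)" by metis
  \<comment> \<open>Chosen so that \<open>C1 * (\<eta> * (K + 1)) = 1 / 8\<close>; with the three
    bounds \<open>1 / 8\<close> built into \<open>b\<close> and \<open>e\<close>, the error terms of
    the final estimate add up to at most \<open>1 / 2\<close>.\<close>
  define \<eta> where "\<eta> = 1 / (8 * C1 * (K + 1))"
  have \<eta>: "\<eta> > 0" using C1 K(1) by (simp add: \<eta>_def)
  define k where "k s = h s \<bullet> p" for s
  have kC: "Cinf_on k U" unfolding k_def using hC Cinf_on_open by (intro Cinf_intros) blast+
  have "(k has_derivative (\<lambda>s. (s *\<^sub>R (w + p)) \<bullet> p)) (at 0)"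
    unfolding k_def by (rule has_derivative_inner_left[OF hd])
  moreover have "(w + p) \<bullet> p = 0"
    using w(2) p1 by (simp add: inner_add_left p_def dot_square_norm)
  ultimately have "(k has_derivative (\<lambda>s. 0)) (at 0)" by simp
  then have "frechet_derivative k (at 0) = (\<lambda>s. 0)" using frechet_derivative_at by metis
  then have "onorm (frechet_derivative k (at 0)) < \<eta>" using \<eta> by (simp add: onorm_zero)
  from Cinf_on_lipschitz_at[OF kC g(2) this]
  obtain e2 where e2: "e2 > 0"
    "\<And>s t. s \<in> ball 0 e2 \<Longrightarrow> t \<in> ball 0 e2 \<Longrightarrow> norm (k s - k t) \<le> \<eta> * norm (s - t)" by metis
  \<comment> \<open>\<open>r / 2\<close> confines the support of \<open>\<beta>\<close> to the ball
    of radius \<open>r\<close>; \<open>1 / 6\<close> makes \<open>3 * b \<le> 1 / 2\<close>, as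
    \<open>norm_diff_near_unit_vector\<close> requires; the last entry gives
    \<open>12 * C1 * b \<le> 1 / 8\<close>.\<close>
  define b where "b = Min {r / 2, 1 / 6, 1 / (96 * C1)}"
  have b: "b > 0" "2 * b \<le> r" "b \<le> 1 / 6" "12 * C1 * b \<le> 1 / 8"
  proof -
    show "b > 0" using \<open>r > 0\<close> C1 by (simp add: b_def)
    have "b \<le> r / 2" "b \<le> 1 / 6" "b \<le> 1 / (96 * C1)" by (simp_all add: b_def)
    then show "2 * b \<le> r" "b \<le> 1 / 6" "12 * C1 * b \<le> 1 / 8" using C1 by (simp_all add: field_simps)
  qed
  \<comment> \<open>The first two entries keep the arguments of \<open>h\<close> and
    \<open>k\<close> in the balls where their Lipschitz bounds hold, the third keeps the ball of
    radius \<open>1 / 2\<close> fixed. \<open>4 * C * e \<le> b\<close> bounds each displacement by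
    \<open>b / 4\<close>, and the last two entries pay for the slope \<open>K1 / b\<close> of
    \<open>\<beta>\<close>.\<close>
  define e where "e = Min {e1 / 2, e2 / 2, 1 / 2, b / (4 * C), b / (8 * K1 * C), b / (8 * K1 * C * C1)}"
  have e: "e > 0" "e < e1" "e < e2" "e \<le> 1 / 2" "4 * C * e \<le> b" "K1 * C * e / b \<le> 1 / 8" "C1 * (K1 * C * e / b) \<le> 1 / 8"
  proof -
    show "e > 0" using e1(1) e2(1) b(1) C K1(1) C1 by (simp add: e_def)
    have "e \<le> e1 / 2" "e \<le> e2 / 2" "e \<le> b / (4 * C)" "e \<le> b / (8 * K1 * C)" "e \<le> b / (8 * K1 * C * C1)"
      by (simp_all add: e_def)
    then show "e < e1" "e < e2" "4 * C * e \<le> b" "K1 * C * e / b \<le> 1 / 8" "C1 * (K1 * C * e / b) \<le> 1 / 8"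
      using e1(1) e2(1) b(1) C K1(1) C1 by (simp_all add: field_simps)
    show "e \<le> 1 / 2" by (simp add: e_def)
  qed
  define \<omega> where "\<omega> s = plateau e s *\<^sub>R h s" for s
  have \<omega>0: "\<omega> s = 0" if "\<bar>s\<bar> \<ge> e" for s using plateau_eq_0[OF e(1) that] by (simp add: \<omega>_def)
  have \<omega>C: "Cinf_on \<omega> UNIV"
  proof (rule Cinf_on_local)
    fix s :: real
    show "\<exists>V. s \<in> V \<and> Cinf_on \<omega> V"
    proof (cases "\<bar>s\<bar> < e1")
      case True
      have "Cinf_on \<omega> (ball 0 e1)"
        unfolding \<omega>_def
        by (intro Cinf_on_scaleR Cinf_on_subset[OF Cinf_on_plateau] Cinf_on_subset[OF hC] e1(2)) auto
      then show ?thesis using True by (intro exI[of _ "ball 0 e1"]) auto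
    next
      case False
      have "Cinf_on \<omega> (- cball 0 e)"
        by (rule Cinf_on_cong[OF Cinf_on_const[of _ 0]]) (auto simp: \<omega>0 open_Compl)
      then show ?thesis using False e(2) by (intro exI[of _ "- cball 0 e"]) auto
    qed
  qed simp
  have hL: "norm (h s - h t) \<le> C * \<bar>s - t\<bar>" if "\<bar>s\<bar> \<le> e" "\<bar>t\<bar> \<le> e" for s t
    using e1(3)[of s t] that e(2) by simp
  have kL: "norm (k s - k t) \<le> \<eta> * \<bar>s - t\<bar>" if "\<bar>s\<bar> \<le> e" "\<bar>t\<bar> \<le> e" for s t
    using e2(2)[of s t] that e(3) by simp
  have \<omega>L: "norm (\<omega> s - \<omega> t) \<le> C1 * \<bar>s - t\<bar>" and \<omega>B: "norm (\<omega> s) \<le> C * e" for s t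
    unfolding \<omega>_def C1_def using cutoff_lipschitz[OF e(1) _ h0 hL, of K] K e(1) C by auto
  have \<omega>p: "\<bar>\<omega> s \<bullet> p - \<omega> t \<bullet> p\<bar> \<le> \<eta> * (K + 1) * \<bar>s - t\<bar>" for s t
    using cutoff_lipschitz(1)[OF e(1) _ _ kL, of K s t] K e(1) \<eta> h0 by (simp add: \<omega>_def k_def)
  define \<beta> where "\<beta> x = step (2 - norm (x - p) / b)" for x
  have \<beta>01: "0 \<le> \<beta> x" "\<beta> x \<le> 1" for x by (simp_all add: \<beta>_def step_nonneg step_le_1)
  have \<beta>1: "\<beta> x = 1" if "norm (x - p) \<le> b" for x
    using that b(1) by (simp add: \<beta>_def step_eq_1 field_simps)
  have \<beta>0: "\<beta> x = 0" if "norm (x - p) \<ge> 2 * b" for x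
    using that b(1) by (simp add: \<beta>_def step_eq_0 field_simps)
  have \<beta>L: "\<bar>\<beta> x - \<beta> y\<bar> \<le> K1 / b * norm (x - y)" for x y
  proof -
    have "\<bar>(2 - norm (x - p) / b) - (2 - norm (y - p) / b)\<bar> \<le> norm (x - y) / b"
      using b(1) norm_triangle_ineq3[of "x - p" "y - p"]
      by (simp add: diff_divide_distrib[symmetric] divide_right_mono abs_minus_commute)
    then show ?thesis
      using order_trans[OF K1(2) mult_left_mono[OF _ less_imp_le[OF K1(1)]]] unfolding \<beta>_def
      by fastforce
  qed
  have \<beta>C: "Cinf_on \<beta> UNIV"
    unfolding \<beta>_def
  proof (rule Cinf_on_radial[where f = "\<lambda>r. step (2 - r / b)" and c = 1, OF _ _ b(1)])
    have "Cinf_on (\<lambda>r. step (2 - inverse b * r)) UNIV"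
      by (intro Cinf_on_compose[OF Cinf_on_step] Cinf_intros) auto
    then show "Cinf_on (\<lambda>r. step (2 - r / b)) UNIV" by (simp add: divide_inverse mult.commute)
    show "step (2 - r / b) = 1" if "r < b" for r
      using that b(1) by (intro step_eq_1) (simp add: field_simps)
  qed
  define q where "q x = \<beta> x *\<^sub>R \<omega> (1 - norm x)" for x
  define Z where "Z x = x + q x" for x
  have ZC: "Cinf_on Z UNIV"
  proof -
    have "Cinf_on (\<lambda>x. \<omega> (1 - norm (x - 0::'a))) UNIV"
    proof (rule Cinf_on_radial[where f = "\<lambda>r. \<omega> (1 - r)" and c = 0 and e = "1/2"])
      show "Cinf_on (\<lambda>r. \<omega> (1 - r)) UNIV"
        by (intro Cinf_on_compose[OF \<omega>C] Cinf_intros) auto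
      show "\<omega> (1 - r) = 0" if "r < 1 / 2" for r
        using that e(4) by (intro \<omega>0) auto
    qed simp
    then show ?thesis unfolding Z_def q_def by (intro Cinf_intros \<beta>C) auto
  qed
  have qB: "norm (q x) \<le> C * e" for x
    unfolding q_def using mult_mono[OF \<beta>01(2) \<omega>B] \<beta>01(1)[of x] by simp
  have qdiff: "q x - q y = (\<beta> x - \<beta> y) *\<^sub>R \<omega> (1 - norm x) + \<beta> y *\<^sub>R (\<omega> (1 - norm x) - \<omega> (1 - norm y))" for x y
    by (simp add: q_def algebra_simps)
  define a where "a = K1 * C * e / b"
  have a: "a \<le> 1 / 8" "C1 * a \<le> 1 / 8" "a \<ge> 0" using e b(1) K1 C by (auto simp: a_def)
  have q1: "norm ((\<beta> x - \<beta> y) *\<^sub>R \<omega> (1 - norm x)) \<le> a * norm (x - y)" for x y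
  proof -
    have "norm ((\<beta> x - \<beta> y) *\<^sub>R \<omega> (1 - norm x)) \<le> (K1 / b * norm (x - y)) * (C * e)"
      unfolding norm_scaleR using \<beta>L[of x y] \<omega>B K1(1) b(1) by (intro mult_mono) auto
    then show ?thesis by (simp add: a_def mult_ac)
  qed
  define m where "m = 1 / (2 * (1 + C1))"
  have m: "m > 0" "m \<le> 1 / 2" "m \<le> 1" using C1 by (auto simp: m_def field_simps)
  have lower: "m * norm (x - y) \<le> norm (Z x - Z y)" for x y
  proof -
    define d where "d = x - y"
    have Zd: "Z x - Z y = d + (q x - q y)" by (simp add: Z_def d_def)
    \<comment> \<open>Outside the support of \<open>\<beta>\<close> nothing moves. Two points at
      distance at least \<open>b\<close> cannot be brought together by displacements of norm at most
      \<open>b / 4\<close>. Only in the third case is the shear estimate needed.\<close>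
    consider "norm (x - p) \<ge> 2 * b \<and> norm (y - p) \<ge> 2 * b" | "norm d \<ge> b"
      | "norm d \<le> b" "norm (x - p) \<le> 3 * b" "norm (y - p) \<le> 3 * b"
    proof -
      have "norm (x - p) \<le> norm d + norm (y - p)" "norm (y - p) \<le> norm d + norm (x - p)"
        using norm_triangle_ineq[of d "y - p"] norm_triangle_ineq4[of "x - p" d] by (simp_all add: d_def)
      then show ?thesis using that by linarith
    qed
    then show ?thesis
    proof cases
      case 1
      then have "Z x - Z y = d" by (simp add: Zd q_def \<beta>0)
      then show ?thesis using m(3) mult_left_le_one_le[of "norm d" m] m(1) by (simp add: d_def)
    next
      case 2
      have "norm d - norm (q x - q y) \<le> norm (Z x - Z y)"
        unfolding Zd by (rule norm_diff_ineq)
      moreover have "norm (q x - q y) \<le> b / 2"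
        using norm_triangle_ineq4[of "q x" "q y"] qB[of x] qB[of y] e(5) by simp
      ultimately have "norm d / 2 \<le> norm (Z x - Z y)" using 2 by linarith
      moreover have "m * norm d \<le> 1 / 2 * norm d" using m(2) by (rule mult_right_mono) simp
      ultimately show ?thesis by (simp add: d_def)
    next
      case 3
      define f where "f = norm (Z x - Z y)"
      have q2: "norm (q x - q y) \<le> a * norm d + C1 * \<bar>norm x - norm y\<bar>"
      proof -
        have "norm (\<beta> y *\<^sub>R (\<omega> (1 - norm x) - \<omega> (1 - norm y))) \<le> 1 * (C1 * \<bar>norm x - norm y\<bar>)"
        proof -
          have "norm (\<omega> (1 - norm x) - \<omega> (1 - norm y)) \<le> C1 * \<bar>norm x - norm y\<bar>"
            using \<omega>L[of "1 - norm x" "1 - norm y"] by (simp add: abs_minus_commute)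
          from mult_mono[OF \<beta>01(2)[of y] this] show ?thesis
            using \<beta>01(1)[of y] by simp
        qed
        then show ?thesis
          unfolding qdiff using q1[of x y] norm_triangle_ineq d_def
          by (smt (verit, best))
      qed
      have q3: "\<bar>(q x - q y) \<bullet> p\<bar> \<le> (a + \<eta> * (K + 1)) * norm d"
      proof -
        have "\<bar>((\<beta> x - \<beta> y) *\<^sub>R \<omega> (1 - norm x)) \<bullet> p\<bar> \<le> a * norm d"
          using Cauchy_Schwarz_ineq2[of "(\<beta> x - \<beta> y) *\<^sub>R \<omega> (1 - norm x)" p] q1[of x y] p1
          by (simp only: mult_1_right d_def)
        moreover have "\<bar>\<beta> y * (\<omega> (1 - norm x) \<bullet> p - \<omega> (1 - norm y) \<bullet> p)\<bar> \<le> \<eta> * (K + 1) * norm d"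
        proof -
          have "\<bar>\<omega> (1 - norm x) \<bullet> p - \<omega> (1 - norm y) \<bullet> p\<bar> \<le> \<eta> * (K + 1) * norm d"
          proof (rule order_trans[OF \<omega>p mult_left_mono])
            show "\<bar>1 - norm x - (1 - norm y)\<bar> \<le> norm d"
              using norm_triangle_ineq3[of x y] by (simp add: d_def abs_minus_commute)
          qed (use \<eta> K(1) in simp)
          then have "\<beta> y * \<bar>\<omega> (1 - norm x) \<bullet> p - \<omega> (1 - norm y) \<bullet> p\<bar> \<le> 1 * (\<eta> * (K + 1) * norm d)"
            using \<beta>01[of y] by (intro mult_mono) auto
          then show ?thesis using \<beta>01[of y] by (simp add: abs_mult)
        qed
        moreover have "(q x - q y) \<bullet> p = ((\<beta> x - \<beta> y) *\<^sub>R \<omega> (1 - norm x)) \<bullet> p +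
            \<beta> y * (\<omega> (1 - norm x) \<bullet> p - \<omega> (1 - norm y) \<bullet> p)"
          unfolding qdiff by (simp add: inner_add_left inner_diff_left)
        ultimately show ?thesis by (simp add: distrib_right)
      qed
      have fp: "\<bar>d \<bullet> p\<bar> \<le> f + (a + \<eta> * (K + 1)) * norm d"
      proof -
        have "d \<bullet> p = (Z x - Z y) \<bullet> p - (q x - q y) \<bullet> p" by (simp add: Zd inner_add_left)
        moreover have "\<bar>(Z x - Z y) \<bullet> p\<bar> \<le> f"
          using Cauchy_Schwarz_ineq2[of "Z x - Z y" p] p1 by (simp add: f_def)
        ultimately show ?thesis using q3 by linarith
      qed
      have n: "\<bar>norm x - norm y\<bar> \<le> \<bar>d \<bullet> p\<bar> + 12 * b * norm d"
        using norm_diff_near_unit_vector[OF p1 3(2,3)] b(3) by (simp add: d_def)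
      \<comment> \<open>The difference of radii in \<open>q2\<close> is replaced by the component of
        \<open>d\<close> along \<open>p\<close>, and that by the image distance \<open>f\<close>
        plus small multiples of \<open>norm d\<close>. The large factor \<open>C1\<close> ends up in
        front of \<open>f\<close>, and the rest is absorbed into \<open>norm d / 2\<close>.\<close>
      have "norm d \<le> f + norm (q x - q y)"
        using norm_triangle_ineq4[of "Z x - Z y" "q x - q y"] by (simp add: Zd f_def)
      also have "\<dots> \<le> f + (a * norm d + C1 * (f + (a + \<eta> * (K + 1)) * norm d + 12 * b * norm d))"
        using q2 n fp C1 by (smt (verit, best) mult_left_mono)
      also have "\<dots> = (1 + C1) * f + (a + C1 * a + C1 * (\<eta> * (K + 1)) + 12 * C1 * b) * norm d"
        by (simp add: algebra_simps)
      also have "\<dots> \<le> (1 + C1) * f + 1 / 2 * norm d"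
      proof -
        have "c * (1 / (8 * c * k) * k) = 1 / 8" if "c \<noteq> 0" "k \<noteq> 0" for c k :: real
          using that by simp
        from this[of C1 "K + 1"] have "C1 * (\<eta> * (K + 1)) = 1 / 8"
          using C1 K(1) by (simp only: \<eta>_def)
        then have "a + C1 * a + C1 * (\<eta> * (K + 1)) + 12 * C1 * b \<le> 1 / 2" using a b(4) by linarith
        then show ?thesis by (intro add_left_mono mult_right_mono) auto
      qed
      finally have "norm d / 2 \<le> (1 + C1) * f" by simp
      then show ?thesis using C1 by (simp add: m_def f_def d_def field_simps)
    qed
  qed
  \<comment> \<open>At depth \<open>s\<close> on the ray of \<open>p\<close> both cut-offs are
    \<open>1\<close>: \<open>plateau\<close> for \<open>s \<le> e / 2\<close>, and
    \<open>\<beta>\<close> for distance at most \<open>b\<close> from \<open>p\<close>, which is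
    \<open>s\<close> as well.\<close>
  have start: "Z ((1 - s) *\<^sub>R p) = g s" "s \<in> U" if "0 \<le> s" "s \<le> min (e / 2) b" for s
  proof -
    have "s < e1" "s \<le> 1/2" using that e by auto
    then show "s \<in> U" using e1(2) that(1) by auto
    have "(1 - s) *\<^sub>R p - p = - (s *\<^sub>R p)" by (simp add: algebra_simps)
    then have "norm ((1 - s) *\<^sub>R p - p) = s" using p1 that(1) by simp
    then have "\<beta> ((1 - s) *\<^sub>R p) = 1" using that by (intro \<beta>1) simp
    moreover have "norm ((1 - s) *\<^sub>R p) = 1 - s" using p1 \<open>s \<le> 1/2\<close> by simp
    moreover have "plateau e s = 1" using that by (intro plateau_eq_1 e) auto
    ultimately show "Z ((1 - s) *\<^sub>R p) = g s" by (simp add: Z_def q_def \<omega>_def h_def)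
  qed
  show ?thesis
  proof (rule that[of Z m "min (e / 2) b"])
    show "Z x = x" if "norm x = 1" for x using that h0 by (simp add: Z_def q_def \<omega>_def)
    show "Z x = x" if "norm x \<le> 1 / 2" for x
      using that e(4) by (simp add: Z_def q_def \<omega>0)
    show "Z x = x" if "norm (x - g 0) \<ge> r" for x
      using that b(2) by (simp add: Z_def q_def \<beta>0 p_def)
  qed (use ZC m lower start e(1) b(1) p_def in auto)
qed

text \<open>The image of the open ball is connected, misses the sphere and is open and relatively closed in
  the ball.\<close>

lemma cball_onto_if_sphere_fixed:
  fixes f :: "'a::euclidean_space \<Rightarrow> 'a"
  assumes f: "continuous_on (cball 0 1) f" "inj_on f (cball 0 1)"
    and fix_sphere: "\<And>x. norm x = 1 \<Longrightarrow> f x = x" and "f 0 = 0"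
  shows "bij_betw f (cball 0 1) (cball 0 1)"
proof -
  have nin: "norm (f x) \<noteq> 1" if "x \<in> ball 0 1" for x
  proof
    assume "norm (f x) = 1"
    then have "f (f x) = f x" by (rule fix_sphere)
    then have "f x = x" using inj_onD[OF f(2)] that \<open>norm (f x) = 1\<close> by fastforce
    then show False using that \<open>norm (f x) = 1\<close> by simp
  qed
  have conn: "connected (f ` ball 0 1)"
    by (intro connected_continuous_image continuous_on_subset[OF f(1)]) auto
  have sub: "f ` ball 0 1 \<subseteq> ball 0 1"
  proof (rule ccontr)
    assume "\<not> f ` ball 0 1 \<subseteq> ball 0 1"
    then obtain x where x: "x \<in> ball 0 1" "f x \<notin> ball 0 1" by blast
    then have x: "x \<in> ball 0 1" "norm (f x) \<ge> 1" by simp_all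
    have c: "connected (norm ` f ` ball 0 1)"
      by (intro connected_continuous_image conn continuous_intros)
    have "norm (f 0) \<in> norm ` f ` ball 0 1" "norm (f x) \<in> norm ` f ` ball 0 1"
      using x by (auto intro!: imageI)
    then have "1 \<in> norm ` f ` ball 0 1"
      by (rule connectedD_interval[OF c]) (use x \<open>f 0 = 0\<close> in simp_all)
    then obtain y where "y \<in> ball 0 1" "norm (f y) = 1" by (metis imageE)
    then show False using nin by blast
  qed
  have op: "open (f ` ball 0 1)"
    by (intro invariance_of_domain continuous_on_subset[OF f(1)] inj_on_subset[OF f(2)]) auto
  have "f ` ball 0 1 = f ` cball 0 1 \<inter> ball 0 1"
  proof -
    have "f x \<in> f ` ball 0 1" if "x \<in> cball 0 1" "f x \<in> ball 0 1" for x
    proof -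
      have "norm x \<noteq> 1" using fix_sphere[of x] that(2) by auto
      then show ?thesis using that(1) by auto
    qed
    then show ?thesis using sub by auto
  qed
  moreover have "closed (f ` cball 0 1)"
    by (intro compact_imp_closed compact_continuous_image f(1)) auto
  ultimately have "f ` ball 0 1 = ball 0 1"
    using connected_clopen[of "ball 0 1 :: 'a set"] op \<open>f 0 = 0\<close>
    by (metis (no_types, lifting) Int_commute centre_in_ball closedin_closed connected_ball convex_ball
        convex_connected empty_iff image_eqI open_subset sub zero_less_one)
  moreover have "f ` sphere 0 1 = sphere 0 1" using fix_sphere by force
  moreover have "(cball 0 1 :: 'a set) = ball 0 1 \<union> sphere 0 1" by auto
  ultimately have "f ` cball 0 1 = cball 0 1" by (simp add: image_Un)
  then show ?thesis using f(2) by (simp add: bij_betw_def)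
qed

lemma smooth_on_differentiable:
  assumes "smooth_on S f" "x \<in> S"
  obtains D where "(f has_derivative D) (at x within S)"
proof -
  obtain U g where U: "x \<in> U" "Cinf_on g U" "\<And>y. y \<in> S \<Longrightarrow> y \<in> U \<Longrightarrow> f y = g y"
    using smooth_onE[OF assms] by metis
  obtain d where d: "d > 0" "ball x d \<subseteq> U" using Cinf_on_open[OF U(2)] U(1) openE by blast
  have "(g has_derivative frechet_derivative g (at x)) (at x within S)"
    using Cinf_on_has_derivative[OF U(2,1)] by (rule has_derivative_at_withinI)
  then have "(f has_derivative frechet_derivative g (at x)) (at x within S)"
    by (rule has_derivative_transform_within[OF _ d(1) assms(2)])
      (use U(3) d(2) in \<open>auto simp: subset_iff dist_commute\<close>)
  then show ?thesis by (rule that)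
qed

text \<open>A reparametrisation \<open>s \<mapsto> l * s\<close> normalises the radial speed to
  \<open>-1\<close>, the form \<open>straighten_endpoint\<close> asks for. Transversality makes the
  radial speed nonzero, and its sign is forced because the arc stays in the ball.\<close>

lemma straighten_arc_at_endpoint:
  fixes \<gamma> :: "real \<Rightarrow> 'a::euclidean_space"
  assumes \<gamma>: "smooth_on {0..1} \<gamma>" "\<gamma> ` {0..1} \<subseteq> cball 0 1" "norm (\<gamma> 0) = 1"
    and v: "(\<gamma> has_vector_derivative v) (at 0 within {0..1})" "v \<bullet> \<gamma> 0 \<noteq> 0" and "r > 0"
  obtains Z m e l where "Cinf_on Z UNIV" "m > 0" "\<And>x y. m * norm (x - y) \<le> norm (Z x - Z y)"
    "\<And>x. norm x = 1 \<Longrightarrow> Z x = x" "\<And>x. norm x \<le> 1/2 \<Longrightarrow> Z x = x"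
    "\<And>x. norm (x - \<gamma> 0) \<ge> r \<Longrightarrow> Z x = x"
    "e > 0" "l > 0" "\<And>s. 0 \<le> s \<Longrightarrow> s \<le> e \<Longrightarrow> l * s \<le> 1 \<and> Z ((1 - s) *\<^sub>R \<gamma> 0) = \<gamma> (l * s)"
proof -
  have 0: "(0::real) \<in> {0..1}" by simp
  obtain U g where U: "0 \<in> U" "Cinf_on g U" "\<And>y. y \<in> {0..1} \<Longrightarrow> y \<in> U \<Longrightarrow> \<gamma> y = g y"
    using smooth_onE[OF \<gamma>(1) 0] by metis
  have g0: "g 0 = \<gamma> 0" using U by simp
  obtain d where d: "d > 0" "ball 0 d \<subseteq> U" using Cinf_on_open[OF U(2)] U(1) openE by blast
  define D where "D = frechet_derivative g (at 0)"
  have gD: "(g has_derivative D) (at 0)" using Cinf_on_has_derivative[OF U(2,1)] by (simp add: D_def)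
  have gD1: "(g has_vector_derivative D 1) (at 0)"
  proof -
    have "D (s *\<^sub>R 1) = s *\<^sub>R D 1" for s :: real
      by (rule linear_scale[OF has_derivative_linear[OF gD]])
    then have "D = (\<lambda>s. s *\<^sub>R D 1)" by (intro ext) (metis mult.right_neutral real_scaleR_def)
    then show ?thesis unfolding has_vector_derivative_def by (rule has_derivative_eq_rhs[OF gD])
  qed
  have "(\<gamma> has_vector_derivative D 1) (at 0 within {0..1})"
    using has_vector_derivative_at_within[OF gD1, of "{0..1}"]
    unfolding has_vector_derivative_def
    by (rule has_derivative_transform_within[OF _ d(1) 0]) (use U(3) d(2) in \<open>auto simp: subset_iff\<close>)
  then have Dv: "D 1 = v"
    using v(1) vector_derivative_unique_within_closed_interval[of 0 1 0 \<gamma> v "D 1"] by simp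
  \<comment> \<open>By Cauchy-Schwarz \<open>\<gamma> s \<bullet> \<gamma> 0 \<le> 1\<close>, with
    equality at \<open>s = 0\<close>, so all difference quotients along \<open>\<gamma> 0\<close>
    are nonpositive.\<close>
  have le: "v \<bullet> \<gamma> 0 \<le> 0"
  proof (rule tendsto_upperbound)
    show "((\<lambda>s. ((g (0 + s *\<^sub>R 1) - g 0) /\<^sub>R s) \<bullet> \<gamma> 0) \<longlongrightarrow> v \<bullet> \<gamma> 0) (at_right 0)"
      using directional_derivative_tendsto[OF gD, of 1] Dv by (intro tendsto_intros) simp
    show "\<forall>\<^sub>F s in at_right 0. ((g (0 + s *\<^sub>R 1) - g 0) /\<^sub>R s) \<bullet> \<gamma> 0 \<le> 0"
      using eventually_at_right_less[of 0] eventually_at_right_real[OF d(1)] eventually_at_right_real[OF zero_less_one]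
    proof (eventually_elim)
      fix s :: real assume "0 < s" "s \<in> {0<..<d}" "s \<in> {0<..<1}"
      then have s: "0 < s" "s < d" "s < 1" by auto
      then have gs: "g s = \<gamma> s" using U(3)[of s] subsetD[OF d(2), of s] by simp
      have "norm (\<gamma> s) \<le> 1" using \<gamma>(2) s by (auto simp: image_subset_iff)
      then have "\<gamma> s \<bullet> \<gamma> 0 \<le> 1"
        using norm_cauchy_schwarz[of "\<gamma> s" "\<gamma> 0"] \<gamma>(3) by simp
      moreover have "\<gamma> 0 \<bullet> \<gamma> 0 = 1" using \<gamma>(3) by (simp add: dot_square_norm)
      ultimately have "(g s - g 0) \<bullet> \<gamma> 0 \<le> 0" by (simp add: gs g0 inner_diff_left)
      then show "((g (0 + s *\<^sub>R 1) - g 0) /\<^sub>R s) \<bullet> \<gamma> 0 \<le> 0"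
        using s(1) by (simp add: mult_le_0_iff divide_le_0_iff)
    qed
  qed simp
  define l where "l = - 1 / (v \<bullet> \<gamma> 0)"
  have l: "l > 0" using le v(2) by (simp add: l_def divide_pos_neg)
  define U' where "U' = (\<lambda>s. l * s) -` U"
  have oU: "open U'"
    unfolding U'_def using Cinf_on_open[OF U(2)] by (intro continuous_open_vimage) (auto intro!: continuous_intros)
  have c: "Cinf_on (\<lambda>s. g (l * s)) U'"
    by (intro Cinf_on_compose[OF U(2)] Cinf_intros oU) (auto simp: U'_def)
  have dv: "((\<lambda>s. g (l * s)) has_vector_derivative l *\<^sub>R v) (at 0)"
  proof -
    have "((\<lambda>s::real. l * s) has_vector_derivative l) (at 0)"
      by (auto intro!: derivative_eq_intros)
    then show ?thesis
      using vector_diff_chain_at[of "\<lambda>s. l * s" l 0 g v] gD1 Dv by (simp add: o_def)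
  qed
  have "(l *\<^sub>R v) \<bullet> g (l * 0) = - 1" using v(2) g0 by (simp add: l_def)
  moreover have "norm (g (l * 0)) = 1" "0 \<in> U'" using \<gamma>(3) g0 U(1) by (auto simp: U'_def)
  ultimately have Zex: "norm (g (l * 0)) = 1" "0 \<in> U'" "(l *\<^sub>R v) \<bullet> g (l * 0) = - 1" by auto
  obtain Z m e where Z: "Cinf_on Z UNIV" "m > 0" "\<And>x y. m * norm (x - y) \<le> norm (Z x - Z y)"
    "\<And>x. norm x = 1 \<Longrightarrow> Z x = x" "\<And>x. norm x \<le> 1/2 \<Longrightarrow> Z x = x"
    "\<And>x. norm (x - g (l * 0)) \<ge> r \<Longrightarrow> Z x = x"
    "e > 0" "\<And>s. 0 \<le> s \<Longrightarrow> s \<le> e \<Longrightarrow> s \<in> U' \<and> Z ((1 - s) *\<^sub>R g (l * 0)) = g (l * s)"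
    using straighten_endpoint[OF c Zex(2,1) dv Zex(3) \<open>r > 0\<close>] by blast
  show ?thesis
  proof (rule that[of Z m "min e (1 / l)" l])
    fix s assume s: "0 \<le> s" "s \<le> min e (1 / l)"
    then have ls: "l * s \<le> 1" "0 \<le> l * s" using l by (auto simp: field_simps)
    moreover have "g (l * s) = \<gamma> (l * s)"
      using U(3)[of "l * s"] Z(8)[of s] s ls by (simp add: U'_def)
    ultimately show "l * s \<le> 1 \<and> Z ((1 - s) *\<^sub>R \<gamma> 0) = \<gamma> (l * s)"
      using Z(8)[of s] s g0 by simp
  qed (use Z l g0 in auto)
qed

text \<open>Each end is straightened by a map that does not disturb the other end. Conversely no
  other part of the arc may enter the shell near the sphere: away from its ends the arc has radius
  at most \<open>1 - \<epsilon>\<close>, while \<open>Z\<close> fixes the sphere and is uniformly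
  continuous, so points of a thin shell are mapped to radius above
  \<open>1 - \<epsilon>\<close>.\<close>

lemma straighten_arc:
  assumes "properly_embedded_arc a"
  obtains Z p q m e where "Cinf_on Z UNIV" "m > 0" "\<And>x y. m * norm (x - y) \<le> norm (Z x - Z y)"
    "\<And>x. norm x = 1 \<Longrightarrow> Z x = x" "\<And>x. norm x \<le> 1/2 \<Longrightarrow> Z x = x"
    "norm p = 1" "norm q = 1" "e > 0"
    "\<And>x. 1 - e < norm x \<Longrightarrow> norm x \<le> 1 \<Longrightarrow> Z x \<in> a \<longleftrightarrow> x = norm x *\<^sub>R p \<or> x = norm x *\<^sub>R q"
proof -
  obtain \<gamma> :: "real \<Rightarrow> real^3" where \<gamma>: "smooth_on {0..1} \<gamma>" "inj_on \<gamma> {0..1}" "\<gamma> ` {0..1} \<subseteq> D3"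
    "\<forall>s\<in>{0..1}. \<gamma> s \<in> S2 \<longleftrightarrow> s = 0 \<or> s = 1"
    "\<forall>s\<in>{0,1}. vector_derivative \<gamma> (at s within {0..1}) \<bullet> \<gamma> s \<noteq> 0" "a = \<gamma> ` {0..1}"
    using assms unfolding properly_embedded_arc_def by metis
  define p where "p = \<gamma> 0" define q where "q = \<gamma> 1"
  have pq: "norm p = 1" "norm q = 1" using \<gamma>(4) by (auto simp: p_def q_def)
  have "p \<noteq> q" using inj_onD[OF \<gamma>(2), of 0 1] by (auto simp: p_def q_def)
  \<comment> \<open>Half the distance of the end points: a point closer than \<open>r\<close> to one
    of them has distance at least \<open>r\<close> from the other, so near one end only the map
    belonging to that end acts.\<close>
  define r where "r = norm (p - q) / 2"
  have r: "r > 0" using \<open>p \<noteq> q\<close> by (simp add: r_def)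
  have vd: "(\<gamma> has_vector_derivative vector_derivative \<gamma> (at s within {0..1})) (at s within {0..1})"
    if "s \<in> {0..1}" for s
    using smooth_on_differentiable[OF \<gamma>(1) that] vector_derivative_works differentiable_def by metis
  have p0: "norm (\<gamma> 0) = 1" using pq by (simp add: p_def)
  have vd0: "(\<gamma> has_vector_derivative vector_derivative \<gamma> (at 0 within {0..1})) (at 0 within {0..1})"
    using vd[of 0] by simp
  have v0: "vector_derivative \<gamma> (at 0 within {0..1}) \<bullet> \<gamma> 0 \<noteq> 0" using \<gamma>(5) by simp
  obtain Z0 m0 e0 l0 where Z0: "Cinf_on Z0 UNIV" "m0 > 0" "\<And>x y. m0 * norm (x - y) \<le> norm (Z0 x - Z0 y)"
    "\<And>x. norm x = 1 \<Longrightarrow> Z0 x = x" "\<And>x. norm x \<le> 1/2 \<Longrightarrow> Z0 x = x"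
    "\<And>x. norm (x - p) \<ge> r \<Longrightarrow> Z0 x = x"
    "e0 > 0" "l0 > 0" "\<And>s. 0 \<le> s \<Longrightarrow> s \<le> e0 \<Longrightarrow> l0 * s \<le> 1 \<and> Z0 ((1 - s) *\<^sub>R p) = \<gamma> (l0 * s)"
    using straighten_arc_at_endpoint[OF \<gamma>(1,3) p0 vd0 v0 r, folded p_def] by blast
  \<comment> \<open>The reversed arc, so that the statement for the parameter value \<open>0\<close>
    also covers the end \<open>q\<close>.\<close>
  define \<delta> where "\<delta> s = \<gamma> (1 - s)" for s
  have \<delta>S: "smooth_on {0..1} \<delta>"
    unfolding \<delta>_def
    by (rule smooth_on_compose[OF \<gamma>(1) smooth_onI_Cinf_on[of _ UNIV]]) (auto intro!: Cinf_intros)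
  have \<delta>D: "\<delta> ` {0..1} \<subseteq> D3" using \<gamma>(3) by (auto simp: \<delta>_def image_subset_iff)
  have "((\<lambda>s::real. 1 - s) has_vector_derivative -1) (at 0 within {0..1})"
    by (auto intro!: derivative_eq_intros)
  moreover have "(\<gamma> has_vector_derivative vector_derivative \<gamma> (at 1 within {0..1})) (at (1 - 0) within (\<lambda>s. 1 - s) ` {0..1::real})"
    using vd[of 1] by (simp add: image_diff_atLeastAtMost)
  ultimately have \<delta>v: "(\<delta> has_vector_derivative -1 *\<^sub>R vector_derivative \<gamma> (at 1 within {0..1})) (at 0 within {0..1})"
    using vector_diff_chain_within[of "\<lambda>s. 1 - s" "-1" 0 "{0..1}" \<gamma>] by (simp add: o_def \<delta>_def[abs_def])
  have \<delta>n: "(-1 *\<^sub>R vector_derivative \<gamma> (at 1 within {0..1})) \<bullet> \<delta> 0 \<noteq> 0" using \<gamma>(5) by (simp add: \<delta>_def)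
  have \<delta>1: "norm (\<delta> 0) = 1" using pq by (simp add: \<delta>_def q_def)
  obtain Z1 m1 e1 l1 where Z1: "Cinf_on Z1 UNIV" "m1 > 0" "\<And>x y. m1 * norm (x - y) \<le> norm (Z1 x - Z1 y)"
    "\<And>x. norm x = 1 \<Longrightarrow> Z1 x = x" "\<And>x. norm x \<le> 1/2 \<Longrightarrow> Z1 x = x"
    "\<And>x. norm (x - \<delta> 0) \<ge> r \<Longrightarrow> Z1 x = x"
    "e1 > 0" "l1 > 0" "\<And>s. 0 \<le> s \<Longrightarrow> s \<le> e1 \<Longrightarrow> l1 * s \<le> 1 \<and> Z1 ((1 - s) *\<^sub>R \<delta> 0) = \<delta> (l1 * s)"
    using straighten_arc_at_endpoint[OF \<delta>S \<delta>D \<delta>1 \<delta>v \<delta>n r] by blast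
  have \<delta>0: "\<delta> 0 = q" by (simp add: \<delta>_def q_def)
  define Z where "Z x = Z1 (Z0 x)" for x
  have inj0: "x = y" if "Z0 x = Z0 y" for x y using Z0(3)[of x y] Z0(2) that by (simp add: mult_le_0_iff)
  have inj1: "x = y" if "Z1 x = Z1 y" for x y using Z1(3)[of x y] Z1(2) that by (simp add: mult_le_0_iff)
  have lower: "m1 * m0 * norm (x - y) \<le> norm (Z x - Z y)" for x y
  proof -
    have "m1 * (m0 * norm (x - y)) \<le> m1 * norm (Z0 x - Z0 y)"
      using Z0(3) Z1(2) by (intro mult_left_mono) auto
    then show ?thesis using Z1(3)[of "Z0 x" "Z0 y"] by (simp add: Z_def mult.assoc)
  qed
  have ZC: "Cinf_on Z UNIV" unfolding Z_def by (rule Cinf_on_compose[OF Z1(1) Z0(1)]) auto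
  define e where "e = Min {e0, e1, r / 2, 1 / 2}"
  have e: "e > 0" "e \<le> e0" "e \<le> e1" "e < r" "e \<le> 1 / 2" using Z0(7) Z1(7) r by (auto simp: e_def min_def)
  have at_p: "Z ((1 - s) *\<^sub>R p) = \<gamma> (l0 * s)" "l0 * s \<le> 1" if s: "0 \<le> s" "s \<le> e" for s
  proof -
    let ?x = "(1 - s) *\<^sub>R p"
    have "?x - p = - (s *\<^sub>R p)" by (simp add: algebra_simps)
    then have "norm (?x - p) < r" using s e pq by simp
    then have "norm (Z0 ?x - p) < r" using Z0(6)[of "Z0 ?x"] inj0 by (metis not_le)
    then have "norm (Z0 ?x - q) \<ge> r"
      using norm_triangle_ineq4[of "Z0 ?x - q" "Z0 ?x - p"] by (simp add: r_def)
    then show "Z ?x = \<gamma> (l0 * s)" using Z1(6)[of "Z0 ?x"] Z0(9)[of s] s e by (simp add: Z_def \<delta>0)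
    show "l0 * s \<le> 1" using Z0(9)[of s] s e by simp
  qed
  have at_q: "Z ((1 - s) *\<^sub>R q) = \<gamma> (1 - l1 * s)" "l1 * s \<le> 1" if s: "0 \<le> s" "s \<le> e" for s
  proof -
    let ?x = "(1 - s) *\<^sub>R q"
    have "(p - ?x) - s *\<^sub>R q = p - q" by (simp add: algebra_simps)
    then have "norm (p - q) \<le> norm (p - ?x) + norm (s *\<^sub>R q)"
      using norm_triangle_ineq4[of "p - ?x" "s *\<^sub>R q"] by metis
    then have "2 * r \<le> norm (p - ?x) + s" using pq s(1) by (simp add: r_def)
    then have "norm (?x - p) \<ge> r" using s e by (simp add: norm_minus_commute)
    then show "Z ?x = \<gamma> (1 - l1 * s)" using Z0(6)[of ?x] Z1(9)[of s] s e by (simp add: Z_def \<delta>_def q_def)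
    show "l1 * s \<le> 1" using Z1(9)[of s] s e by simp
  qed
  have inj: "x = y" if "Z x = Z y" for x y
    using inj0[OF inj1] that unfolding Z_def .
  \<comment> \<open>By compactness the middle part of the arc attains a maximal radius, which is
    less than \<open>1\<close>. If its parameter interval is empty, any positive value does, and
    \<open>1\<close> is taken.\<close>
  obtain \<epsilon> where \<epsilon>: "\<epsilon> > 0" "\<And>u. u \<in> {l0 * e..1 - l1 * e} \<Longrightarrow> norm (\<gamma> u) \<le> 1 - \<epsilon>"
  proof (cases "l0 * e \<le> 1 - l1 * e")
    case True
    have sub: "{l0 * e..1 - l1 * e} \<subseteq> {0<..<1}" using mult_pos_pos[OF Z0(8) e(1)] mult_pos_pos[OF Z1(8) e(1)] by auto
    have sub': "{l0 * e..1 - l1 * e} \<subseteq> {0..1}" using sub by force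
    have "continuous_on {l0 * e..1 - l1 * e} (\<lambda>u. norm (\<gamma> u))"
      by (intro continuous_on_norm continuous_on_subset[OF smooth_on_continuous_on[OF \<gamma>(1)] sub'])
    then obtain u where u: "u \<in> {l0 * e..1 - l1 * e}" "\<And>w. w \<in> {l0 * e..1 - l1 * e} \<Longrightarrow> norm (\<gamma> w) \<le> norm (\<gamma> u)"
      using continuous_attains_sup[of "{l0 * e..1 - l1 * e}"] True by (metis atLeastAtMost_iff compact_Icc empty_iff order_refl)
    have "u \<in> {0..1}" "u \<noteq> 0" "u \<noteq> 1" using subsetD[OF sub u(1)] by auto
    then have "norm (\<gamma> u) < 1" using \<gamma>(3,4) by (force simp: image_subset_iff)
    then show ?thesis using that[of "1 - norm (\<gamma> u)"] u(2) by simp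
  qed (use that[of 1] in auto)
  have "uniformly_continuous_on D3 Z"
    by (intro compact_uniformly_continuous continuous_on_subset[OF Cinf_on_continuous_on[OF ZC]]) auto
  then obtain d where d: "d > 0" "\<And>x y. x \<in> D3 \<Longrightarrow> y \<in> D3 \<Longrightarrow> dist y x < d \<Longrightarrow> dist (Z y) (Z x) < \<epsilon>"
    using \<epsilon>(1) unfolding uniformly_continuous_on_def by metis
  show ?thesis
  proof (rule that[OF ZC _ lower _ _ pq, of "min d e"])
    fix x :: "real^3" assume x: "1 - min d e < norm x" "norm x \<le> 1"
    define s where "s = 1 - norm x"
    have s: "0 \<le> s" "s < d" "s < e" using x by (auto simp: s_def)
    have nx: "norm x = 1 - s" "norm x > 0" using s e by (auto simp: s_def)
    show "Z x \<in> a \<longleftrightarrow> x = norm x *\<^sub>R p \<or> x = norm x *\<^sub>R q"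
    proof
      assume "x = norm x *\<^sub>R p \<or> x = norm x *\<^sub>R q"
      then have "Z x = \<gamma> (l0 * s) \<or> Z x = \<gamma> (1 - l1 * s)"
        using at_p(1)[of s] at_q(1)[of s] s nx by auto
      moreover have "l0 * s \<in> {0..1}" "1 - l1 * s \<in> {0..1}"
        using at_p(2)[of s] at_q(2)[of s] s Z0(8) Z1(8) by auto
      ultimately show "Z x \<in> a" using \<gamma>(6) by auto
    next
      assume "Z x \<in> a"
      then obtain u where u: "u \<in> {0..1}" "Z x = \<gamma> u" using \<gamma>(6) by blast
      define y where "y = x /\<^sub>R norm x"
      have y: "norm y = 1" using nx by (simp add: y_def)
      have "y - x = s *\<^sub>R y" using nx by (simp add: y_def s_def algebra_simps)
      then have "norm (y - x) < d" using y s by simp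
      then have "dist x y < d" by (simp add: dist_norm norm_minus_commute)
      then have "dist (Z x) (Z y) < \<epsilon>" using d(2)[of y x] x y by simp
      moreover have "Z y = y" using y Z0(4) Z1(4) by (simp add: Z_def)
      ultimately have "norm (Z x) > 1 - \<epsilon>"
        using y norm_triangle_ineq2[of y "Z x"] by (simp add: dist_norm norm_minus_commute)
      then have "u \<notin> {l0 * e..1 - l1 * e}" using \<epsilon>(2)[of u] u(2) by auto
      then consider "u < l0 * e" | "1 - u < l1 * e" by force
      then show "x = norm x *\<^sub>R p \<or> x = norm x *\<^sub>R q"
      proof cases
        case 1
        define w where "w = u / l0"
        have w: "0 \<le> w" "w \<le> e" "l0 * w = u" using 1 u(1) Z0(8) by (auto simp: w_def field_simps)
        have xe: "x = (1 - w) *\<^sub>R p" using at_p(1)[OF w(1,2)] w(3) u(2) inj[of x] by simp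
        then have "norm x = 1 - w" using pq w e by simp
        then show ?thesis using xe by simp
      next
        case 2
        define w where "w = (1 - u) / l1"
        have w: "0 \<le> w" "w \<le> e" "l1 * w = 1 - u" using 2 u(1) Z1(8) by (auto simp: w_def field_simps)
        have xe: "x = (1 - w) *\<^sub>R q" using at_q(1)[OF w(1,2)] w(3) u(2) inj[of x] by simp
        then have "norm x = 1 - w" using pq w e by simp
        then show ?thesis using xe by simp
      qed
    qed
  qed (use Z0 Z1 d e in \<open>auto simp: Z_def\<close>)
qed

section \<open>Reparametrising the rays\<close>

text \<open>The same number \<open>e\<close> measures the neighbourhood and the strength of the
  property \<open>R\<close>, and monotonicity allows the minimum over a finite subcover. The uniform
  Lipschitz bound and the uniform radial growth below both have this shape.\<close>

lemma compact_uniform_scale: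
  fixes K :: "'a::metric_space set"
  assumes "compact K"
    and ex: "\<And>x. x \<in> K \<Longrightarrow> \<exists>e>0. \<forall>y\<in>K. dist x y < e \<longrightarrow> R y e"
    and mono: "\<And>y e e'. R y e \<Longrightarrow> 0 < e' \<Longrightarrow> e' \<le> e \<Longrightarrow> R y e'"
  shows "\<exists>e::real. e > 0 \<and> (\<forall>y\<in>K. R y e)"
proof -
  obtain f where f: "\<And>x. x \<in> K \<Longrightarrow> f x > 0 \<and> (\<forall>y\<in>K. dist x y < f x \<longrightarrow> R y (f x))"
    using ex by metis
  obtain X where X: "X \<subseteq> K" "finite X" "K \<subseteq> (\<Union>x\<in>X. ball x (f x))"
    by (rule compactE_image[OF assms(1), of K "\<lambda>x. ball x (f x)"]) (use f in force)+
  define e where "e = Min (insert 1 (f ` X))"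
  have "e > 0" using X f unfolding e_def by (subst Min_gr_iff) auto
  moreover have "R y e" if y: "y \<in> K" for y
  proof -
    obtain x where x: "x \<in> X" "dist x y < f x" using X(3) y by auto
    then have "R y (f x)" using f X(1) y by blast
    moreover have "e \<le> f x" using X(2) x(1) unfolding e_def by (intro Min_le) auto
    ultimately show ?thesis using mono \<open>e > 0\<close> by blast
  qed
  ultimately show ?thesis by blast
qed

text \<open>Without convexity the mean value inequality is only local. Compactness makes it uniform
  for pairs closer than some \<open>e\<close>, with \<open>1 / e\<close> itself as Lipschitz
  constant; for pairs at distance at least \<open>e\<close>, the bound \<open>2 * M\<close> on the
  difference of the values is enough.\<close>

lemma smooth_on_lipschitz:
  assumes f: "smooth_on S f" and "compact S"
  obtains L where "L \<ge> 1" "\<And>x y. x \<in> S \<Longrightarrow> y \<in> S \<Longrightarrow> norm (f x - f y) \<le> L * norm (x - y)"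
proof -
  have "\<exists>e>0. \<forall>y\<in>S. dist x y < e \<longrightarrow> (\<forall>z\<in>S. dist y z < e \<longrightarrow> norm (f y - f z) \<le> (1 / e) * norm (y - z))"
    if x: "x \<in> S" for x
  proof -
    obtain U g where U: "x \<in> U" "Cinf_on g U" "\<And>y. y \<in> S \<Longrightarrow> y \<in> U \<Longrightarrow> f y = g y"
      using smooth_onE[OF f x] by metis
    define c where "c = onorm (frechet_derivative g (at x)) + 1"
    have "onorm (frechet_derivative g (at x)) < c" by (simp add: c_def)
    from Cinf_on_lipschitz_at[OF U(2,1) this] obtain e where e: "e > 0" "ball x e \<subseteq> U"
      "\<And>y z. y \<in> ball x e \<Longrightarrow> z \<in> ball x e \<Longrightarrow> norm (g y - g z) \<le> c * norm (y - z)" by metis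
    have c1: "c \<ge> 1"
      using onorm_pos_le[OF has_derivative_bounded_linear[OF Cinf_on_has_derivative[OF U(2,1)]]]
      by (simp add: c_def)
    define d where "d = min (e / 2) (1 / c)"
    have d: "d > 0" "2 * d \<le> e" "c \<le> 1 / d" using e(1) c1 by (auto simp: d_def min_def field_simps)
    show ?thesis
    proof (intro exI[of _ d] conjI ballI impI d(1))
      fix y z assume yz: "y \<in> S" "dist x y < d" "z \<in> S" "dist y z < d"
      have "dist x z < 2 * d" using yz dist_triangle[of x z y] by linarith
      then have b: "y \<in> ball x e" "z \<in> ball x e" using yz d by auto
      then have "norm (f y - f z) \<le> c * norm (y - z)" using e(2,3) U(3) yz by (metis subsetD)
      also have "\<dots> \<le> (1 / d) * norm (y - z)" by (rule mult_right_mono[OF d(3)]) simp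
      finally show "norm (f y - f z) \<le> 1 / d * norm (y - z)" .
    qed
  qed
  then have "\<exists>e>0. \<forall>y\<in>S. \<forall>z\<in>S. dist y z < e \<longrightarrow> norm (f y - f z) \<le> (1 / e) * norm (y - z)"
  proof (rule compact_uniform_scale[OF assms(2),
        where R = "\<lambda>y e. \<forall>z\<in>S. dist y z < e \<longrightarrow> norm (f y - f z) \<le> (1 / e) * norm (y - z)"])
    fix y and e e' :: real
    assume R: "\<forall>z\<in>S. dist y z < e \<longrightarrow> norm (f y - f z) \<le> (1 / e) * norm (y - z)" "0 < e'" "e' \<le> e"
    have "1 / e * norm (y - z) \<le> 1 / e' * norm (y - z)" for z
      using R(2,3) by (intro mult_right_mono) (auto simp: field_simps)
    then show "\<forall>z\<in>S. dist y z < e' \<longrightarrow> norm (f y - f z) \<le> (1 / e') * norm (y - z)"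
      using R(1,3) by (meson order_less_le_trans order_trans)
  qed
  then obtain e where e: "e > 0"
    "\<And>y. y \<in> S \<Longrightarrow> \<forall>z\<in>S. dist y z < e \<longrightarrow> norm (f y - f z) \<le> (1 / e) * norm (y - z)"
    by blast
  have "bounded (f ` S)"
    by (intro compact_imp_bounded compact_continuous_image smooth_on_continuous_on assms)
  then obtain M where M: "M > 0" "\<And>x. x \<in> S \<Longrightarrow> norm (f x) \<le> M"
    unfolding bounded_pos by blast
  define L where "L = Max {1, 1 / e, 2 * M / e}"
  have L: "L \<ge> 1" "1 / e \<le> L" "2 * M / e \<le> L" by (simp_all add: L_def)
  show ?thesis
  proof (rule that[OF L(1)])
    fix x y assume xy: "x \<in> S" "y \<in> S"
    show "norm (f x - f y) \<le> L * norm (x - y)"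
    proof (cases "dist x y < e")
      case True
      then have "norm (f x - f y) \<le> 1 / e * norm (x - y)" using e(2) xy by blast
      also have "\<dots> \<le> L * norm (x - y)" using L(2) by (rule mult_right_mono) simp
      finally show ?thesis .
    next
      case False
      have "norm (f x - f y) \<le> 2 * M" using norm_triangle_ineq4[of "f x" "f y"] M(2)[OF xy(1)] M(2)[OF xy(2)] by linarith
      also have "\<dots> = 2 * M / e * e" using e(1) by simp
      also have "\<dots> \<le> L * norm (x - y)"
        using L False M(1) e(1) by (intro mult_mono) (auto simp: dist_norm)
      finally show ?thesis .
    qed
  qed
qed

text \<open>A logarithmic cut-off. For a rescaled step the slope times the argument is bounded but
  not small; here \<open>\<theta>\<close> is a step in \<open>k * ln s\<close>, whose slope at
  \<open>s\<close> is at most \<open>K * k / s = \<eta> / s\<close>. The price is that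
  \<open>a\<close> is exponentially smaller than \<open>b\<close>.\<close>

lemma slow_cutoff:
  assumes "\<eta> > 0" "b > 0"
  obtains \<theta> :: "real \<Rightarrow> real" and a where "0 < a" "a < b" "Cinf_on \<theta> UNIV"
    "\<And>s. s \<le> a \<Longrightarrow> \<theta> s = 1" "\<And>s. s \<ge> b \<Longrightarrow> \<theta> s = 0" "\<And>s. 0 \<le> \<theta> s" "\<And>s. \<theta> s \<le> 1"
    "\<And>s t. 0 \<le> t \<Longrightarrow> t \<le> s \<Longrightarrow> \<bar>\<theta> t - \<theta> s\<bar> * t \<le> \<eta> * (s - t)"
proof -
  obtain K where K: "K > 0" "\<And>x y. \<bar>step x - step y\<bar> \<le> K * \<bar>x - y\<bar>" using step_lipschitz by blast
  define k where "k = \<eta> / K"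
  have k: "k > 0" using assms K by (simp add: k_def)
  \<comment> \<open>Makes \<open>k * ln (b / a) = 1\<close>, so that the step is completed exactly
    at \<open>b\<close>.\<close>
  define a where "a = b * exp (- 1 / k)"
  have a: "0 < a" "a < b" using assms k by (simp_all add: a_def)
  define \<theta> where "\<theta> s = (if s \<le> 0 then 1 else 1 - step (k * ln (s / a)))" for s
  have one: "\<theta> s = 1" if "s \<le> a" for s
  proof (cases "s \<le> 0")
    case False
    then have "ln (s / a) \<le> 0" using that a by (simp add: ln_le_zero_iff)
    then have "k * ln (s / a) \<le> 0" using k by (simp add: mult_le_0_iff)
    then show ?thesis by (simp add: \<theta>_def step_eq_0)
  qed (simp add: \<theta>_def)
  show ?thesis
  proof (rule that[OF a])
    show "Cinf_on \<theta> UNIV"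
    proof (rule Cinf_on_local)
      fix s :: real
      have "Cinf_on \<theta> {..<a}"
        by (rule Cinf_on_cong[OF Cinf_on_const[of _ 1]]) (auto simp: one)
      moreover have "Cinf_on \<theta> {0<..}"
      proof (rule Cinf_on_cong)
        show "Cinf_on (\<lambda>s. 1 - step (k * ln (inverse a * s))) {0<..}"
          by (intro Cinf_on_compose[OF Cinf_on_step] Cinf_intros Cinf_on_ln) (use a in auto)
      qed (use a in \<open>auto simp: \<theta>_def divide_inverse mult.commute\<close>)
      ultimately show "\<exists>V. s \<in> V \<and> Cinf_on \<theta> V"
        using a(1) by (cases "s > 0") force+
    qed simp
    show "\<theta> s = 1" if "s \<le> a" for s using one[OF that] .
    show "\<theta> s = 0" if "s \<ge> b" for s
    proof -
      have s: "s > 0" using that assms by simp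
      have "ln (s / a) = ln (s / b) + 1 / k"
        using s assms by (simp add: a_def ln_div ln_mult)
      moreover have "ln (s / b) \<ge> 0" using that assms by simp
      ultimately have "k * ln (s / a) \<ge> 1" using k by (simp add: field_simps)
      then show ?thesis using s by (simp add: \<theta>_def step_eq_1)
    qed
    show "0 \<le> \<theta> s" "\<theta> s \<le> 1" for s by (simp_all add: \<theta>_def step_nonneg step_le_1)
    show "\<bar>\<theta> t - \<theta> s\<bar> * t \<le> \<eta> * (s - t)" if "0 \<le> t" "t \<le> s" for s t
    proof (cases "t = 0")
      case False
      then have t: "t > 0" "s > 0" using that by auto
      have "\<bar>\<theta> t - \<theta> s\<bar> = \<bar>step (k * ln (s / a)) - step (k * ln (t / a))\<bar>" using t by (simp add: \<theta>_def)
      also have "\<dots> \<le> K * \<bar>k * ln (s / a) - k * ln (t / a)\<bar>" by (rule K(2))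
      also have "k * ln (s / a) - k * ln (t / a) = k * ln (s / t)"
        using t a by (simp add: ln_div algebra_simps)
      also have "K * \<bar>k * ln (s / t)\<bar> = \<eta> * ln (s / t)"
      proof -
        have "ln (s / t) \<ge> 0" using t that by simp
        then have "K * \<bar>k * ln (s / t)\<bar> = (K * k) * ln (s / t)" using k by (simp add: abs_mult)
        then show ?thesis using K(1) by (simp add: k_def)
      qed
      also have "\<eta> * ln (s / t) \<le> \<eta> * (s / t - 1)"
        using assms t ln_le_minus_one[of "s / t"] by (intro mult_left_mono) auto
      finally have "\<bar>\<theta> t - \<theta> s\<bar> * t \<le> \<eta> * (s / t - 1) * t" using t by (intro mult_right_mono) auto
      also have "\<eta> * (s / t - 1) * t = \<eta> * (s - t)" using t by (simp add: field_simps)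
      finally show ?thesis .
    qed (use that assms in \<open>simp add: mult_nonneg_nonneg\<close>)
  qed
qed

text \<open>To be applied to \<open>\<Phi> t x = \<phi> t (Z x)\<close> with \<open>Z\<close> the
  straightening map. What is wanted is control of \<open>norm (\<Phi> t x)\<close> near the sphere,
  uniformly in \<open>t\<close>.\<close>

locale boundary_fixing_family =
  fixes \<Phi> :: "real \<Rightarrow> real^3 \<Rightarrow> real^3"
  assumes diffeo: "diffeo cylinder cylinder (lift \<Phi>)"
    and fix_sphere: "\<And>t x. t \<in> {0..1} \<Longrightarrow> norm x = 1 \<Longrightarrow> \<Phi> t x = x"
begin

lemma smooth: "smooth_on cylinder (lift \<Phi>)"
  using diffeo by (simp add: diffeo_def)

lemma bij: "bij_betw (lift \<Phi>) cylinder cylinder"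
  using diffeo by (simp add: diffeo_def)

lemma norm_le_1: assumes "t \<in> {0..1}" "norm x \<le> 1" shows "norm (\<Phi> t x) \<le> 1"
proof -
  have "lift \<Phi> (pt t x) \<in> cylinder"
    using bij assms by (intro bij_betwE[OF bij, rule_format]) (simp add: pt_mem_cylinder)
  then show ?thesis by (simp add: pt_mem_cylinder)
qed

text \<open>Both bounds compare a point with the nearest point of the sphere, which is fixed: the
  first is a Lipschitz bound for the lift, the second one for its inverse.\<close>

lemma norm_bounds:
  obtains L c where "L \<ge> 1" "0 < c" "c \<le> 1"
    "\<And>t x. t \<in> {0..1} \<Longrightarrow> norm x \<le> 1 \<Longrightarrow> 1 - norm (\<Phi> t x) \<le> L * (1 - norm x)"
    "\<And>t x. t \<in> {0..1} \<Longrightarrow> norm x \<le> 1 \<Longrightarrow> c * (1 - norm x) \<le> 1 - norm (\<Phi> t x)"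
proof -
  obtain L where L: "L \<ge> 1"
    "\<And>p q. p \<in> cylinder \<Longrightarrow> q \<in> cylinder \<Longrightarrow> norm (lift \<Phi> p - lift \<Phi> q) \<le> L * norm (p - q)"
    using smooth_on_lipschitz[OF smooth compact_cylinder] by metis
  let ?h = "inv_into cylinder (lift \<Phi>)"
  obtain M where M: "M \<ge> 1"
    "\<And>p q. p \<in> cylinder \<Longrightarrow> q \<in> cylinder \<Longrightarrow> norm (?h p - ?h q) \<le> M * norm (p - q)"
    using smooth_on_lipschitz[of cylinder ?h] diffeo compact_cylinder unfolding diffeo_def by metis
  have unit: "\<exists>y. norm y = 1 \<and> norm (x - y) = 1 - norm x" if "norm x \<le> 1" for x :: "real^3"
  proof (cases "x = 0")
    case True
    then show ?thesis by (intro exI[of _ "axis 1 1"]) (simp add: norm_axis_1)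
  next
    case False
    have "x - x /\<^sub>R norm x = (norm x - 1) *\<^sub>R (x /\<^sub>R norm x)"
      using False by (simp add: algebra_simps)
    then have "norm (x - x /\<^sub>R norm x) = \<bar>norm x - 1\<bar> * norm (x /\<^sub>R norm x)" by (simp only: norm_scaleR)
    also have "\<dots> = 1 - norm x" using False that by simp
    finally have "norm (x - x /\<^sub>R norm x) = 1 - norm x" .
    then show ?thesis using False by (intro exI[of _ "x /\<^sub>R norm x"]) simp
  qed
  show ?thesis
  proof (rule that[OF L(1), of "1 / M"])
    show "0 < 1 / M" "1 / M \<le> 1" using M(1) by auto
    fix t :: real and x :: "real^3" assume tx: "t \<in> {0..1}" "norm x \<le> 1"
    obtain y where y: "norm y = 1" "norm (x - y) = 1 - norm x" using unit[OF tx(2)] by blast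
    have "norm (pt t (\<Phi> t x) - pt t y) \<le> L * norm (pt t x - pt t y)"
      using L(2)[of "pt t x" "pt t y"] tx y fix_sphere by (simp add: pt_mem_cylinder)
    then show "1 - norm (\<Phi> t x) \<le> L * (1 - norm x)"
      using y norm_triangle_ineq2[of y "\<Phi> t x"] by (simp add: pt_diff norm_minus_commute)
    have le: "norm (\<Phi> t x) \<le> 1" using norm_le_1[OF tx] .
    obtain z where z: "norm z = 1" "norm (\<Phi> t x - z) = 1 - norm (\<Phi> t x)" using unit[OF le] by blast
    have hx: "?h (pt t (\<Phi> t x)) = pt t x" "?h (pt t z) = pt t z"
      using bij_betw_inv_into_left[OF bij, of "pt t x"] bij_betw_inv_into_left[OF bij, of "pt t z"]
        tx z fix_sphere by (auto simp: pt_mem_cylinder)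
    have "norm (pt t x - pt t z) \<le> M * norm (pt t (\<Phi> t x) - pt t z)"
      using M(2)[of "pt t (\<Phi> t x)" "pt t z"] hx tx z le by (simp add: pt_mem_cylinder)
    then have "1 - norm x \<le> M * (1 - norm (\<Phi> t x))"
      using z norm_triangle_ineq2[of z x] by (simp add: pt_diff norm_minus_commute)
    then show "1 / M * (1 - norm x) \<le> 1 - norm (\<Phi> t x)" using M(1) by (simp add: field_simps)
  qed
qed

text \<open>By the second bound of \<open>norm_bounds\<close> the inward derivative of
  \<open>norm (\<Phi> t x)\<close> at the sphere is at most \<open>- c\<close>. By continuity the
  derivative along the position vector exceeds \<open>c / 2\<close> near each lateral boundary
  point, and compactness gives a common shell.\<close>

lemma radial_growth:
  obtains e where "0 < e" "e \<le> 1"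
    "\<And>t x r1 r2. t \<in> {0..1} \<Longrightarrow> norm x = 1 \<Longrightarrow> 1 - e \<le> r1 \<Longrightarrow> r1 \<le> r2 \<Longrightarrow> r2 \<le> 1 \<Longrightarrow>
       e * (r2 - r1) \<le> norm (\<Phi> t (r2 *\<^sub>R x)) - norm (\<Phi> t (r1 *\<^sub>R x))"
proof -
  define K where "K = {p \<in> cylinder. norm (xs p) = 1}"
  have "closed {p. norm (xs p) = 1}"
    by (intro closed_Collect_eq continuous_intros linear_continuous_on[OF bounded_linear_xs])
  then have "compact (cylinder \<inter> {p. norm (xs p) = 1})" by (rule compact_Int_closed[OF compact_cylinder])
  then have K: "compact K" by (simp add: K_def Collect_conj_eq Int_commute)
  \<comment> \<open>One number is shell depth and growth rate, as
    \<open>compact_uniform_scale\<close> requires; a smaller \<open>e\<close> weakens the condition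
    in both roles.\<close>
  define R where "R p e \<longleftrightarrow> (\<forall>r1 r2. 1 - e \<le> r1 \<longrightarrow> r1 \<le> r2 \<longrightarrow> r2 \<le> 1 \<longrightarrow>
       e * (r2 - r1) \<le> norm (\<Phi> (p $ 1) (r2 *\<^sub>R xs p)) - norm (\<Phi> (p $ 1) (r1 *\<^sub>R xs p)))" for p and e :: real
  obtain L c where Lc: "L \<ge> 1" "0 < c" "c \<le> 1"
    "\<And>t x. t \<in> {0..1} \<Longrightarrow> norm x \<le> 1 \<Longrightarrow> 1 - norm (\<Phi> t x) \<le> L * (1 - norm x)"
    "\<And>t x. t \<in> {0..1} \<Longrightarrow> norm x \<le> 1 \<Longrightarrow> c * (1 - norm x) \<le> 1 - norm (\<Phi> t x)"
    using norm_bounds by blast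
  have "\<exists>e>0. \<forall>p\<in>K. dist p0 p < e \<longrightarrow> R p e" if p0: "p0 \<in> K" for p0
  proof -
    have p0c: "p0 \<in> cylinder" "norm (xs p0) = 1" "p0 $ 1 \<in> {0..1}"
      using p0 by (auto simp: K_def mem_cylinder)
    obtain U0 g where U0: "p0 \<in> U0" "Cinf_on g U0" "\<And>y. y \<in> cylinder \<Longrightarrow> y \<in> U0 \<Longrightarrow> lift \<Phi> y = g y"
      using smooth_onE[OF smooth p0c(1)] by metis
    \<comment> \<open>Removing the zeros of \<open>xs (g p)\<close> makes the radius
      \<open>N\<close> of the extension smooth; \<open>p0\<close> is kept, since
      \<open>lift \<Phi>\<close> fixes it.\<close>
    define U where "U = U0 \<inter> (\<lambda>p. xs (g p)) -` (- {0})"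
    have "continuous_on U0 (\<lambda>p. xs (g p))" using Cinf_on_continuous_on[OF Cinf_on_xs[OF U0(2)]] .
    then have oU: "open U"
      unfolding U_def using Cinf_on_open[OF U0(2)]
      by (metis Int_commute continuous_on_open_vimage open_Compl closed_singleton)
    have "g p0 = p0"
      using U0(3)[OF p0c(1) U0(1)] fix_sphere[OF p0c(3,2)] by (simp add: lift_def)
    then have p0U: "p0 \<in> U" using U0(1) p0c by (auto simp: U_def)
    define N where "N p = norm (xs (g p))" for p
    have NC: "Cinf_on N U"
      unfolding N_def
      by (intro Cinf_on_norm Cinf_on_xs Cinf_on_subset[OF U0(2) oU]) (auto simp: U_def)
    have N: "N p = norm (\<Phi> (p $ 1) (xs p))" if "p \<in> cylinder" "p \<in> U" for p
      using U0(3)[of p] that by (simp add: N_def U_def lift_def) (metis lift_def xs_pt)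
    have NE: "(N has_derivative frechet_derivative N (at q)) (at q)" if "q \<in> U" for q
      by (rule Cinf_on_has_derivative[OF NC that])
    \<comment> \<open>The derivative of \<open>N\<close> along the spatial position vector, written
      out in the basis so that its smoothness in \<open>q\<close> is visible.\<close>
    define E where "E q = (\<Sum>b\<in>Basis. (xs q \<bullet> b) * frechet_derivative N (at q) (pt 0 b))" for q
    have EC: "Cinf_on E U"
      unfolding E_def
      by (intro Cinf_on_sum oU Cinf_on_mult Cinf_on_inner Cinf_on_const
          Cinf_on_frechet_derivative[OF NC] Cinf_on_xs Cinf_on_id)
    have E: "E q = frechet_derivative N (at q) (pt 0 (xs q))" if "q \<in> U" for q
    proof -
      have "pt 0 (xs q) = (\<Sum>b\<in>Basis. (xs q \<bullet> b) *\<^sub>R pt 0 b)"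
        by (subst euclidean_representation[of "xs q", symmetric])
          (simp only: linear_sum[OF linear_pt_0] linear_scale[OF linear_pt_0])
      then show ?thesis
        using has_derivative_linear[OF NE[OF that]] by (simp add: E_def linear_sum linear_scale)
    qed
    define x0 where "x0 = xs p0" define t0 where "t0 = p0 $ 1"
    have p0e: "p0 = pt t0 x0" by (simp add: x0_def t0_def)
    obtain d0 where d0: "d0 > 0" "ball p0 d0 \<subseteq> U" using oU p0U openE by blast
    have "frechet_derivative N (at p0) (- pt 0 x0) \<le> - c"
    proof (rule tendsto_upperbound[OF directional_derivative_tendsto[OF NE[OF p0U]]])
      show "\<forall>\<^sub>F s in at_right 0. (N (p0 + s *\<^sub>R - pt 0 x0) - N p0) /\<^sub>R s \<le> - c"
        using eventually_at_right_less[of 0] eventually_at_right_real[OF d0(1)] eventually_at_right_real[OF zero_less_one]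
      proof (eventually_elim)
        fix s :: real assume "0 < s" "s \<in> {0<..<d0}" "s \<in> {0<..<1}"
        then have s: "0 < s" "s < d0" "s < 1" by auto
        have eq: "p0 + s *\<^sub>R - pt 0 x0 = pt t0 ((1 - s) *\<^sub>R x0)"
          by (simp add: p0e vec_eq_iff forall_4 algebra_simps)
        have nx: "norm x0 = 1" "t0 \<in> {0..1}" using p0c by (auto simp: x0_def t0_def)
        have nx1: "norm ((1 - s) *\<^sub>R x0) = 1 - s" using nx s by simp
        have c1: "pt t0 ((1 - s) *\<^sub>R x0) \<in> cylinder" using nx nx1 s by (simp add: pt_mem_cylinder)
        have "dist p0 (p0 + s *\<^sub>R - pt 0 x0) = s" using nx s by (simp add: dist_norm)
        then have "p0 + s *\<^sub>R - pt 0 x0 \<in> U" using subsetD[OF d0(2)] s by (simp only: mem_ball)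
        then have "N (p0 + s *\<^sub>R - pt 0 x0) = norm (\<Phi> t0 ((1 - s) *\<^sub>R x0))"
          using N[OF c1] unfolding eq by simp
        also have "\<dots> \<le> 1 - c * s" using Lc(5)[OF nx(2), of "(1 - s) *\<^sub>R x0"] nx1 s by simp
        finally have "N (p0 + s *\<^sub>R - pt 0 x0) - N p0 \<le> - (c * s)"
          using N[OF p0c(1) p0U] fix_sphere[OF nx(2,1)] nx by (simp add: x0_def t0_def)
        then show "(N (p0 + s *\<^sub>R - pt 0 x0) - N p0) /\<^sub>R s \<le> - c"
          using s(1) by (simp add: field_simps)
      qed
    qed simp
    then have "E p0 \<ge> c"
      using E[OF p0U] linear_neg[OF has_derivative_linear[OF NE[OF p0U]]] by (simp add: x0_def)
    then have "p0 \<in> U \<inter> E -` {c / 2<..}" using p0U Lc(2) by simp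
    moreover have "open (U \<inter> E -` {c / 2<..})"
      using oU Cinf_on_continuous_on[OF EC] by (metis Int_commute continuous_on_open_vimage open_greaterThan)
    ultimately obtain \<epsilon> where \<epsilon>: "\<epsilon> > 0" "ball p0 \<epsilon> \<subseteq> U \<inter> E -` {c / 2<..}" by (meson openE)
    define d where "d = min (\<epsilon> / 2) (c / 2)"
    have d: "d > 0" "d \<le> \<epsilon> / 2" "d \<le> c / 2" "d \<le> 1 / 2" using \<epsilon>(1) Lc(2,3) by (auto simp: d_def)
    have "R p d" if p: "p \<in> K" "dist p0 p < d" for p
      unfolding R_def
    proof (intro allI impI)
      fix r1 r2 :: real assume r: "1 - d \<le> r1" "r1 \<le> r2" "r2 \<le> 1"
      define t where "t = p $ 1" define x where "x = xs p"
      have tx: "t \<in> {0..1}" "norm x = 1" "p = pt t x" using p(1) by (auto simp: K_def t_def x_def mem_cylinder)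
      have qU: "pt t (r *\<^sub>R x) \<in> U" "E (pt t (r *\<^sub>R x)) > c / 2" "pt t (r *\<^sub>R x) \<in> cylinder"
        if "1 - d \<le> r" "r \<le> 1" for r
      proof -
        have r0: "0 \<le> r" using that d by simp
        have "p - pt t (r *\<^sub>R x) = (1 - r) *\<^sub>R pt 0 x"
          by (simp add: tx(3) vec_eq_iff forall_4 algebra_simps)
        then have "dist p (pt t (r *\<^sub>R x)) \<le> d" using tx(2) that by (simp add: dist_norm)
        then have "dist p0 (pt t (r *\<^sub>R x)) < \<epsilon>"
          using p(2) d(2) dist_triangle[of p0 "pt t (r *\<^sub>R x)" p] by linarith
        then have "pt t (r *\<^sub>R x) \<in> U \<inter> E -` {c / 2<..}" using subsetD[OF \<epsilon>(2)] by (simp only: mem_ball)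
        then show "pt t (r *\<^sub>R x) \<in> U" "E (pt t (r *\<^sub>R x)) > c / 2" by auto
        show "pt t (r *\<^sub>R x) \<in> cylinder" using tx that r0 by (simp add: pt_mem_cylinder)
      qed
      define f where "f r = N (pt t (r *\<^sub>R x)) - d * r" for r
      have "f r1 \<le> f r2"
      proof (rule DERIV_nonneg_imp_nondecreasing[OF r(2)])
        fix r assume "r1 \<le> r" "r \<le> r2"
        then have rr: "1 - d \<le> r" "r \<le> 1" "r > 0" using r d(4) by auto
        let ?D = "frechet_derivative N (at (pt t (r *\<^sub>R x)))"
        have lin: "linear ?D" by (rule has_derivative_linear[OF NE[OF qU(1)[OF rr(1,2)]]])
        have "((\<lambda>r. pt t 0 + r *\<^sub>R pt 0 x) has_derivative (\<lambda>h. h *\<^sub>R pt 0 x)) (at r)"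
          by (auto intro!: derivative_eq_intros)
        moreover have "(\<lambda>r. pt t 0 + r *\<^sub>R pt 0 x) = (\<lambda>r. pt t (r *\<^sub>R x))"
          by (simp add: pt_scaleR pt_add)
        ultimately have "((\<lambda>r. pt t (r *\<^sub>R x)) has_derivative (\<lambda>h. h *\<^sub>R pt 0 x)) (at r)" by simp
        from diff_chain_at[OF this, of N ?D]
        have "((\<lambda>r. N (pt t (r *\<^sub>R x))) has_derivative (\<lambda>h. ?D (h *\<^sub>R pt 0 x))) (at r)"
          using NE[OF qU(1)[OF rr(1,2)]] by (simp add: o_def)
        moreover have "(\<lambda>h. ?D (h *\<^sub>R pt 0 x)) = (\<lambda>h. ?D (pt 0 x) * h)"
          using linear_scale[OF lin] by (auto simp: mult.commute)
        ultimately have "((\<lambda>r. N (pt t (r *\<^sub>R x))) has_field_derivative ?D (pt 0 x)) (at r)"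
          by (simp add: has_field_derivative_def)
        then have der: "(f has_field_derivative ?D (pt 0 x) - d) (at r)"
          unfolding f_def by (auto intro!: derivative_eq_intros)
        have "E (pt t (r *\<^sub>R x)) = ?D (r *\<^sub>R pt 0 x)"
          using E[OF qU(1)[OF rr(1,2)]] by (simp add: pt_scaleR)
        then have "c / 2 < r * ?D (pt 0 x)" using qU(2)[OF rr(1,2)] linear_scale[OF lin] by simp
        moreover from this have "?D (pt 0 x) > 0"
          using rr(3) Lc(2) by (metis half_gt_zero order_less_trans zero_less_mult_pos)
        ultimately have "c / 2 < ?D (pt 0 x)"
          using rr(2) mult_left_le_one_le[of "?D (pt 0 x)" r] rr(3) by linarith
        then show "\<exists>y. (f has_field_derivative y) (at r) \<and> 0 \<le> y"
          using der d(3) by (intro exI[of _ "?D (pt 0 x) - d"]) simp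
      qed
      then show "d * (r2 - r1) \<le> norm (\<Phi> (p $ 1) (r2 *\<^sub>R xs p)) - norm (\<Phi> (p $ 1) (r1 *\<^sub>R xs p))"
        using N[OF qU(3,1)[of r1]] N[OF qU(3,1)[of r2]] r
        by (simp add: f_def t_def x_def algebra_simps)
    qed
    then show ?thesis using d(1) by blast
  qed
  then have "\<exists>e>0. \<forall>p\<in>K. R p e"
  proof (rule compact_uniform_scale[OF K, where R = R])
    fix p and e e' :: real assume R: "R p e" "0 < e'" "e' \<le> e"
    show "R p e'"
      unfolding R_def
    proof (intro allI impI)
      fix r1 r2 assume r: "1 - e' \<le> r1" "r1 \<le> r2" "r2 \<le> 1"
      have "e' * (r2 - r1) \<le> e * (r2 - r1)" using R(3) r by (intro mult_right_mono) auto
      also have "\<dots> \<le> norm (\<Phi> (p $ 1) (r2 *\<^sub>R xs p)) - norm (\<Phi> (p $ 1) (r1 *\<^sub>R xs p))"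
        using R r unfolding R_def by auto
      finally show "e' * (r2 - r1) \<le> norm (\<Phi> (p $ 1) (r2 *\<^sub>R xs p)) - norm (\<Phi> (p $ 1) (r1 *\<^sub>R xs p))" .
    qed
  qed
  then obtain e where e: "e > 0" "\<And>p. p \<in> K \<Longrightarrow> R p e" by blast
  have "R p (min e 1)" if "p \<in> K" for p
    unfolding R_def
  proof (intro allI impI)
    fix r1 r2 assume r: "1 - min e 1 \<le> r1" "r1 \<le> r2" "r2 \<le> 1"
    have "min e 1 * (r2 - r1) \<le> e * (r2 - r1)" using r by (intro mult_right_mono) auto
    then show "min e 1 * (r2 - r1) \<le> norm (\<Phi> (p $ 1) (r2 *\<^sub>R xs p)) - norm (\<Phi> (p $ 1) (r1 *\<^sub>R xs p))"
      using e(2)[OF that] r unfolding R_def by (smt (verit))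
  qed
  then show ?thesis
  proof (intro that[of "min e 1"])
    fix t r1 r2 :: real and x :: "real^3"
    assume *: "\<And>p. p \<in> K \<Longrightarrow> R p (min e 1)" "t \<in> {0..1}" "norm x = 1" "1 - min e 1 \<le> r1" "r1 \<le> r2" "r2 \<le> 1"
    then have "R (pt t x) (min e 1)" by (simp add: K_def pt_mem_cylinder)
    then show "min e 1 * (r2 - r1) \<le> norm (\<Phi> t (r2 *\<^sub>R x)) - norm (\<Phi> t (r1 *\<^sub>R x))"
      using * by (simp add: R_def)
  qed (use e(1) in auto)
qed

text \<open>\<open>Q\<close> moves \<open>x\<close> along its ray to the radius
  \<open>n t x\<close>, which is \<open>norm (\<Phi> t x)\<close> near the sphere and
  \<open>norm x\<close> deeper inside; \<open>\<Phi> t\<close> after the inverse of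
  \<open>Q t\<close> then preserves the radius near the sphere. The radius has to stay increasing
  along each ray, although \<open>norm (\<Phi> t x)\<close> and \<open>norm x\<close> may differ by
  an amount comparable to the depth. The slow cut-off keeps the loss from switching between them at
  no more than half of the guaranteed growth \<open>e0\<close>.\<close>

lemma radial_normalisation:
  assumes e1: "0 < e1" "e1 \<le> 1"
  obtains Q e where "oriented_diffeo cylinder cylinder (lift Q)" "e > 0"
    "\<And>t x. t \<in> {0..1} \<Longrightarrow> norm x \<le> 1 \<Longrightarrow> \<exists>k>0. Q t x = k *\<^sub>R x"
    "\<And>t x. t \<in> {0..1} \<Longrightarrow> norm x \<le> 1 - e1 \<Longrightarrow> Q t x = x"
    "\<And>t x. t \<in> {0..1} \<Longrightarrow> 1 - e1 < norm x \<Longrightarrow> norm x \<le> 1 \<Longrightarrow> 1 - e1 < norm (Q t x)"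
    "\<And>t x. t \<in> {0..1} \<Longrightarrow> norm x \<le> 1 \<Longrightarrow> 1 - e \<le> norm (Q t x) \<Longrightarrow> norm (\<Phi> t x) = norm (Q t x)"
    "\<And>t x. t \<in> {0..1} \<Longrightarrow> norm x \<le> 1 \<Longrightarrow> norm (Q t x) < 1 - e \<Longrightarrow> norm (\<Phi> t x) < 1 - e"
proof -
  obtain L c where Lc: "L \<ge> 1" "0 < c" "c \<le> 1"
    "\<And>t x. t \<in> {0..1} \<Longrightarrow> norm x \<le> 1 \<Longrightarrow> 1 - norm (\<Phi> t x) \<le> L * (1 - norm x)"
    "\<And>t x. t \<in> {0..1} \<Longrightarrow> norm x \<le> 1 \<Longrightarrow> c * (1 - norm x) \<le> 1 - norm (\<Phi> t x)"
    using norm_bounds by blast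
  obtain e0 where e0: "0 < e0" "e0 \<le> 1"
    "\<And>t x r1 r2. t \<in> {0..1} \<Longrightarrow> norm x = 1 \<Longrightarrow> 1 - e0 \<le> r1 \<Longrightarrow> r1 \<le> r2 \<Longrightarrow> r2 \<le> 1 \<Longrightarrow>
       e0 * (r2 - r1) \<le> norm (\<Phi> t (r2 *\<^sub>R x)) - norm (\<Phi> t (r1 *\<^sub>R x))"
    using radial_growth by blast
  \<comment> \<open>\<open>b \<le> e1\<close> confines \<open>Q\<close> to the prescribed shell,
    \<open>b \<le> e0\<close> to the one where \<open>radial_growth\<close> holds, and
    \<open>4 * L * b \<le> 1\<close> keeps \<open>\<Phi> t x\<close> away from \<open>0\<close> at
    depth up to \<open>2 * b\<close>.\<close>
  define b where "b = Min {e1, e0, 1 / (4 * L)}"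
  have b: "b > 0" "b \<le> e1" "b \<le> e0" "4 * L * b \<le> 1" "b \<le> 1 / 4"
  proof -
    show "b > 0" using e1 e0 Lc(1) by (simp add: b_def)
    show "b \<le> e1" "b \<le> e0" by (simp_all add: b_def)
    have "b \<le> 1 / (4 * L)" by (simp add: b_def)
    then show "4 * L * b \<le> 1" using Lc(1) by (simp add: field_simps)
    moreover have "b \<le> L * b" using mult_right_mono[OF Lc(1), of b] \<open>b > 0\<close> by simp
    ultimately show "b \<le> 1 / 4" by (simp add: mult.assoc)
  qed
  define \<eta> where "\<eta> = e0 / (2 * L)"
  have \<eta>: "\<eta> > 0" "L * \<eta> = e0 / 2" using e0 Lc(1) by (simp_all add: \<eta>_def)
  obtain \<theta> :: "real \<Rightarrow> real" and a where \<theta>: "0 < a" "a < b" "Cinf_on \<theta> UNIV"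
    "\<And>s. s \<le> a \<Longrightarrow> \<theta> s = 1" "\<And>s. s \<ge> b \<Longrightarrow> \<theta> s = 0" "\<And>s. 0 \<le> \<theta> s" "\<And>s. \<theta> s \<le> 1"
    "\<And>s t. 0 \<le> t \<Longrightarrow> t \<le> s \<Longrightarrow> \<bar>\<theta> t - \<theta> s\<bar> * t \<le> \<eta> * (s - t)"
    by (rule slow_cutoff[OF \<eta>(1) b(1)]) (rule that, assumption+)
  \<comment> \<open>At \<open>x = 0\<close> the factor is \<open>1\<close>:
    \<open>inverse 0 = 0\<close>, and also \<open>\<theta> 1 = 0\<close> because
    \<open>b \<le> 1 / 4\<close>.\<close>
  define \<mu> where "\<mu> t x = 1 + \<theta> (1 - norm x) * ((norm (\<Phi> t x) - norm x) * inverse (norm x))" for t x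
  define Q where "Q t x = \<mu> t x *\<^sub>R x" for t x
  define n where "n t x = norm x + \<theta> (1 - norm x) * (norm (\<Phi> t x) - norm x)" for t x
  have \<mu>n: "\<mu> t x * norm x = n t x" for t x
  proof (cases "x = 0")
    case True
    then show ?thesis using \<theta>(5)[of 1] b(5) by (simp add: n_def)
  qed (simp add: \<mu>_def n_def field_simps)
  have inner: "n t x = norm x" "Q t x = x" "\<mu> t x = 1" if "norm x \<le> 1 - b" for t x
    using \<theta>(5)[of "1 - norm x"] that by (simp_all add: n_def Q_def \<mu>_def)
  have shell: "(e0 / 2) * (r2 - r1) \<le> n t (r2 *\<^sub>R x) - n t (r1 *\<^sub>R x)"
    if tx: "t \<in> {0..1}" "norm x = 1" and r: "1 - b \<le> r1" "r1 \<le> r2" "r2 \<le> 1" for t x r1 r2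
  proof -
    have r0: "0 \<le> r1" "0 \<le> r2" using r b by auto
    have nr: "norm (r1 *\<^sub>R x) = r1" "norm (r2 *\<^sub>R x) = r2" using r0 tx by auto
    define m1 where "m1 = norm (\<Phi> t (r1 *\<^sub>R x))" define m2 where "m2 = norm (\<Phi> t (r2 *\<^sub>R x))"
    define k1 where "k1 = \<theta> (1 - r1)" define k2 where "k2 = \<theta> (1 - r2)"
    have k1: "0 \<le> k1" "k1 \<le> 1" by (simp_all add: k1_def \<theta>)
    have "\<bar>m2 - r2\<bar> \<le> L * (1 - r2)"
    proof -
      have "1 - m2 \<le> L * (1 - r2)" using Lc(4)[OF tx(1), of "r2 *\<^sub>R x"] nr r by (simp add: m2_def)
      moreover have "m2 \<le> 1" using norm_le_1[OF tx(1), of "r2 *\<^sub>R x"] nr r by (simp add: m2_def)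
      moreover have "1 - r2 \<le> L * (1 - r2)" using mult_right_mono[OF Lc(1), of "1 - r2"] r by simp
      ultimately show ?thesis using r by (simp add: abs_le_iff)
    qed
    then have "\<bar>(k2 - k1) * (m2 - r2)\<bar> \<le> \<bar>k2 - k1\<bar> * (L * (1 - r2))"
      unfolding abs_mult by (intro mult_left_mono) auto
    also have "\<dots> = L * (\<bar>k2 - k1\<bar> * (1 - r2))" by simp
    also have "\<dots> \<le> L * (\<eta> * (r2 - r1))"
      using \<theta>(8)[of "1 - r2" "1 - r1"] r Lc(1) by (intro mult_left_mono) (auto simp: k1_def k2_def)
    also have "\<dots> = e0 / 2 * (r2 - r1)" using \<eta>(2) by (simp add: mult.assoc[symmetric])
    finally have 1: "- (e0 / 2 * (r2 - r1)) \<le> (k2 - k1) * (m2 - r2)" by (simp add: abs_le_iff)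
    have "e0 * (r2 - r1) \<le> m2 - m1"
      unfolding m1_def m2_def using r b(3) tx by (intro e0(3)) auto
    then have 2: "k1 * (e0 * (r2 - r1)) \<le> k1 * (m2 - m1)" using k1 by (intro mult_left_mono)
    have "e0 * (r2 - r1) \<le> 1 * (r2 - r1)" using e0(2) r by (intro mult_right_mono) auto
    then have 3: "(1 - k1) * (e0 * (r2 - r1)) \<le> (1 - k1) * (r2 - r1)" using k1 by (intro mult_left_mono) auto
    \<comment> \<open>The growth of \<open>n\<close> splits into a convex combination of the growths
      of \<open>norm x\<close> and of \<open>norm (\<Phi> t x)\<close>, each at least
      \<open>e0 * (r2 - r1)\<close>, and the switching term, which is at least minus half of
      that.\<close>
    have "n t (r2 *\<^sub>R x) - n t (r1 *\<^sub>R x) =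
        (1 - k1) * (r2 - r1) + k1 * (m2 - m1) + (k2 - k1) * (m2 - r2)"
      unfolding n_def nr m1_def[symmetric] m2_def[symmetric] k1_def[symmetric] k2_def[symmetric]
      by (simp add: algebra_simps)
    moreover have "(1 - k1) * (e0 * (r2 - r1)) + k1 * (e0 * (r2 - r1)) = e0 / 2 * (r2 - r1) + e0 / 2 * (r2 - r1)"
      by (simp add: algebra_simps)
    ultimately show ?thesis using 1 2 3 by linarith
  qed
  have growth: "(e0 / 2) * (r2 - r1) \<le> n t (r2 *\<^sub>R x) - n t (r1 *\<^sub>R x)"
    if tx: "t \<in> {0..1}" "norm x = 1" and r: "0 \<le> r1" "r1 \<le> r2" "r2 \<le> 1" for t x r1 r2
  proof -
    have core: "(e0 / 2) * (r' - r) \<le> n t (r' *\<^sub>R x) - n t (r *\<^sub>R x)" if "0 \<le> r" "r \<le> r'" "r' \<le> 1 - b" for r r'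
    proof -
      have "n t (r' *\<^sub>R x) = r'" "n t (r *\<^sub>R x) = r" using inner(1)[of "r' *\<^sub>R x"] inner(1)[of "r *\<^sub>R x"] that tx by auto
      moreover have "(e0 / 2) * (r' - r) \<le> 1 * (r' - r)" using that e0 by (intro mult_right_mono) auto
      ultimately show ?thesis by simp
    qed
    consider "r2 \<le> 1 - b" | "1 - b \<le> r1" | "r1 \<le> 1 - b" "1 - b \<le> r2" by linarith
    then show ?thesis
    proof cases
      case 3
      have "(e0 / 2) * (r2 - (1 - b)) + (e0 / 2) * ((1 - b) - r1) = (e0 / 2) * (r2 - r1)"
        by (simp only: distrib_left[symmetric]) simp
      then show ?thesis using core[OF r(1) 3(1) order_refl] shell[OF tx order_refl 3(2) r(3)] by linarith
    qed (use core shell r tx in auto)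
  qed
  have unit: "x = norm x *\<^sub>R (x /\<^sub>R norm x)" "norm (x /\<^sub>R norm x) = 1" if "x \<noteq> 0" for x :: "real^3"
    using that by simp_all
  have n0: "n t 0 = 0" for t using inner(1)[of 0] b(5) by simp
  have \<mu>pos: "\<mu> t x > 0" if "t \<in> {0..1}" "norm x \<le> 1" for t x
  proof (cases "x = 0")
    case False
    have "(e0 / 2) * (norm x - 0) \<le> n t x - n t 0"
      using growth[OF that(1) unit(2)[OF False], of 0 "norm x"] that(2) unit(1)[OF False] by simp
    then have "0 < n t x" using False e0(1) n0 by (smt (verit, best) mult_pos_pos half_gt_zero zero_less_norm_iff)
    then show ?thesis using \<mu>n[of t x] False by (metis norm_ge_zero zero_less_mult_pos2 zero_less_norm_iff)
  qed (use inner(3)[of 0] b(5) in simp)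
  have nQ: "norm (Q t x) = n t x" if "t \<in> {0..1}" "norm x \<le> 1" for t x
    using \<mu>n[of t x] \<mu>pos[OF that] by (simp add: Q_def)
  have outer: "n t x = norm (\<Phi> t x)" if "1 - a \<le> norm x" for t x
    using \<theta>(4)[of "1 - norm x"] that by (simp add: n_def)
  have strict: "n t x < n t (r *\<^sub>R (x /\<^sub>R norm x))"
    if "t \<in> {0..1}" "x \<noteq> 0" "norm x < r" "r \<le> 1" for t x r
  proof -
    have "0 < (e0 / 2) * (r - norm x)" using that e0 by simp
    also have "\<dots> \<le> n t (r *\<^sub>R (x /\<^sub>R norm x)) - n t x"
      using growth[OF that(1) unit(2)[OF that(2)], of "norm x" r] that unit(1)[OF that(2)] by simp
    finally show ?thesis by simp
  qed
  have fixQ: "Q t x = x" if "t \<in> {0..1}" "norm x = 1" for t x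
    using that fix_sphere[OF that] by (simp add: Q_def \<mu>_def)
  \<comment> \<open>Depth \<open>2 * b\<close> makes the shell overlap the region of depth more than
    \<open>b\<close>, where \<open>Q\<close> is the identity. In the shell neither \<open>x\<close>
    nor \<open>\<Phi> t x\<close> vanishes, so both norms are smooth.\<close>
  have smooth_\<mu>: "smooth_on (cylinder \<inter> {p. norm (xs p) > 1 - 2 * b}) (\<lambda>p. \<mu> (p $ 1) (xs p))"
    (is "smooth_on ?S _")
  proof -
    have cmp: "smooth_on S (\<lambda>x. g (f x))" if "Cinf_on g V" "smooth_on S f" "f ` S \<subseteq> V"
      for g :: "'c::euclidean_space \<Rightarrow> real" and f V and S :: "(real^4) set"
      by (rule smooth_on_compose[OF smooth_onI_Cinf_on[OF that(1) order_refl] that(2,3)])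
    have xs0: "xs p \<noteq> 0" if "p \<in> ?S" for p using that b(5) by auto
    have \<Phi>0: "xs (lift \<Phi> p) \<noteq> 0" if "p \<in> ?S" for p
    proof -
      have p: "p $ 1 \<in> {0..1}" "norm (xs p) \<le> 1" "1 - norm (xs p) \<le> 2 * b"
        using that by (auto simp: mem_cylinder)
      have "1 - norm (\<Phi> (p $ 1) (xs p)) \<le> L * (2 * b)"
        using Lc(4)[OF p(1,2)] mult_left_mono[OF p(3), of L] Lc(1) by linarith
      then have "norm (\<Phi> (p $ 1) (xs p)) > 0" using b(4) by linarith
      then show ?thesis by (simp add: lift_def)
    qed
    have sx: "smooth_on ?S xs" by (rule smooth_on_bounded_linear[OF bounded_linear_xs])
    have nC: "Cinf_on (\<lambda>x::real^3. norm x) (- {0})"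
      by (intro Cinf_on_norm Cinf_on_id) (auto simp: open_Compl)
    have s1: "smooth_on ?S (\<lambda>p. norm (xs p))" by (rule cmp[OF nC sx]) (use xs0 in auto)
    have "smooth_on ?S (\<lambda>p. xs (lift \<Phi> p))"
      by (rule smooth_on_compose[OF smooth_on_bounded_linear[OF bounded_linear_xs] smooth_on_subset[OF smooth]]) auto
    then have s2: "smooth_on ?S (\<lambda>p. norm (xs (lift \<Phi> p)))" by (rule cmp[OF nC]) (use \<Phi>0 in auto)
    have "Cinf_on (\<lambda>r. \<theta> (1 - r)) UNIV" by (intro Cinf_on_compose[OF \<theta>(3)] Cinf_intros) auto
    then have s3: "smooth_on ?S (\<lambda>p. \<theta> (1 - norm (xs p)))" by (rule cmp[OF _ s1]) auto
    have "Cinf_on (\<lambda>r::real. inverse r) (- {0})" by (intro Cinf_on_inverse Cinf_on_id) (auto simp: open_Compl)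
    then have s4: "smooth_on ?S (\<lambda>p. inverse (norm (xs p)))" by (rule cmp[OF _ s1]) (use xs0 in auto)
    have s5: "smooth_on ?S (\<lambda>p. - norm (xs p))"
      by (rule cmp[OF Cinf_on_minus[OF Cinf_on_id[OF open_UNIV]] s1]) simp
    have s6: "smooth_on ?S (\<lambda>p. 1::real)"
      by (rule smooth_onI_Cinf_on[OF Cinf_on_const[OF open_UNIV]]) simp
    have "smooth_on ?S (\<lambda>p. 1 + \<theta> (1 - norm (xs p)) * ((norm (xs (lift \<Phi> p)) + - norm (xs p)) * inverse (norm (xs p))))"
      by (intro smooth_on_mult smooth_on_add s6 s2 s3 s4 s5)
    then show ?thesis by (simp add: \<mu>_def lift_def)
  qed
  have nd: "nondegenerate_on cylinder (lift Q)"
    unfolding nondegenerate_on_def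
  proof
    fix p assume p: "p \<in> cylinder"
    define t where "t = p $ 1" define x where "x = xs p"
    have tx: "t \<in> {0..1}" "norm x \<le> 1" "p = pt t x" using p by (auto simp: t_def x_def mem_cylinder)
    show "\<exists>U g. p \<in> U \<and> Cinf_on g U \<and> (\<forall>y\<in>cylinder \<inter> U. lift Q y = g y) \<and> inj (frechet_derivative g (at p))"
    proof (cases "norm x < 1 - b")
      case True
      let ?U = "{p. norm (xs p) < 1 - b}"
      have "open ?U"
        by (intro open_Collect_less continuous_intros linear_continuous_on[OF bounded_linear_xs])
      moreover have "inj (frechet_derivative (\<lambda>q::real^4. q) (at p))"
      proof -
        have "((\<lambda>q::real^4. q) has_derivative (\<lambda>v. v)) (at p)" by simp
        then show ?thesis by (simp add: frechet_derivative_at[symmetric])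
      qed
      moreover have "lift Q q = q" if "q \<in> ?U" for q
        using inner(2)[of "xs q"] that by (simp add: lift_def)
      ultimately show ?thesis
        using True by (intro exI[of _ ?U] exI[of _ "\<lambda>q. q"]) (auto simp: x_def intro: Cinf_on_id)
    next
      case False
      let ?V = "{p. norm (xs p) > 1 - 2 * b}"
      have oV: "open ?V"
        by (intro open_Collect_less continuous_intros linear_continuous_on[OF bounded_linear_xs])
      have pV: "p \<in> ?V" using False b(1) by (simp add: x_def)
      have pS: "p \<in> cylinder \<inter> ?V" using p pV by simp
      obtain U0 g where U0: "p \<in> U0" "Cinf_on g U0"
        "\<And>y. y \<in> cylinder \<inter> ?V \<Longrightarrow> y \<in> U0 \<Longrightarrow> \<mu> (y $ 1) (xs y) = g y"
        using smooth_onE[OF smooth_\<mu> pS] by metis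
      define U where "U = U0 \<inter> ?V"
      have oU: "open U" using Cinf_on_open[OF U0(2)] oV by (simp add: U_def open_Int)
      have pU: "p \<in> U" using U0(1) pV by (simp add: U_def)
      have gU: "Cinf_on g U" by (rule Cinf_on_subset[OF U0(2) oU]) (simp add: U_def)
      define f where "f q = pt (q $ 1) (g q *\<^sub>R xs q)" for q
      have fC: "Cinf_on f U"
        unfolding f_def
        by (intro Cinf_on_pt Cinf_on_nth Cinf_on_scaleR Cinf_on_xs Cinf_on_id oU gU)
      have feq: "lift Q q = f q" if "q \<in> cylinder" "q \<in> U" for q
        using U0(3)[of q] that by (simp add: lift_def Q_def f_def U_def)
      let ?D = "frechet_derivative f (at p)" and ?G = "frechet_derivative g (at p)"
      have fD: "(f has_derivative ?D) (at p)" by (rule Cinf_on_has_derivative[OF fC pU])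
      have linD: "linear ?D" by (rule has_derivative_linear[OF fD])
      have gD: "(g has_derivative ?G) (at p)" by (rule Cinf_on_has_derivative[OF gU pU])
      have "((\<lambda>q. (q $ 1) *\<^sub>R pt 1 0 + pt 0 (g q *\<^sub>R xs q)) has_derivative
          (\<lambda>v. (v $ 1) *\<^sub>R pt 1 0 + pt 0 (g p *\<^sub>R xs v + ?G v *\<^sub>R xs p))) (at p)"
        by (intro has_derivative_add has_derivative_scaleR_left bounded_linear.has_derivative[OF bounded_linear_pt_0]
            has_derivative_scaleR gD bounded_linear_imp_has_derivative bounded_linear_xs bounded_linear_vec_nth)
      moreover have "(\<lambda>q. (q $ 1) *\<^sub>R pt 1 0 + pt 0 (g q *\<^sub>R xs q)) = f"
        by (simp add: f_def pt_scaleR pt_add fun_eq_iff)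
      ultimately have "(f has_derivative (\<lambda>v. (v $ 1) *\<^sub>R pt 1 0 + pt 0 (g p *\<^sub>R xs v + ?G v *\<^sub>R xs p))) (at p)"
        by simp
      from has_derivative_unique[OF fD this]
      have Dv: "?D v = pt (v $ 1) (g p *\<^sub>R xs v + ?G v *\<^sub>R xs p)" for v
        by (simp add: pt_scaleR pt_add)
      have gp: "g p > 0" using U0(3)[OF pS U0(1)] \<mu>pos[OF tx(1,2)] by (simp add: t_def x_def)
      have x0: "x \<noteq> 0" using False b(5) by auto
      obtain d where d: "d > 0" "ball p d \<subseteq> U" using oU pU openE by blast
      have "(e0 / 2) * norm x \<le> norm (?D (- pt 0 x))"
      proof (rule directional_derivative_lower_bound[OF fD, of "min d 1"])
        fix s :: real assume s: "0 < s" "s < min d 1"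
        have eq: "p + s *\<^sub>R - pt 0 x = pt t ((1 - s) *\<^sub>R x)"
          by (simp add: tx(3) vec_eq_iff forall_4 algebra_simps)
        have "s * norm x \<le> s * 1" using s by (intro mult_left_mono tx(2)) simp
        then have "s * norm x < d" using s by linarith
        then have "dist p (p + s *\<^sub>R - pt 0 x) < d" using s by (simp add: dist_norm)
        then have inU: "pt t ((1 - s) *\<^sub>R x) \<in> U" using subsetD[OF d(2)] eq by (simp only: mem_ball)
        have n1: "norm ((1 - s) *\<^sub>R x) \<le> 1"
          using s tx(2) mult_le_one[of "1 - s" "norm x"] by simp
        then have inC: "pt t ((1 - s) *\<^sub>R x) \<in> cylinder" using tx(1) by (simp add: pt_mem_cylinder)
        have "(e0 / 2) * (norm x - (1 - s) * norm x) \<le>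
            n t (norm x *\<^sub>R (x /\<^sub>R norm x)) - n t (((1 - s) * norm x) *\<^sub>R (x /\<^sub>R norm x))"
          using s tx(2) by (intro growth tx unit(2)[OF x0]) (auto simp: mult_left_le_one_le)
        moreover have "norm x *\<^sub>R (x /\<^sub>R norm x) = x" "((1 - s) * norm x) *\<^sub>R (x /\<^sub>R norm x) = (1 - s) *\<^sub>R x"
          using x0 by simp_all
        moreover have "norm x - (1 - s) * norm x = norm x * s" by (simp add: algebra_simps)
        ultimately have "(e0 / 2) * norm x * s \<le> n t x - n t ((1 - s) *\<^sub>R x)" by (simp only: mult.assoc)
        also have "\<dots> = norm (Q t x) - norm (Q t ((1 - s) *\<^sub>R x))"
          using nQ[OF tx(1,2)] nQ[OF tx(1) n1] by simp
        also have "\<dots> \<le> norm (Q t ((1 - s) *\<^sub>R x) - Q t x)"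
          using norm_triangle_ineq2[of "Q t x" "Q t ((1 - s) *\<^sub>R x)"] by (simp add: norm_minus_commute)
        also have "\<dots> = norm (f (p + s *\<^sub>R - pt 0 x) - f p)"
        proof -
          have f1: "f (pt t ((1 - s) *\<^sub>R x)) = pt t (Q t ((1 - s) *\<^sub>R x))" using feq[OF inC inU] by simp
          have f2: "f p = pt t (Q t x)" using feq[OF p pU] by (simp add: lift_def t_def x_def)
          show ?thesis by (simp only: eq f1 f2 pt_diff diff_self norm_pt_0)
        qed
        finally show "(e0 / 2) * norm x * s \<le> norm (f (p + s *\<^sub>R - pt 0 x) - f p)" .
      qed (use d(1) in simp)
      moreover have "(e0 / 2) * norm x > 0" using e0(1) x0 by simp
      ultimately have D0: "?D (pt 0 x) \<noteq> 0" using linear_neg[OF linD, of "pt 0 x"] by auto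
      \<comment> \<open>By the formula \<open>Dv\<close> a kernel vector has no time component and
        its spatial part is a multiple of \<open>x\<close>; but the derivative in the radial
        direction is nonzero, by \<open>growth\<close>.\<close>
      have "v = 0" if v: "?D v = 0" for v
      proof -
        have "pt (v $ 1) (g p *\<^sub>R xs v + ?G v *\<^sub>R xs p) = pt 0 0"
          using Dv[of v] v by (simp add: eq_pt_iff)
        then have v1: "v $ 1 = 0" "g p *\<^sub>R xs v + ?G v *\<^sub>R x = 0" by (auto simp: pt_eq_iff x_def)
        then have "g p *\<^sub>R xs v = (- ?G v) *\<^sub>R x" by (simp add: eq_neg_iff_add_eq_0)
        then have "inverse (g p) *\<^sub>R (g p *\<^sub>R xs v) = inverse (g p) *\<^sub>R ((- ?G v) *\<^sub>R x)" by (rule arg_cong)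
        then have "xs v = (- ?G v / g p) *\<^sub>R x" using gp by (simp add: divide_inverse mult.commute)
        then have "v = (- ?G v / g p) *\<^sub>R pt 0 x" using v1(1) by (simp only: pt_scaleR eq_pt_iff) simp
        moreover from this have "(- ?G v / g p) *\<^sub>R ?D (pt 0 x) = 0" using v linear_scale[OF linD] by metis
        ultimately show ?thesis using D0 by (metis scaleR_eq_0_iff)
      qed
      then have "inj ?D" using linear_injective_0[OF linD] by blast
      then show ?thesis using pU fC feq by (intro exI[of _ U] exI[of _ f]) auto
    qed
  qed
  have inj: "inj_on (Q t) D3" if t: "t \<in> {0..1}" for t
  proof (rule inj_onI)
    fix x y assume xy: "x \<in> D3" "y \<in> D3" "Q t x = Q t y"
    have nxy: "norm x \<le> 1" "norm y \<le> 1" using xy by auto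
    have n_eq: "n t x = n t y" using nQ[OF t nxy(1)] nQ[OF t nxy(2)] xy(3) by simp
    show "x = y"
    proof (cases "x = 0 \<or> y = 0")
      case True
      then have "n t x = 0" using n0 n_eq by metis
      then have "Q t x = 0" "Q t y = 0" using nQ[OF t nxy(1)] nQ[OF t nxy(2)] n_eq by auto
      then show ?thesis using \<mu>pos[OF t nxy(1)] \<mu>pos[OF t nxy(2)] by (auto simp: Q_def)
    next
      case False
      have dir: "z /\<^sub>R norm z = Q t z /\<^sub>R norm (Q t z)" if "norm z \<le> 1" for z
        using \<mu>pos[OF t that] by (simp add: Q_def)
      have "x /\<^sub>R norm x = y /\<^sub>R norm y" using dir[OF nxy(1)] dir[OF nxy(2)] xy(3) by simp
      moreover have "norm x = norm y"
      proof (rule ccontr)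
        assume "norm x \<noteq> norm y"
        then consider "norm x < norm y" | "norm y < norm x" by linarith
        then show False
          using strict[OF t, of x "norm y"] strict[OF t, of y "norm x"] nxy False n_eq calculation
            unit(1)[of x] unit(1)[of y] by cases (metis less_irrefl)+
      qed
      ultimately show ?thesis using unit(1) False by metis
    qed
  qed
  have onto: "Q t ` D3 = D3" if t: "t \<in> {0..1}" for t
  proof -
    have "continuous_on D3 (\<lambda>x. xs (lift Q (pt t x)))"
    proof (rule continuous_on_compose2[OF linear_continuous_on[OF bounded_linear_xs, of UNIV]])
      have "continuous_on D3 (\<lambda>x. pt t 0 + pt 0 x)"
        by (intro continuous_intros linear_continuous_on[OF bounded_linear_pt_0])
      then have "continuous_on D3 (\<lambda>x. pt t x)" by (simp add: pt_add)
      then show "continuous_on D3 (\<lambda>x. lift Q (pt t x))"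
        by (rule continuous_on_compose2[OF smooth_on_continuous_on[OF nondegenerate_on_smooth_on[OF nd]]])
          (use t in \<open>auto simp: pt_mem_cylinder\<close>)
    qed auto
    then have "bij_betw (Q t) D3 D3"
      using fixQ[OF t] by (intro cball_onto_if_sphere_fixed inj[OF t]) (auto simp: Q_def)
    then show ?thesis by (simp add: bij_betw_def)
  qed
  have dQ: "Defs.diffeo cylinder cylinder (lift Q)"
    using diffeo_if_nondegenerate[OF compact_cylinder inj_on_lift[OF inj] nd] lift_image_cylinder[of Q, OF onto] by simp
  have "oriented_diffeo cylinder cylinder (lift Q)"
  proof (rule oriented_diffeo_if_positive_somewhere[OF dQ convex_cylinder])
    show "pt (1 / 2) 0 \<in> interior cylinder" by (rule mem_interior_cylinder) auto
    have "open {p. norm (xs p) < 1 - b}"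
      by (intro open_Collect_less continuous_intros linear_continuous_on[OF bounded_linear_xs])
    then have "det (jacobian (lift Q) (at (pt (1 / 2) 0))) = 1"
      by (rule jacobian_eq_id) (use b(5) inner(2) in \<open>auto simp: lift_def\<close>)
    then show "det (jacobian (lift Q) (at (pt (1 / 2) 0))) > 0" by simp
  qed
  \<comment> \<open>The depth at which the radius is preserved: by \<open>norm_bounds\<close> an
    image of depth at most \<open>c * a\<close> comes from depth at most \<open>a\<close>, where
    \<open>\<theta>\<close> is \<open>1\<close> and the radii of \<open>Q t x\<close> and
    \<open>\<Phi> t x\<close> agree.\<close>
  moreover have "c * a > 0" using Lc(2) \<theta>(1) by simp
  moreover have "\<exists>k>0. Q t x = k *\<^sub>R x" if "t \<in> {0..1}" "norm x \<le> 1" for t x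
    using \<mu>pos[OF that] by (auto simp: Q_def)
  moreover have "Q t x = x" if "norm x \<le> 1 - e1" for t x using inner(2) that b(2) by simp
  moreover have "1 - e1 < norm (Q t x)" if "t \<in> {0..1}" "1 - e1 < norm x" "norm x \<le> 1" for t x
  proof -
    have x0: "x \<noteq> 0" using that e1(2) by auto
    have "(e0 / 2) * (norm x - (1 - e1)) \<le> n t (norm x *\<^sub>R (x /\<^sub>R norm x)) - n t ((1 - e1) *\<^sub>R (x /\<^sub>R norm x))"
      using that e1 by (intro growth unit(2)[OF x0]) auto
    moreover have "norm ((1 - e1) *\<^sub>R (x /\<^sub>R norm x)) = 1 - e1" using x0 e1(2) by simp
    then have "n t ((1 - e1) *\<^sub>R (x /\<^sub>R norm x)) = 1 - e1"
      using inner(1)[of "(1 - e1) *\<^sub>R (x /\<^sub>R norm x)" t] b(2) by simp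
    moreover have "0 < (e0 / 2) * (norm x - (1 - e1))" using that e0(1) by simp
    ultimately have "1 - e1 < n t x" using unit(1)[OF x0] by simp
    then show ?thesis using nQ[OF that(1,3)] by simp
  qed
  moreover have small: "norm (\<Phi> t x) < 1 - c * a \<and> norm (Q t x) < 1 - c * a"
    if tx: "t \<in> {0..1}" "norm x < 1 - a" for t x
  proof -
    have x1: "norm x \<le> 1" using tx(2) \<theta>(1) by simp
    have bd: "norm (\<Phi> t y) \<le> 1 - c * (1 - norm y)" if "norm y \<le> 1" for y
      using Lc(5)[OF tx(1) that] by simp
    have "c * a < c * (1 - norm x)" using Lc(2) tx(2) by simp
    then have "norm (\<Phi> t x) < 1 - c * a" using bd[OF x1] by simp
    moreover have "n t x < 1 - c * a"
    proof (cases "x = 0")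
      case True
      have "c * a \<le> 1 * a" using Lc(3) \<theta>(1) by (intro mult_right_mono) auto
      then show ?thesis using True n0 \<theta>(2) b(5) by simp
    next
      case False
      define y where "y = (1 - a) *\<^sub>R (x /\<^sub>R norm x)"
      have ny: "norm y = 1 - a" using False \<theta>(2) b(5) by (simp add: y_def)
      have "n t x < n t y" unfolding y_def using tx \<theta>(1) False by (intro strict) auto
      also have "\<dots> = norm (\<Phi> t y)" using outer[of y t] ny by simp
      also have "\<dots> \<le> 1 - c * a" using bd[of y] ny \<theta>(1) by simp
      finally show ?thesis .
    qed
    ultimately show ?thesis using nQ[OF tx(1) x1] by simp
  qed
  moreover have "norm (\<Phi> t x) = norm (Q t x)" if "t \<in> {0..1}" "norm x \<le> 1" "1 - c * a \<le> norm (Q t x)" for t x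
    using small[OF that(1), of x] that outer[of x t] nQ[OF that(1,2)] by (cases "norm x < 1 - a") auto
  moreover have "norm (\<Phi> t x) < 1 - c * a" if "t \<in> {0..1}" "norm x \<le> 1" "norm (Q t x) < 1 - c * a" for t x
    using small[OF that(1), of x] that outer[of x t] nQ[OF that(1,2)] by (cases "norm x < 1 - a") auto
  ultimately show ?thesis using that[of Q "c * a"] by blast
qed

end

section \<open>Profiles of rounded cylinders\<close>

text \<open>\<open>corner_rounding\<close> without orientation and without a chosen identification
  with \<open>D4\<close>. In this form the notion is invariant under reflection in time, which
  reverses orientation.\<close>

definition rounded_cylinder :: "real \<Rightarrow> (real^4) set \<Rightarrow> bool" where
  "rounded_cylinder \<delta> W \<longleftrightarrow> W \<subseteq> cylinder \<and> (\<forall>p\<in>cylinder - W. \<exists>c\<in>corners. dist p c < \<delta>) \<and> convex W \<and>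
     (\<forall>A t x. orthogonal_transformation A \<longrightarrow> pt t x \<in> W \<longrightarrow> pt t (A x) \<in> W) \<and> (\<exists>\<rho>. diffeo W D4 \<rho>)"

text \<open>The sum and the difference of time and depth \<open>1 - norm (xs p)\<close>, that is,
  the diagonal coordinates at the lower corner. In them the cylinder near that corner is
  \<open>\<bar>tau p\<bar> \<le> sig p\<close>.\<close>

definition sig :: "real^4 \<Rightarrow> real" where "sig p = p $ 1 + 1 - norm (xs p)"
definition tau :: "real^4 \<Rightarrow> real" where "tau p = p $ 1 - 1 + norm (xs p)"

abbreviation e0 :: "real^3" where "e0 \<equiv> axis 1 1"

text \<open>The point with \<open>tau = u\<close> and \<open>sig = s\<close>, as long as its radius
  is nonnegative, in the half-plane of the ray through \<open>e0\<close>; by rotational symmetry a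
  rounding is determined by its trace there. The point is affine in both arguments, which lets
  convexity of the rounding act on the profile.\<close>

definition profile_point :: "real \<Rightarrow> real \<Rightarrow> real^4" where
  "profile_point u s = pt ((s + u) / 2) ((1 - (s - u) / 2) *\<^sub>R e0)"

lemma rounded_cylinder_subset: "rounded_cylinder \<delta> W \<Longrightarrow> W \<subseteq> cylinder"
  by (simp add: rounded_cylinder_def)

lemma corner_dist:
  assumes "pt s y \<in> corners"
  shows "\<bar>1 - norm x\<bar> \<le> dist (pt t x) (pt s y)" "min \<bar>t\<bar> \<bar>1 - t\<bar> \<le> dist (pt t x) (pt s y)"
proof -
  have sy: "s = 0 \<or> s = 1" "norm y = 1" using assms by (auto simp: corners_def pt_eq_iff)
  have d: "dist (pt t x) (pt s y) = norm (pt (t - s) (x - y))" by (simp add: dist_norm pt_diff)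
  have "\<bar>1 - norm x\<bar> \<le> norm (x - y)" using norm_triangle_ineq3[of x y] sy by simp
  also have "\<dots> \<le> dist (pt t x) (pt s y)" unfolding d using norm_xs_le[of "pt (t - s) (x - y)"] by simp
  finally show "\<bar>1 - norm x\<bar> \<le> dist (pt t x) (pt s y)" .
  have "\<bar>t - s\<bar> \<le> dist (pt t x) (pt s y)"
    unfolding d using component_le_norm_cart[of "pt (t - s) (x - y)" 1] by simp
  then show "min \<bar>t\<bar> \<bar>1 - t\<bar> \<le> dist (pt t x) (pt s y)" using sy by auto
qed

lemma rounded_cylinder_mem_if_far:
  assumes W: "rounded_cylinder \<delta> W" and p: "p \<in> cylinder"
    and far: "norm (xs p) \<le> 1 - \<delta> \<or> (\<delta> \<le> p $ 1 \<and> p $ 1 \<le> 1 - \<delta>)"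
  shows "p \<in> W"
proof (rule ccontr)
  assume "p \<notin> W"
  then obtain c where c: "c \<in> corners" "dist p c < \<delta>" using W p unfolding rounded_cylinder_def by blast
  obtain s y where sy: "c = pt s y" by (rule pt_cases)
  show False
    using corner_dist[where s = s and y = y and x = "xs p" and t = "p $ 1"] c far by (auto simp: sy)
qed

text \<open>Time and depth add up to \<open>sig p\<close>, so one of them is at least
  \<open>\<delta>\<close>; the bound on \<open>p $ 1\<close> keeps off the upper corner.\<close>

lemma rounded_cylinder_mem_if_sig:
  assumes W: "rounded_cylinder \<delta> W" and p: "p \<in> cylinder" "p $ 1 \<le> 1 - \<delta>" "2 * \<delta> \<le> sig p"
  shows "p \<in> W"
  by (rule rounded_cylinder_mem_if_far[OF W p(1)]) (use p in \<open>auto simp: sig_def\<close>)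

lemma rounded_cylinder_interior:
  assumes "rounded_cylinder \<delta> W" "\<delta> < 1 / 2" shows "pt (1 / 2) 0 \<in> interior W"
proof (rule interiorI)
  show "open {p. \<delta> < p $ 1 \<and> p $ 1 < 1 - \<delta> \<and> 0 < p $ 1 \<and> p $ 1 < 1 \<and> norm (xs p) < 1}"
    by (intro open_Collect_conj open_Collect_less continuous_intros
        linear_continuous_on[OF bounded_linear_xs])
  show "{p. \<delta> < p $ 1 \<and> p $ 1 < 1 - \<delta> \<and> 0 < p $ 1 \<and> p $ 1 < 1 \<and> norm (xs p) < 1} \<subseteq> W"
    by (auto intro!: rounded_cylinder_mem_if_far[OF assms(1)] simp: mem_cylinder)
qed (use assms(2) in simp)

lemma compact_rounded_cylinder: assumes "rounded_cylinder \<delta> W" shows "compact W"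
proof -
  obtain \<rho> where \<rho>: "diffeo W D4 \<rho>" using assms unfolding rounded_cylinder_def by blast
  then have "smooth_on D4 (inv_into W \<rho>)" "inv_into W \<rho> ` D4 = W"
    using bij_betw_inv_into[of \<rho> W D4] by (auto simp: diffeo_def bij_betw_def)
  then show ?thesis by (metis compact_cball compact_continuous_image smooth_on_continuous_on)
qed

lemma rounded_cylinder_rotate:
  assumes W: "rounded_cylinder \<delta> W" and "norm x = norm y" shows "pt t x \<in> W \<longleftrightarrow> pt t y \<in> W"
proof -
  have *: "pt t v \<in> W" if uv: "pt t u \<in> W" "norm u = norm v" for u v
  proof -
    obtain A where "orthogonal_transformation A" "A u = v"
      using orthogonal_transformation_exists[OF uv(2)] by blast
    then show ?thesis using W uv(1) unfolding rounded_cylinder_def by metis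
  qed
  show ?thesis using *[of x y] *[of y x] assms(2) by auto
qed

lemma profile_point_coords:
  "profile_point u s $ 1 = (s + u) / 2" "xs (profile_point u s) = (1 - (s - u) / 2) *\<^sub>R e0"
  by (simp_all add: profile_point_def)

lemma mem_rounded_cylinder_iff_profile:
  assumes "rounded_cylinder \<delta> W"
  shows "p \<in> W \<longleftrightarrow> profile_point (tau p) (sig p) \<in> W"
proof -
  have "profile_point (tau p) (sig p) = pt (p $ 1) (norm (xs p) *\<^sub>R e0)"
    by (simp add: profile_point_def tau_def sig_def field_simps)
  then show ?thesis
    using rounded_cylinder_rotate[OF assms, of "xs p" "norm (xs p) *\<^sub>R e0" "p $ 1"] by simp
qed

lemma profile_point_affine:
  "u + v = 1 \<Longrightarrow> u *\<^sub>R profile_point a s + v *\<^sub>R profile_point b t = profile_point (u * a + v * b) (u * s + v * t)"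
  by (simp add: profile_point_def vec_eq_iff forall_4 axis_def field_simps)

lemma profile_point_eq:
  "profile_point u s = pt 0 e0 + u *\<^sub>R pt (1 / 2) ((1 / 2) *\<^sub>R e0) + s *\<^sub>R pt (1 / 2) (- (1 / 2) *\<^sub>R e0)"
  by (simp add: profile_point_def vec_eq_iff forall_4 axis_def field_simps)

lemma continuous_on_profile_point [continuous_intros]:
  "continuous_on S f \<Longrightarrow> continuous_on S g \<Longrightarrow> continuous_on S (\<lambda>x. profile_point (f x) (g x))"
  unfolding profile_point_eq by (intro continuous_intros)

text \<open>On each line \<open>tau = u\<close> the points of \<open>W\<close> form, up to
  \<open>sig = 1 / 2\<close>, a closed segment with lower end \<open>f u\<close>. The lower end is a
  boundary point, so \<open>\<rho>\<close> sends it to the sphere, and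
  \<open>h = 1 - r \<bullet> r\<close>, for a local extension \<open>r\<close> of
  \<open>\<rho>\<close>, vanishes along the profile. Convexity makes the derivative of
  \<open>h\<close> along the line positive, so the inverse function theorem presents the profile as
  a smooth graph over \<open>tau\<close>.\<close>

lemma rounded_cylinder_profile:
  assumes W: "rounded_cylinder \<delta> W" and \<delta>: "0 < \<delta>" "\<delta> \<le> 1 / 16"
  obtains f where "Cinf_on f {-1/2<..<1/2}"
    "\<And>u. \<bar>u\<bar> < 1/2 \<Longrightarrow> \<bar>u\<bar> \<le> f u" "\<And>u. \<bar>u\<bar> < 1/2 \<Longrightarrow> f u \<le> max \<bar>u\<bar> (2 * \<delta>)"
    "\<And>p. \<bar>tau p\<bar> < 1/2 \<Longrightarrow> sig p \<le> 1/2 \<Longrightarrow> p \<in> W \<longleftrightarrow> f (tau p) \<le> sig p"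
proof -
  note sub = rounded_cylinder_subset[OF W]
  have conv: "convex W" using W by (simp add: rounded_cylinder_def)
  obtain \<rho> where \<rho>: "diffeo W D4 \<rho>" using W unfolding rounded_cylinder_def by blast
  have clW: "closed W" using compact_rounded_cylinder[OF W] compact_imp_closed by blast
  define S where "S u = {s. profile_point u s \<in> W}" for u
  have S_lower: "\<bar>u\<bar> \<le> s" if "s \<in> S u" for u s
  proof -
    have "profile_point u s \<in> cylinder" using that sub by (auto simp: S_def)
    then have "0 \<le> (s + u) / 2" "\<bar>1 - (s - u) / 2\<bar> \<le> 1" by (auto simp: mem_cylinder profile_point_coords)
    then show ?thesis by (auto simp: abs_le_iff)
  qed
  have S_upper: "s \<in> S u" if "\<bar>u\<bar> \<le> s" "2 * \<delta> \<le> s" "s \<le> 1 / 2" for u s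
  proof -
    have "\<bar>1 - (s - u) / 2\<bar> = 1 - (s - u) / 2" using that by (auto simp: abs_le_iff)
    then have "profile_point u s \<in> cylinder" "sig (profile_point u s) = s"
      using that by (auto simp: mem_cylinder profile_point_coords sig_def abs_le_iff field_simps)
    then show ?thesis
      unfolding S_def using that \<delta>
      by (intro CollectI rounded_cylinder_mem_if_sig[OF W]) (auto simp: profile_point_coords abs_le_iff)
  qed
  have S_closed: "closed (S u)" for u
  proof -
    have "closed ((\<lambda>s. profile_point u s) -` W)"
      using clW by (intro closed_vimage continuous_intros)
    then show ?thesis by (simp add: S_def vimage_def)
  qed
  define f where "f u = Inf (S u)" for u
  have bdd: "bdd_below (S u)" for u using S_lower by (meson bdd_belowI)
  have ne: "1 / 2 \<in> S u" if "\<bar>u\<bar> < 1 / 2" for u using S_upper[of u "1 / 2"] that \<delta> by simp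
  have f_mem: "f u \<in> S u" if "\<bar>u\<bar> < 1 / 2" for u
    unfolding f_def using ne[OF that] bdd S_closed by (intro closed_contains_Inf) auto
  have f_le: "f u \<le> s" if "s \<in> S u" for u s unfolding f_def using that bdd by (rule cInf_lower)
  have f_lower: "\<bar>u\<bar> \<le> f u" if "\<bar>u\<bar> < 1 / 2" for u using S_lower[OF f_mem[OF that]] .
  have f_upper: "f u \<le> max \<bar>u\<bar> (2 * \<delta>)" if "\<bar>u\<bar> < 1 / 2" for u
    using that \<delta> by (intro f_le S_upper) auto
  have f_half: "f u < 1 / 2" if "\<bar>u\<bar> < 1 / 2" for u using f_upper[OF that] that \<delta> by simp
  have S_iff: "s \<in> S u \<longleftrightarrow> f u \<le> s" if "\<bar>u\<bar> < 1 / 2" "s \<le> 1 / 2" for u s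
  proof
    assume fs: "f u \<le> s"
    define v where "v = (s - f u) / (1 / 2 - f u)"
    have v: "0 \<le> v" "v \<le> 1" using fs that f_half[OF that(1)] by (auto simp: v_def field_simps)
    have "(1 - v) *\<^sub>R profile_point u (f u) + v *\<^sub>R profile_point u (1 / 2) \<in> W"
      using f_mem[OF that(1)] ne[OF that(1)] v conv unfolding S_def convex_def by auto
    moreover have "v * (1 / 2 - f u) = s - f u" using f_half[OF that(1)] by (simp add: v_def)
    then have "(1 - v) * f u + v * (1 / 2) = s" by (simp add: algebra_simps)
    moreover have "(1 - v) * u + v * u = u" by (simp add: algebra_simps)
    ultimately show "s \<in> S u" using profile_point_affine[of "1 - v" v u "f u" u "1 / 2"] by (simp add: S_def)
  qed (rule f_le)
  \<comment> \<open>Convexity of \<open>f\<close> is used for its continuity on the open interval,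
    which keeps \<open>y u\<close> in a prescribed neighbourhood of \<open>y u0\<close>.\<close>
  have "convex_on {-1/2<..<1/2} f"
  proof (rule convex_onI)
    fix t x y :: real assume t: "0 < t" "t < 1" and x: "x \<in> {-1/2<..<1/2}" and y: "y \<in> {-1/2<..<1/2}"
    have xy: "\<bar>x\<bar> < 1 / 2" "\<bar>y\<bar> < 1 / 2" using x y by auto
    have "(1 - t) *\<^sub>R profile_point x (f x) + t *\<^sub>R profile_point y (f y) \<in> W"
      using f_mem[OF xy(1)] f_mem[OF xy(2)] t conv unfolding S_def convex_def by auto
    then show "f ((1 - t) *\<^sub>R x + t *\<^sub>R y) \<le> (1 - t) * f x + t * f y"
      using profile_point_affine[of "1 - t" t x "f x" y "f y"] by (intro f_le) (simp add: S_def)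
  qed (rule convex_real_interval)
  then have f_cont: "continuous_on {-1/2<..<1/2} f" by (intro convex_on_continuous) auto
  have "pt (1 / 2) 0 \<in> interior W" using rounded_cylinder_interior[OF W] \<delta> by simp
  then have dense: "W \<subseteq> closure (interior W)" by (intro interior_dense_convex conv) auto
  note nd = diffeo_nondegenerate[OF \<rho> dense]
  have \<rho>D: "\<rho> p \<in> D4" if "p \<in> W" for p using \<rho> that by (auto simp: diffeo_def bij_betw_def)
  define y where "y u = profile_point u (f u)" for u
  have yW: "y u \<in> W" if "\<bar>u\<bar> < 1 / 2" for u using f_mem[OF that] by (simp add: y_def S_def)
  \<comment> \<open>A value in the interior of \<open>D4\<close> would pull back to an interior
    point of \<open>W\<close>, and then \<open>f u\<close> could be lowered.\<close>
  have y_bdry: "norm (\<rho> (y u)) = 1" if u: "\<bar>u\<bar> < 1 / 2" for u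
  proof (rule ccontr)
    assume "norm (\<rho> (y u)) \<noteq> 1"
    then have "\<rho> (y u) \<in> interior D4" using \<rho>D[OF yW[OF u]] by simp
    then have "inv_into W \<rho> (\<rho> (y u)) \<in> interior W"
      using diffeo_interior_subset[OF diffeo_inv_into[OF \<rho>]] by blast
    moreover have "inv_into W \<rho> (\<rho> (y u)) = y u"
      using \<rho> yW[OF u] by (auto simp: diffeo_def bij_betw_inv_into_left)
    ultimately have "y u \<in> interior W" by simp
    moreover have "continuous_on UNIV (\<lambda>s. profile_point u s)" by (intro continuous_intros)
    ultimately have "open ((\<lambda>s. profile_point u s) -` interior W)" "f u \<in> (\<lambda>s. profile_point u s) -` interior W"
      by (auto simp: y_def intro!: open_vimage)
    then obtain d where d: "d > 0" "ball (f u) d \<subseteq> (\<lambda>s. profile_point u s) -` interior W" by (meson openE)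
    have "f u - d / 2 \<in> ball (f u) d" using d(1) by (simp add: dist_real_def)
    then have "profile_point u (f u - d / 2) \<in> interior W" using subsetD[OF d(2)] by blast
    then have "f u - d / 2 \<in> S u" using subsetD[OF interior_subset[of W]] by (simp add: S_def)
    then show False using f_le[of "f u - d / 2" u] d(1) by simp
  qed
  have "Cinf_on f {-1/2<..<1/2}"
  proof (rule Cinf_on_local)
    fix u0 :: real assume "u0 \<in> {-1/2<..<1/2}"
    then have u0: "\<bar>u0\<bar> < 1 / 2" by auto
    define p0 where "p0 = y u0"
    obtain U r where U: "p0 \<in> U" "Cinf_on r U" "\<And>p. p \<in> W \<Longrightarrow> p \<in> U \<Longrightarrow> \<rho> p = r p"
      "inj (frechet_derivative r (at p0))"
      using nondegenerate_onE[OF nd yW[OF u0]] unfolding p0_def by metis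
    define h where "h p = 1 - r p \<bullet> r p" for p
    have oU: "open U" using Cinf_on_open[OF U(2)] .
    have hC: "Cinf_on h U" unfolding h_def by (intro Cinf_intros U(2) oU)
    have h_nonneg: "h p \<ge> 0" if "p \<in> W" "p \<in> U" for p
      using \<rho>D[OF that(1)] U(3)[OF that] by (simp add: h_def dot_square_norm abs_square_le_1)
    have h_y: "h (y u) = 0" if "\<bar>u\<bar> < 1 / 2" "y u \<in> U" for u
      using y_bdry[OF that(1)] U(3)[OF yW[OF that(1)] that(2)] by (simp add: h_def dot_square_norm)
    let ?R = "frechet_derivative r (at p0)" and ?H = "frechet_derivative h (at p0)"
    have rD: "(r has_derivative ?R) (at p0)" by (rule Cinf_on_has_derivative[OF U(2,1)])
    have hD: "(h has_derivative ?H) (at p0)" by (rule Cinf_on_has_derivative[OF hC U(1)])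
    have linH: "linear ?H" by (rule has_derivative_linear[OF hD])
    have linR: "linear ?R" by (rule has_derivative_linear[OF rD])
    have "(h has_derivative (\<lambda>v. 0 - (r p0 \<bullet> ?R v + ?R v \<bullet> r p0))) (at p0)"
      unfolding h_def by (intro has_derivative_diff has_derivative_const has_derivative_inner rD)
    from has_derivative_unique[OF hD this]
    have H: "?H v = - 2 * (r p0 \<bullet> ?R v)" for v by (simp add: inner_commute)
    have "surj ?R" using linear_injective_imp_surjective[OF linR U(4)] by simp
    \<comment> \<open>A preimage of the inward normal of the sphere at \<open>r p0\<close>; it shows
      that \<open>?H\<close> is not zero.\<close>
    then obtain v1 where v1: "?R v1 = - r p0" by (metis surjD)
    have "r p0 \<bullet> r p0 = 1" using h_y[OF u0] U(1) by (simp add: p0_def h_def)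
    then have Hv1: "?H v1 = 2" by (simp add: H v1)
    \<comment> \<open>\<open>h\<close> vanishes at \<open>p0\<close> and is nonnegative on
      \<open>W\<close> near \<open>p0\<close>, and the segment from \<open>p0\<close> to
      \<open>q\<close> stays in \<open>W\<close>: the convex set lies on one side of the tangent
      hyperplane.\<close>
    have H_nonneg: "?H (q - p0) \<ge> 0" if q: "q \<in> W" for q
    proof (rule tendsto_lowerbound[OF directional_derivative_tendsto[OF hD]])
      obtain d where d: "d > 0" "ball p0 d \<subseteq> U" using oU U(1) openE by blast
      define d' where "d' = d / (norm (q - p0) + 1)"
      have d': "d' > 0" using d(1) by (simp add: d'_def add_nonneg_pos)
      show "\<forall>\<^sub>F s in at_right 0. 0 \<le> (h (p0 + s *\<^sub>R (q - p0)) - h p0) /\<^sub>R s"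
        using eventually_at_right_less[of 0] eventually_at_right_real[OF d'] eventually_at_right_real[OF zero_less_one]
      proof eventually_elim
        fix s :: real assume "0 < s" "s \<in> {0<..<d'}" "s \<in> {0<..<1}"
        then have s: "0 < s" "s < d'" "s < 1" by auto
        have "p0 + s *\<^sub>R (q - p0) = (1 - s) *\<^sub>R p0 + s *\<^sub>R q" by (simp add: algebra_simps)
        then have inW: "p0 + s *\<^sub>R (q - p0) \<in> W"
          using yW[OF u0] q s conv unfolding p0_def convex_def by auto
        have "s * (norm (q - p0) + 1) < d"
          using s(2) by (simp add: d'_def pos_less_divide_eq add_nonneg_pos)
        then have "s * norm (q - p0) < d" using s(1) by (simp add: algebra_simps)
        then have "dist p0 (p0 + s *\<^sub>R (q - p0)) < d" using s(1) by (simp add: dist_norm)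
        then have "p0 + s *\<^sub>R (q - p0) \<in> U" using subsetD[OF d(2)] by (simp only: mem_ball)
        then have "h (p0 + s *\<^sub>R (q - p0)) \<ge> 0" by (rule h_nonneg[OF inW])
        moreover have "h p0 = 0" using h_y[OF u0] U(1) by (simp add: p0_def)
        ultimately show "0 \<le> (h (p0 + s *\<^sub>R (q - p0)) - h p0) /\<^sub>R s" using s(1) by simp
      qed
    qed simp
    define e2 where "e2 = pt (1 / 2) (- (1 / 2) *\<^sub>R e0)"
    have y_diff: "profile_point u s - profile_point u s' = (s - s') *\<^sub>R e2" for u s s'
      by (simp add: profile_point_eq e2_def scaleR_left_diff_distrib)
    define q where "q = profile_point u0 (1 / 2)"
    have "q \<in> interior W"
    proof (rule interiorI)
      let ?O = "{p. 0 < p $ 1 \<and> p $ 1 < 1 - \<delta> \<and> norm (xs p) < 1 \<and> 2 * \<delta> < sig p}"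
      show "open ?O"
        unfolding sig_def
        by (intro open_Collect_conj open_Collect_less continuous_intros
            linear_continuous_on[OF bounded_linear_xs])
      show "?O \<subseteq> W"
        using \<delta> by (auto intro!: rounded_cylinder_mem_if_sig[OF W] simp: mem_cylinder)
      have "\<bar>1 - (1 / 2 - u0) / 2\<bar> = 1 - (1 / 2 - u0) / 2" using u0 by (auto simp: abs_if)
      then show "q \<in> ?O" using u0 \<delta> by (auto simp: q_def profile_point_coords sig_def field_simps)
    qed
    then obtain \<eta> where \<eta>: "\<eta> > 0" "ball q \<eta> \<subseteq> W" by (meson mem_interior)
    \<comment> \<open>The ball around \<open>q\<close> contains
      \<open>q - \<kappa> *\<^sub>R v1\<close>. The one-sided bound there, with
      \<open>?H v1 = 2\<close>, improves the bound at \<open>q\<close> to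
      \<open>?H (q - p0) \<ge> 2 * \<kappa>\<close>; as \<open>q\<close> lies above
      \<open>p0\<close> on the same line, the line crosses the boundary transversely.\<close>
    define \<kappa> where "\<kappa> = \<eta> / (norm v1 + 1)"
    have \<kappa>: "\<kappa> > 0" using \<eta>(1) by (simp add: \<kappa>_def add_nonneg_pos)
    have "\<kappa> * (norm v1 + 1) = \<eta>" by (simp add: \<kappa>_def) (metis add_nonneg_pos less_irrefl norm_ge_zero zero_less_one)
    then have "\<kappa> * norm v1 < \<eta>" using \<kappa> by (simp add: algebra_simps)
    then have "q - \<kappa> *\<^sub>R v1 \<in> W" using subsetD[OF \<eta>(2), of "q - \<kappa> *\<^sub>R v1"] \<kappa> by (simp add: dist_norm)
    from H_nonneg[OF this] have "?H ((q - p0) - \<kappa> *\<^sub>R v1) \<ge> 0" by (simp add: algebra_simps)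
    then have "?H (q - p0) \<ge> \<kappa> * 2" using linear_diff[OF linH] linear_scale[OF linH] Hv1 by simp
    moreover have "q - p0 = (1 / 2 - f u0) *\<^sub>R e2" by (simp add: q_def p0_def y_def y_diff)
    ultimately have "(1 / 2 - f u0) * ?H e2 > 0" using \<kappa> linear_scale[OF linH] by simp
    then have He2: "?H e2 > 0" using f_half[OF u0] by (simp add: zero_less_mult_iff)
    \<comment> \<open>A substitute for \<open>sig\<close> in which the norm is replaced by the
      component along \<open>e0\<close>: it is affine and returns \<open>s\<close> at
      \<open>profile_point u s\<close>.\<close>
    define l where "l p = p $ 1 + 1 - xs p \<bullet> e0" for p
    have l_profile: "l (profile_point u s) = s" for u s
      by (simp add: l_def profile_point_coords inner_axis_axis field_simps)
    have lC: "Cinf_on l UNIV"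
      unfolding l_def by (intro Cinf_intros Cinf_on_nth Cinf_on_xs open_UNIV)
    define l' where "l' v = v $ 1 - xs v \<bullet> e0" for v
    have lD: "(l has_derivative l') (at p0)"
    proof -
      have "((\<lambda>p. p $ 1 + 1 - xs p \<bullet> e0) has_derivative (\<lambda>v. v $ 1 + 0 - xs v \<bullet> e0)) (at p0)"
        by (intro has_derivative_add has_derivative_diff has_derivative_const has_derivative_inner_left
            bounded_linear_imp_has_derivative bounded_linear_xs bounded_linear_vec_nth)
      then show ?thesis by (simp add: l_def[abs_def] l'_def[abs_def])
    qed
    have l'e2: "l' e2 = 1" by (simp add: l'_def e2_def inner_axis_axis)
    \<comment> \<open>The coordinate \<open>l\<close> is exchanged for \<open>h\<close> and the rest
      is kept. As \<open>h\<close> vanishes at \<open>y u\<close>, the point \<open>G (y u)\<close>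
      is \<open>profile_point u 0\<close>, which is affine in \<open>u\<close>; the local inverse of
      \<open>G\<close> then expresses \<open>y u\<close>, hence \<open>f u\<close>,
      smoothly.\<close>
    define G where "G p = p + (h p - l p) *\<^sub>R e2" for p
    have GC: "Cinf_on G U"
      unfolding G_def by (intro Cinf_intros hC Cinf_on_subset[OF lC] oU) auto
    have "(G has_derivative (\<lambda>v. v + (?H v - l' v) *\<^sub>R e2)) (at p0)"
      unfolding G_def
      by (intro has_derivative_add has_derivative_ident has_derivative_scaleR_left has_derivative_diff hD lD)
    then have GD: "frechet_derivative G (at p0) = (\<lambda>v. v + (?H v - l' v) *\<^sub>R e2)"
      by (rule frechet_derivative_at[symmetric])
    have linG: "linear (frechet_derivative G (at p0))"
      using has_derivative_linear[OF Cinf_on_has_derivative[OF GC U(1)]] .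
    have "v = 0" if "frechet_derivative G (at p0) v = 0" for v
    proof -
      define k where "k = - (?H v - l' v)"
      have v: "v = k *\<^sub>R e2"
        unfolding k_def scaleR_minus_left eq_neg_iff_add_eq_0 using that by (simp add: GD)
      have linl: "linear l'" using has_derivative_linear[OF lD] .
      have "?H v = k * ?H e2"
        using trans[OF arg_cong[OF v, of ?H] linear_scale[OF linH]] by (simp only: real_scaleR_def)
      moreover have "l' v = k"
        using trans[OF arg_cong[OF v, of l'] linear_scale[OF linl]] by (simp only: real_scaleR_def l'e2 mult_1_right)
      ultimately have "k * ?H e2 = 0" unfolding k_def by linarith
      then have "k = 0" using He2 by simp
      then show ?thesis using v by simp
    qed
    then have "inj (frechet_derivative G (at p0))" using linear_injective_0[OF linG] by blast
    then obtain U' V k where I: "open U'" "U' \<subseteq> U" "p0 \<in> U'" "Cinf_on k V"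
      "\<And>p. p \<in> U' \<Longrightarrow> G p \<in> V" "\<And>p. p \<in> U' \<Longrightarrow> k (G p) = p"
      using Cinf_on_local_inverse[OF GC U(1)] by metis
    define T where "T = {-1/2<..<1/2} \<inter> y -` U'"
    have "continuous_on {-1/2<..<1/2} y" unfolding y_def by (intro continuous_intros f_cont)
    then have oT: "open T" unfolding T_def using I(1)
      by (metis Int_commute continuous_on_open_vimage open_greaterThanLessThan)
    have Gy: "G (y u) = profile_point u 0" if "u \<in> T" for u
    proof -
      have u: "\<bar>u\<bar> < 1 / 2" "y u \<in> U" using that I(2) by (auto simp: T_def)
      have "G (y u) = y u - f u *\<^sub>R e2" using h_y[OF u] by (simp add: G_def y_def l_profile)
      then show ?thesis using y_diff[of u "f u" 0] by (simp add: y_def algebra_simps)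
    qed
    have "Cinf_on (\<lambda>u. l (k (profile_point u 0))) T"
    proof (rule Cinf_on_compose[OF lC])
      have "Cinf_on (\<lambda>u. profile_point u 0) T"
        unfolding profile_point_eq by (intro Cinf_intros oT)
      then show "Cinf_on (\<lambda>u. k (profile_point u 0)) T"
      proof (rule Cinf_on_compose[OF I(4)], intro image_subsetI)
        fix u assume u: "u \<in> T"
        show "profile_point u 0 \<in> V"
          unfolding Gy[OF u, symmetric] using u by (intro I(5)) (simp add: T_def)
      qed
    qed simp
    then have "Cinf_on f T"
    proof (rule Cinf_on_cong)
      fix u assume u: "u \<in> T"
      then have "k (profile_point u 0) = y u" using Gy[OF u] I(6)[of "y u"] by (simp add: T_def)
      then show "l (k (profile_point u 0)) = f u" by (simp add: y_def l_profile)
    qed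
    moreover have "u0 \<in> T" using u0 I(3) by (auto simp: T_def p0_def)
    ultimately show "\<exists>V. u0 \<in> V \<and> Cinf_on f V" by blast
  qed simp
  then show ?thesis
  proof (rule that)
    show "p \<in> W \<longleftrightarrow> f (tau p) \<le> sig p" if "\<bar>tau p\<bar> < 1 / 2" "sig p \<le> 1 / 2" for p
      using mem_rounded_cylinder_iff_profile[OF W, of p] S_iff[OF that] by (simp add: S_def)
  qed (use f_lower f_upper in auto)
qed

section \<open>Moving one profile to another\<close>

lemma norm_normalize_diff:
  fixes x y :: "'a::real_normed_vector"
  assumes "norm x \<ge> 1/2" "y \<noteq> 0"
  shows "norm (x /\<^sub>R norm x - y /\<^sub>R norm y) \<le> 4 * norm (x - y)"
proof -
  have x: "norm x > 0" using assms(1) by linarith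
  have "x /\<^sub>R norm x - y /\<^sub>R norm y = (x - y) /\<^sub>R norm x + ((norm y - norm x) / norm x) *\<^sub>R (y /\<^sub>R norm y)"
  proof -
    have "(norm y - norm x) / norm x * inverse (norm y) = inverse (norm x) - inverse (norm y)"
      using x assms(2) by (simp add: field_simps)
    then show ?thesis by (simp only: scaleR_scaleR) (simp add: algebra_simps)
  qed
  then have "norm (x /\<^sub>R norm x - y /\<^sub>R norm y) \<le> norm ((x - y) /\<^sub>R norm x) + norm (((norm y - norm x) / norm x) *\<^sub>R (y /\<^sub>R norm y))"
    by (metis norm_triangle_ineq)
  also have "\<dots> = norm (x - y) / norm x + \<bar>norm y - norm x\<bar> / norm x"
  proof -
    have z: "norm (y /\<^sub>R norm y) = 1" using assms(2) by simp
    have "norm (((norm y - norm x) / norm x) *\<^sub>R (y /\<^sub>R norm y)) = \<bar>norm y - norm x\<bar> / norm x"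
      unfolding norm_scaleR[of "(norm y - norm x) / norm x"] z using x by simp
    moreover have "norm ((x - y) /\<^sub>R norm x) = norm (x - y) / norm x"
      by (simp add: divide_inverse mult.commute)
    ultimately show ?thesis by (simp only:)
  qed
  also have "\<dots> \<le> norm (x - y) / norm x + norm (x - y) / norm x"
    using x norm_triangle_ineq3[of x y] by (intro add_left_mono divide_right_mono) auto
  also have "\<dots> \<le> 2 * norm (x - y) + 2 * norm (x - y)"
  proof -
    have "inverse (norm x) \<le> 2" using le_imp_inverse_le[OF assms(1)] by simp
    then have "norm (x - y) * inverse (norm x) \<le> norm (x - y) * 2" by (rule mult_left_mono) simp
    then show ?thesis by (simp add: divide_inverse mult.commute)
  qed
  finally show ?thesis by simp
qed

lemma sig_lipschitz: "\<bar>sig p - sig q\<bar> \<le> 2 * norm (p - q)"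
  and tau_lipschitz: "\<bar>tau p - tau q\<bar> \<le> 2 * norm (p - q)"
proof -
  have "\<bar>p $ 1 - q $ 1\<bar> \<le> norm (p - q)" using component_le_norm_cart[of "p - q" 1] by simp
  moreover have "\<bar>norm (xs p) - norm (xs q)\<bar> \<le> norm (p - q)"
    using norm_triangle_ineq3[of "xs p" "xs q"] norm_xs_le[of "p - q"] by simp
  ultimately show "\<bar>sig p - sig q\<bar> \<le> 2 * norm (p - q)" "\<bar>tau p - tau q\<bar> \<le> 2 * norm (p - q)"
    by (auto simp: sig_def tau_def)
qed

text \<open>Near the corner the map moves points along the lines \<open>tau = const\<close> on each ray of \<open>D\<^sup>3\<close>; the
  displacement \<open>d\<close> is the difference of two profiles.\<close>

definition corner_move :: "real \<Rightarrow> (real \<Rightarrow> real) \<Rightarrow> real^4 \<Rightarrow> real^4" where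
  "corner_move e d p =
     p + (plateau e (sig p) * d (tau p) / 2) *\<^sub>R pt 1 (- (xs p /\<^sub>R norm (xs p)))"

text \<open>\<open>d\<close> stands for a difference of two profiles: small and of small support,
  but of arbitrary slope. \<open>8 * \<delta> \<le> e\<close> puts the profile values over the
  support, at most \<open>2 * \<delta>\<close>, well into the range where \<open>plateau e\<close>
  is \<open>1\<close>, with room for a displacement of \<open>2 * \<delta>\<close>;
  \<open>(64 * K + 64) * \<delta> \<le> e\<close> makes the slope \<open>K / e\<close> of the
  cut-off harmless.\<close>

locale corner_displacement =
  fixes e \<delta> K :: real and d :: "real \<Rightarrow> real"
  assumes K: "K > 0" "\<And>s t. \<bar>plateau e s - plateau e t\<bar> \<le> K / e * \<bar>s - t\<bar>"
    and e: "0 < e" "e \<le> 1/4" and \<delta>: "0 < \<delta>" "8 * \<delta> \<le> e" "(64 * K + 64) * \<delta> \<le> e"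
    and d_smooth: "Cinf_on d UNIV" and d_le: "\<And>u. \<bar>d u\<bar> \<le> 2 * \<delta>"
    and d_0: "\<And>u. 2 * \<delta> \<le> \<bar>u\<bar> \<Longrightarrow> d u = 0"
begin

definition w :: "real^4 \<Rightarrow> real" where "w p = plateau e (sig p) * d (tau p)"

lemma move_eq: "corner_move e d p = p + (w p / 2) *\<^sub>R pt 1 (- (xs p /\<^sub>R norm (xs p)))"
  by (simp add: corner_move_def w_def)

lemma w_eq_0: "e \<le> \<bar>sig p\<bar> \<or> 2 * \<delta> \<le> \<bar>tau p\<bar> \<Longrightarrow> w p = 0"
  using plateau_eq_0[OF e(1)] d_0 by (auto simp: w_def)

lemma w_support: assumes "w p \<noteq> 0" shows "\<bar>sig p\<bar> < e" "\<bar>tau p\<bar> < 2 * \<delta>" "1 - e \<le> norm (xs p)" "\<bar>p $ 1\<bar> < e"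
proof -
  show a: "\<bar>sig p\<bar> < e" "\<bar>tau p\<bar> < 2 * \<delta>" using w_eq_0[of p] assms by linarith+
  have "1 - norm (xs p) = (sig p - tau p) / 2" "p $ 1 = (sig p + tau p) / 2"
    by (simp_all add: sig_def tau_def field_simps)
  then show "1 - e \<le> norm (xs p)" "\<bar>p $ 1\<bar> < e" using a \<delta> e by (auto simp: abs_if split: if_splits)
qed

lemma move_id: "w p = 0 \<Longrightarrow> corner_move e d p = p"
  by (simp add: move_eq)

lemma w_le: "\<bar>w p\<bar> \<le> 2 * \<delta>"
proof -
  have "\<bar>w p\<bar> = plateau e (sig p) * \<bar>d (tau p)\<bar>" by (simp add: w_def abs_mult plateau_nonneg)
  also have "\<dots> \<le> 1 * (2 * \<delta>)" using d_le plateau_le_1 plateau_nonneg by (intro mult_mono) auto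
  finally show ?thesis by simp
qed

lemma move_coords:
  assumes "w p \<noteq> 0"
  shows "corner_move e d p $ 1 = p $ 1 + w p / 2"
    "xs (corner_move e d p) = (1 - w p / 2 / norm (xs p)) *\<^sub>R xs p"
    "norm (xs (corner_move e d p)) = norm (xs p) - w p / 2"
    "sig (corner_move e d p) = sig p + w p" "tau (corner_move e d p) = tau p"
proof -
  have n: "norm (xs p) \<ge> 1 - e" using w_support[OF assms] by simp
  then have n0: "norm (xs p) > 0" using e by linarith
  show 1: "corner_move e d p $ 1 = p $ 1 + w p / 2" by (simp add: move_eq)
  have "(w p / 2) *\<^sub>R (- (xs p /\<^sub>R norm (xs p))) = - ((w p / 2 / norm (xs p)) *\<^sub>R xs p)"
    by (simp only: scaleR_minus_right scaleR_scaleR divide_inverse[symmetric])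
  then show 2: "xs (corner_move e d p) = (1 - w p / 2 / norm (xs p)) *\<^sub>R xs p"
    unfolding move_eq xs_add xs_scaleR xs_pt by (simp only: scaleR_left_diff_distrib scaleR_one) simp
  have "w p / 2 \<le> norm (xs p)" using w_le[of p] n \<delta> e by (auto simp: abs_le_iff)
  then have "0 \<le> 1 - w p / 2 / norm (xs p)" using n0 by (simp add: field_simps)
  then have "norm (xs (corner_move e d p)) = (1 - w p / 2 / norm (xs p)) * norm (xs p)" by (simp add: 2)
  also have "\<dots> = norm (xs p) - w p / 2" using n0 by (simp add: field_simps)
  finally show 3: "norm (xs (corner_move e d p)) = norm (xs p) - w p / 2" .
  show "sig (corner_move e d p) = sig p + w p" "tau (corner_move e d p) = tau p"
    unfolding sig_def tau_def 1 3 by simp_all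
qed

lemma tau_move: "tau (corner_move e d p) = tau p"
  using move_coords(5)[of p] move_id[of p] by (cases "w p = 0") auto

text \<open>The direction of motion is singular on the axis \<open>xs p = 0\<close>, but at depth
  more than \<open>e\<close> the map is the identity.\<close>

lemma smooth_move: "Cinf_on (corner_move e d) UNIV"
proof (rule Cinf_on_local)
  fix p
  show "\<exists>V. p \<in> V \<and> Cinf_on (corner_move e d) V"
  proof (cases "xs p = 0")
    case True
    let ?V = "{p. norm (xs p) < 1 - e}"
    have "open ?V" by (intro open_Collect_less continuous_intros linear_continuous_on[OF bounded_linear_xs])
    moreover have "corner_move e d q = q" if "q \<in> ?V" for q
      using that w_support(3)[of q] by (intro move_id) fastforce
    ultimately have "Cinf_on (corner_move e d) ?V"
      by (intro Cinf_on_cong[OF Cinf_on_id]) auto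
    then show ?thesis using True e by (intro exI[of _ ?V]) auto
  next
    case False
    let ?V = "{p. xs p \<noteq> 0}"
    have oV: "open ?V" by (intro open_Collect_neq continuous_intros linear_continuous_on[OF bounded_linear_xs])
    have x: "Cinf_on xs ?V" using Cinf_on_bounded_linear[OF bounded_linear_xs oV] .
    have n: "Cinf_on (\<lambda>p. norm (xs p)) ?V" by (rule Cinf_on_norm[OF x]) simp
    have c: "Cinf_on (\<lambda>p. p $ 1) ?V" by (rule Cinf_on_nth[OF Cinf_on_id[OF oV]])
    have s: "Cinf_on sig ?V" "Cinf_on tau ?V"
      unfolding sig_def[abs_def] tau_def[abs_def] by (intro Cinf_intros n c oV)+
    have "Cinf_on (\<lambda>p. plateau e (sig p)) ?V" by (rule Cinf_on_compose[OF Cinf_on_plateau s(1)]) simp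
    moreover have "Cinf_on (\<lambda>p. d (tau p)) ?V" by (rule Cinf_on_compose[OF d_smooth s(2)]) simp
    moreover have "Cinf_on (\<lambda>p. inverse (norm (xs p))) ?V" by (rule Cinf_on_inverse[OF n]) simp
    ultimately have "Cinf_on (\<lambda>p. p + (plateau e (sig p) * d (tau p) * (1 / 2)) *\<^sub>R
        pt 1 (- (inverse (norm (xs p)) *\<^sub>R xs p))) ?V"
      by (intro Cinf_intros Cinf_on_pt x oV)
    moreover have "corner_move e d = (\<lambda>p. p + (plateau e (sig p) * d (tau p) * (1 / 2)) *\<^sub>R
        pt 1 (- (inverse (norm (xs p)) *\<^sub>R xs p)))"
      by (rule ext) (simp add: corner_move_def)
    ultimately have "Cinf_on (corner_move e d) ?V" by (simp only:)
    then show ?thesis using False by (intro exI[of _ ?V]) simp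
  qed
qed simp

text \<open>A shear again: \<open>tau\<close> is preserved, so
  \<open>\<bar>tau p - tau q\<bar>\<close> is at most twice the distance of the images, and the
  uncontrolled slope \<open>D\<close> of \<open>d\<close> multiplies that distance only. The
  remaining terms, from the cut-off and from the turning of the rays, carry a factor
  \<open>\<delta>\<close> and are absorbed.\<close>

lemma move_lower_bound:
  obtains m where "m > 0" "\<And>p q. m * norm (p - q) \<le> norm (corner_move e d p - corner_move e d q)"
proof -
  have z1: "d u = 0" if "u \<le> - (2 * \<delta>)" for u using d_0[of u] that by linarith
  have z2: "d u = 0" if "2 * \<delta> \<le> u" for u using d_0[of u] that by linarith
  obtain D where D: "D > 0" "\<And>u v. norm (d u - d v) \<le> D * \<bar>u - v\<bar>"
    using lipschitz_if_compact_support_1[OF d_smooth z1 z2] by blast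
  let ?N = "\<lambda>p. pt 1 (- (xs p /\<^sub>R norm (xs p)))"
  \<comment> \<open>That \<open>q\<close> is displaced keeps it away from the axis, where the unit
    radial direction is not Lipschitz; if neither point is displaced, nothing is to be
    shown.\<close>
  have main: "norm (p - q) / 2 \<le> (1 + 2 * D) * norm (corner_move e d p - corner_move e d q)" if wq: "w q \<noteq> 0" for p q
  proof -
    let ?f = "norm (corner_move e d p - corner_move e d q)"
    have sq: "norm (xs q) \<ge> 1 / 2" using w_support(3)[OF wq] e by simp
    have N_le: "norm (?N p) \<le> 2" for p
    proof -
      have "norm (- (xs p /\<^sub>R norm (xs p))) \<le> 1" by (cases "xs p = 0") simp_all
      then show ?thesis using norm_pt_le[of 1 "- (xs p /\<^sub>R norm (xs p))"] by linarith
    qed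
    have wd: "\<bar>w p - w q\<bar> \<le> 4 * K * \<delta> / e * norm (p - q) + D * (2 * ?f)"
    proof -
      have "w p - w q = (plateau e (sig p) - plateau e (sig q)) * d (tau p) + plateau e (sig q) * (d (tau p) - d (tau q))"
        by (simp add: w_def algebra_simps)
      then have "\<bar>w p - w q\<bar> \<le> \<bar>plateau e (sig p) - plateau e (sig q)\<bar> * \<bar>d (tau p)\<bar> + plateau e (sig q) * \<bar>d (tau p) - d (tau q)\<bar>"
        using abs_triangle_ineq[of "(plateau e (sig p) - plateau e (sig q)) * d (tau p)" "plateau e (sig q) * (d (tau p) - d (tau q))"]
        by (simp add: abs_mult plateau_nonneg)
      also have "\<dots> \<le> (K / e * (2 * norm (p - q))) * (2 * \<delta>) + 1 * (D * (2 * ?f))"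
      proof (intro add_mono mult_mono)
        show "\<bar>plateau e (sig p) - plateau e (sig q)\<bar> \<le> K / e * (2 * norm (p - q))"
          using order_trans[OF K(2) mult_left_mono[OF sig_lipschitz]] K(1) e(1) by simp
        have "\<bar>tau p - tau q\<bar> \<le> 2 * ?f"
          using tau_lipschitz[of "corner_move e d p" "corner_move e d q"] by (simp add: tau_move)
        then have "D * \<bar>tau p - tau q\<bar> \<le> D * (2 * ?f)" using D(1) by (intro mult_left_mono) auto
        then show "\<bar>d (tau p) - d (tau q)\<bar> \<le> D * (2 * ?f)" using D(2)[of "tau p" "tau q"] by simp
      qed (use d_le K e plateau_le_1 plateau_nonneg in auto)
      finally show ?thesis by (simp add: field_simps)
    qed
    have diff: "norm ((w p / 2) *\<^sub>R ?N p - (w q / 2) *\<^sub>R ?N q) \<le> \<bar>w p - w q\<bar> + 4 * \<delta> * norm (p - q)"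
    proof (cases "w p = 0")
      case True
      have "norm ((w p / 2) *\<^sub>R ?N p - (w q / 2) *\<^sub>R ?N q) = \<bar>w q\<bar> / 2 * norm (?N q)" using True by simp
      also have "\<dots> \<le> \<bar>w q\<bar> / 2 * 2" using N_le by (intro mult_left_mono) auto
      also have "\<dots> \<le> \<bar>w p - w q\<bar> + 4 * \<delta> * norm (p - q)" using True \<delta> by simp
      finally show ?thesis .
    next
      case False
      have sp: "xs p \<noteq> 0" using w_support(3)[OF False] e by auto
      have "?N q - ?N p = pt 0 (xs p /\<^sub>R norm (xs p) - xs q /\<^sub>R norm (xs q))" by (simp add: pt_diff)
      then have "norm (?N q - ?N p) = norm (xs q /\<^sub>R norm (xs q) - xs p /\<^sub>R norm (xs p))"
        by (simp add: norm_minus_commute)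
      also have "\<dots> \<le> 4 * norm (xs q - xs p)" by (rule norm_normalize_diff[OF sq sp])
      also have "\<dots> \<le> 4 * norm (p - q)" using norm_xs_le[of "q - p"] by (simp add: norm_minus_commute)
      finally have Nd: "norm (?N p - ?N q) \<le> 4 * norm (p - q)" by (simp add: norm_minus_commute)
      have "(w p / 2) *\<^sub>R ?N p - (w q / 2) *\<^sub>R ?N q = ((w p - w q) / 2) *\<^sub>R ?N p + (w q / 2) *\<^sub>R (?N p - ?N q)"
        by (simp add: algebra_simps diff_divide_distrib)
      then have "norm ((w p / 2) *\<^sub>R ?N p - (w q / 2) *\<^sub>R ?N q) \<le> \<bar>w p - w q\<bar> / 2 * norm (?N p) + \<bar>w q\<bar> / 2 * norm (?N p - ?N q)"
        using norm_triangle_ineq[of "((w p - w q) / 2) *\<^sub>R ?N p" "(w q / 2) *\<^sub>R (?N p - ?N q)"] by simp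
      also have "\<dots> \<le> \<bar>w p - w q\<bar> / 2 * 2 + \<delta> * (4 * norm (p - q))"
        using N_le Nd w_le[of q] \<delta>(1) by (intro add_mono mult_mono) auto
      finally show ?thesis by simp
    qed
    have "p - q = (corner_move e d p - corner_move e d q) - ((w p / 2) *\<^sub>R ?N p - (w q / 2) *\<^sub>R ?N q)"
      by (simp add: move_eq)
    then have "norm (p - q) \<le> ?f + norm ((w p / 2) *\<^sub>R ?N p - (w q / 2) *\<^sub>R ?N q)"
      by (metis norm_triangle_ineq4)
    then have "norm (p - q) \<le> (1 + 2 * D) * ?f + (4 * K * \<delta> / e + 4 * \<delta>) * norm (p - q)"
      using wd diff by (simp add: algebra_simps)
    moreover have "(4 * K * \<delta> / e + 4 * \<delta>) * norm (p - q) \<le> 1 / 2 * norm (p - q)"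
    proof (rule mult_right_mono)
      have "(64 * K + 64) * \<delta> = 64 * (K * \<delta>) + 64 * \<delta>" by (simp add: algebra_simps)
      then have "64 * (K * \<delta>) \<le> e" "64 * \<delta> \<le> e" using \<delta>(1,3) mult_pos_pos[OF K(1) \<delta>(1)] by linarith+
      then have "4 * K * \<delta> / e \<le> 1 / 16" "4 * \<delta> \<le> 1 / 16" using e by (auto simp: field_simps)
      then show "4 * K * \<delta> / e + 4 * \<delta> \<le> 1 / 2" by simp
    qed simp
    ultimately show ?thesis by linarith
  qed
  define m where "m = 1 / (2 * (1 + 2 * D))"
  have m: "m > 0" "m \<le> 1" using D(1) by (auto simp: m_def field_simps)
  have "m * norm (p - q) \<le> norm (corner_move e d p - corner_move e d q)" for p q
  proof -
    consider "w p = 0" "w q = 0" | "w q \<noteq> 0" | "w p \<noteq> 0" by blast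
    then show ?thesis
    proof cases
      case 1
      then show ?thesis using m mult_right_mono[OF m(2), of "norm (p - q)"] by (simp add: move_id)
    next
      case 2
      then show ?thesis using main[of q p] D(1) by (simp add: m_def field_simps)
    next
      case 3
      then show ?thesis using main[of p q] D(1) by (simp add: m_def field_simps norm_minus_commute)
    qed
  qed
  then show ?thesis using that m(1) by blast
qed

end

text \<open>On a line \<open>tau = u\<close> the map shifts \<open>sig\<close> by
  \<open>plateau e (sig p) * (f2 u - f1 u)\<close>. At the profiles the plateau is \<open>1\<close>,
  so the end \<open>f1 u\<close> goes to \<open>f2 u\<close>; from \<open>sig = e\<close> on nothing
  moves. The restriction \<open>p $ 1 \<le> 1/2\<close> is there because \<open>sig\<close> and
  \<open>tau\<close> describe the lower corner only.\<close>

lemma corner_move_swaps: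
  assumes "corner_displacement e \<delta> K (\<lambda>u. if \<bar>u\<bar> < 1/2 then f2 u - f1 u else 0)"
    (is "corner_displacement e \<delta> K ?d")
    and W: "rounded_cylinder \<delta> W1" "rounded_cylinder \<delta> W2"
    and f1: "\<And>u. \<bar>u\<bar> < 1/2 \<Longrightarrow> \<bar>u\<bar> \<le> f1 u" "\<And>u. \<bar>u\<bar> < 1/2 \<Longrightarrow> f1 u \<le> max \<bar>u\<bar> (2 * \<delta>)"
      "\<And>p. \<bar>tau p\<bar> < 1/2 \<Longrightarrow> sig p \<le> 1/2 \<Longrightarrow> p \<in> W1 \<longleftrightarrow> f1 (tau p) \<le> sig p"
    and f2: "\<And>u. \<bar>u\<bar> < 1/2 \<Longrightarrow> \<bar>u\<bar> \<le> f2 u" "\<And>u. \<bar>u\<bar> < 1/2 \<Longrightarrow> f2 u \<le> max \<bar>u\<bar> (2 * \<delta>)"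
      "\<And>p. \<bar>tau p\<bar> < 1/2 \<Longrightarrow> sig p \<le> 1/2 \<Longrightarrow> p \<in> W2 \<longleftrightarrow> f2 (tau p) \<le> sig p"
  shows "\<And>p. p \<in> W1 \<Longrightarrow> p $ 1 \<le> 1/2 \<Longrightarrow> corner_move e ?d p \<in> W2 \<and> corner_move e ?d p $ 1 \<le> 1/2"
    and "\<And>q. q \<in> W2 \<Longrightarrow> q $ 1 \<le> 1/2 \<Longrightarrow> \<exists>p\<in>W1. p $ 1 \<le> 1/2 \<and> corner_move e ?d p = q"
proof -
  interpret corner_displacement e \<delta> K ?d by fact
  have far: "p \<in> W1 \<longleftrightarrow> p \<in> W2" if p: "p \<in> cylinder" "p $ 1 \<le> 1/2" "e \<le> \<bar>sig p\<bar> \<or> 2 * \<delta> \<le> \<bar>tau p\<bar>" for p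
  proof -
    have "\<bar>tau p\<bar> \<le> sig p" using p(1) by (auto simp: mem_cylinder tau_def sig_def abs_le_iff)
    then have "2 * \<delta> \<le> sig p" using p(3) \<delta> by linarith
    then show ?thesis
      using rounded_cylinder_mem_if_sig[OF W(1) p(1)] rounded_cylinder_mem_if_sig[OF W(2) p(1)] p(2) e \<delta> by simp
  qed
  note sub = rounded_cylinder_subset[OF W(1)] rounded_cylinder_subset[OF W(2)]
  have \<delta>e: "\<delta> < 1 / 16" "2 * \<delta> < 1 / 2" using \<delta> e by auto
  show "corner_move e ?d p \<in> W2 \<and> corner_move e ?d p $ 1 \<le> 1/2" if p: "p \<in> W1" "p $ 1 \<le> 1/2" for p
  proof (cases "w p = 0")
    case True
    have "p \<in> W2"
    proof (cases "e \<le> \<bar>sig p\<bar> \<or> 2 * \<delta> \<le> \<bar>tau p\<bar>")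
      case True
      then show ?thesis using far p sub by blast
    next
      case False
      then have st: "\<bar>tau p\<bar> < 1 / 2" "sig p \<le> 1 / 2" "sig p < e" "\<bar>tau p\<bar> < 2 * \<delta>" using \<delta>e e by auto
      then have f1p: "f1 (tau p) \<le> sig p" using f1(3) p by blast
      have "f2 (tau p) \<le> sig p"
      proof (cases "\<bar>sig p\<bar> \<le> e / 2")
        case s: True
        then have "f2 (tau p) = f1 (tau p)"
          using \<open>w p = 0\<close>[unfolded w_def] plateau_eq_1[OF e(1) s] st by simp
        then show ?thesis using f1p by simp
      next
        case F: False
        have "f2 (tau p) \<le> 2 * \<delta>" using f2(2)[OF st(1)] st by simp
        moreover have "0 \<le> sig p" using f1p f1(1)[OF st(1)] by linarith
        ultimately show ?thesis using F \<delta> by simp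
      qed
      then show ?thesis using f2(3) st by blast
    qed
    then show ?thesis unfolding move_id[OF True] using p by simp
  next
    case False
    note mc = move_coords[OF False] and ws = w_support[OF False]
    have st: "\<bar>tau p\<bar> < 1 / 2" "sig p \<le> 1 / 2" using ws \<delta>e e by auto
    then have f1p: "f1 (tau p) \<le> sig p" using f1(3) p by blast
    have s0: "0 \<le> sig p" using f1p f1(1)[OF st(1)] by linarith
    have f2l: "f2 (tau p) \<le> 2 * \<delta>" using f2(2)[OF st(1)] ws by simp
    have "f2 (tau p) \<le> sig p + w p"
    proof (cases "sig p \<le> e / 2")
      case True
      then have "w p = f2 (tau p) - f1 (tau p)" using plateau_eq_1[OF e(1)] s0 st unfolding w_def by simp
      then show ?thesis using f1p by simp
    next
      case F: False
      then show ?thesis using f2l w_le[of p] \<delta> by (auto simp: abs_le_iff)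
    qed
    moreover have "sig p + w p \<le> 1 / 2" using w_le[of p] ws e \<delta> by (auto simp: abs_le_iff)
    ultimately have "corner_move e ?d p \<in> W2" using f2(3)[of "corner_move e ?d p"] mc st by simp
    moreover have "corner_move e ?d p $ 1 \<le> 1 / 2" using mc(1) ws(4) w_le[of p] e \<delta> by (auto simp: abs_le_iff)
    ultimately show ?thesis by simp
  qed
  show "\<exists>p\<in>W1. p $ 1 \<le> 1/2 \<and> corner_move e ?d p = q" if q: "q \<in> W2" "q $ 1 \<le> 1/2" for q
  proof (cases "e \<le> \<bar>sig q\<bar> \<or> 2 * \<delta> \<le> \<bar>tau q\<bar>")
    case True
    then have "q \<in> W1" using far q rounded_cylinder_subset[OF W(2)] by blast
    then show ?thesis using q move_id[OF w_eq_0[OF True]] by blast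
  next
    case False
    then have st: "\<bar>tau q\<bar> < 1 / 2" "sig q \<le> 1 / 2" "sig q < e" "\<bar>tau q\<bar> < 2 * \<delta>" using \<delta> e by auto
    let ?u = "tau q"
    have f2q: "f2 ?u \<le> sig q" using f2(3) st q by blast
    have fl: "f1 ?u \<le> 2 * \<delta>" "f2 ?u \<le> 2 * \<delta>" "0 \<le> f1 ?u" "0 \<le> f2 ?u"
      using f1(1,2)[OF st(1)] f2(1,2)[OF st(1)] st by auto
    \<comment> \<open>The motion along the line through \<open>q\<close>. It maps
      \<open>f1 ?u\<close> to \<open>f2 ?u\<close> and fixes \<open>e\<close>, so the intermediate
      value theorem finds a preimage of \<open>sig q\<close>.\<close>
    define g where "g s = s + plateau e s * ?d ?u" for s
    have gc: "continuous_on {f1 ?u..e} g"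
      unfolding g_def
      by (intro continuous_intros continuous_on_subset[OF Cinf_on_continuous_on[OF Cinf_on_plateau]]) auto
    have "\<bar>f1 ?u\<bar> \<le> e / 2" using fl \<delta> by simp
    then have "g (f1 ?u) = f2 ?u" using plateau_eq_1[OF e(1)] st by (simp add: g_def)
    moreover have "g e = e" using plateau_eq_0[OF e(1), of e] e by (simp add: g_def)
    ultimately obtain s where s: "f1 ?u \<le> s" "s \<le> e" "g s = sig q"
      using IVT'[of g "f1 ?u" "sig q" e] f2q st(3) gc fl \<delta> by auto
    define k where "k = (sig q - s) / 2"
    have ks: "\<bar>k\<bar> \<le> \<delta>"
    proof -
      have "sig q - s = plateau e s * ?d ?u" using s(3) by (simp add: g_def)
      then have "\<bar>sig q - s\<bar> = plateau e s * \<bar>?d ?u\<bar>" by (simp add: abs_mult plateau_nonneg)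
      also have "\<dots> \<le> 1 * (2 * \<delta>)" using d_le[of ?u] plateau_le_1 plateau_nonneg by (intro mult_mono) auto
      finally show ?thesis by (simp add: k_def)
    qed
    have "1 - norm (xs q) = (sig q - tau q) / 2" by (simp add: sig_def tau_def field_simps)
    then have nq: "norm (xs q) \<ge> 1 / 2" using st e \<delta> by (auto simp: abs_if split: if_splits)
    then have nq0: "norm (xs q) > 0" by linarith
    define p where "p = pt (q $ 1 - k) ((1 + k / norm (xs q)) *\<^sub>R xs q)"
    define r where "r = 1 + k / norm (xs q)"
    have r: "0 < r" using ks nq \<delta> e nq0 by (simp add: r_def field_simps abs_le_iff)
    have xp: "xs p = r *\<^sub>R xs q" by (simp add: p_def r_def)
    have np: "norm (xs p) = norm (xs q) + k" "xs p /\<^sub>R norm (xs p) = xs q /\<^sub>R norm (xs q)"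
    proof -
      have "norm (xs p) = r * norm (xs q)" using r by (simp add: xp)
      then show "norm (xs p) = norm (xs q) + k" using nq0 by (simp add: r_def field_simps)
      show "xs p /\<^sub>R norm (xs p) = xs q /\<^sub>R norm (xs q)" using r by (simp add: xp)
    qed
    have "sig p = s" "tau p = tau q"
      unfolding sig_def[of p] tau_def np(1) by (simp_all add: p_def k_def sig_def field_simps)
    moreover have "a = 2 * ((b - s) / 2)" if "s + a = b" for a b :: real using that by simp
    from this[OF s(3)[unfolded g_def]] have "plateau e s * ?d ?u = 2 * k" unfolding k_def .
    ultimately have sp: "sig p = s" "tau p = tau q" "w p = 2 * k" by (simp_all only: w_def)
    have "p \<in> W1" using f1(3)[of p] sp st s e by simp
    moreover have "p $ 1 \<le> 1 / 2"
    proof -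
      have "p $ 1 = (sig p + tau p) / 2" by (simp add: sig_def tau_def field_simps)
      then show ?thesis using sp s st e \<delta> by simp
    qed
    moreover have "corner_move e ?d p = q"
    proof -
      have "corner_move e ?d p = p + k *\<^sub>R pt 1 (- (xs q /\<^sub>R norm (xs q)))"
        unfolding move_eq sp(3) np(2) by simp
      also have "\<dots> = pt (q $ 1) (xs q)"
        unfolding p_def pt_scaleR pt_add using nq0 by (simp add: pt_eq_iff algebra_simps divide_inverse)
      finally show ?thesis by simp
    qed
    ultimately show ?thesis by blast
  qed
qed

section \<open>Comparing the spun disks\<close>

text \<open>Carries the upper corner to the lower one. It reverses orientation, which does no harm
  since maps are only conjugated by it.\<close>

definition reflect :: "real^4 \<Rightarrow> real^4" where "reflect p = pt (1 - p $ 1) (xs p)"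

lemma reflect_nth [simp]: "reflect p $ 1 = 1 - p $ 1" and xs_reflect [simp]: "xs (reflect p) = xs p"
  and reflect_reflect [simp]: "reflect (reflect p) = p" and reflect_pt: "reflect (pt t x) = pt (1 - t) x"
  by (simp_all add: reflect_def)

lemma norm_reflect_diff [simp]: "norm (reflect p - reflect q) = norm (p - q)"
proof -
  have "norm (pt (- t) x) = norm (pt t x)" for t x by (simp add: norm_pt)
  then have "norm (pt (- (p $ 1 - q $ 1)) (xs p - xs q)) = norm (pt (p $ 1 - q $ 1) (xs p - xs q))" .
  moreover have "pt (p $ 1 - q $ 1) (xs p - xs q) = p - q" by (metis pt_diff pt_xs)
  ultimately show ?thesis by (simp add: reflect_def pt_diff)
qed

lemma Cinf_on_reflect: "Cinf_on reflect UNIV"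
  unfolding reflect_def[abs_def] by (intro Cinf_on_pt Cinf_intros Cinf_on_nth Cinf_on_xs open_UNIV)

lemma mem_reflect_image: "p \<in> reflect ` W \<longleftrightarrow> reflect p \<in> W"
  by (metis image_iff reflect_reflect)

lemma rounded_cylinder_reflect:
  assumes W: "rounded_cylinder \<delta> W" shows "rounded_cylinder \<delta> (reflect ` W)"
  unfolding rounded_cylinder_def
proof (intro conjI ballI allI impI)
  have cyl: "reflect p \<in> cylinder \<longleftrightarrow> p \<in> cylinder" for p by (auto simp: mem_cylinder)
  show "reflect ` W \<subseteq> cylinder" using rounded_cylinder_subset[OF W] cyl by blast
  show "\<exists>c\<in>corners. dist p c < \<delta>" if p: "p \<in> cylinder - reflect ` W" for p
  proof -
    have "reflect p \<in> cylinder - W" using p cyl by (simp add: mem_reflect_image)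
    then obtain c where c: "c \<in> corners" "dist (reflect p) c < \<delta>" using W unfolding rounded_cylinder_def by blast
    obtain t x where "c = pt t x" "t \<in> {0, 1}" "x \<in> S2" using c(1) unfolding corners_def by blast
    then have "1 - t \<in> {0, 1}" "reflect c = pt (1 - t) x" "x \<in> S2" by (auto simp: reflect_pt)
    then have "reflect c \<in> corners" unfolding corners_def by blast
    moreover have "dist p (reflect c) < \<delta>"
      using c(2) norm_reflect_diff[of "reflect p" c] by (simp add: dist_norm)
    ultimately show ?thesis by blast
  qed
  show "convex (reflect ` W)"
    unfolding convex_def
  proof (intro ballI allI impI)
    fix p q :: "real^4" and u v :: real
    assume pq: "p \<in> reflect ` W" "q \<in> reflect ` W" and uv: "0 \<le> u" "0 \<le> v" "u + v = 1"
    have "convex W" using W by (simp add: rounded_cylinder_def)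
    then have "u *\<^sub>R reflect p + v *\<^sub>R reflect q \<in> W"
      using pq uv unfolding mem_reflect_image convex_def by blast
    moreover have "u *\<^sub>R reflect p + v *\<^sub>R reflect q = reflect (u *\<^sub>R p + v *\<^sub>R q)"
    proof -
      have "u * (1 - a) + v * (1 - b) = 1 - (u * a + v * b)" for a b :: real
        using uv(3) by (simp add: algebra_simps)
      then show ?thesis by (simp add: reflect_def pt_add pt_scaleR)
    qed
    ultimately show "u *\<^sub>R p + v *\<^sub>R q \<in> reflect ` W" by (simp add: mem_reflect_image)
  qed
  show "pt t (A x) \<in> reflect ` W" if "orthogonal_transformation A" "pt t x \<in> reflect ` W" for A t x
    using that W unfolding mem_reflect_image reflect_pt rounded_cylinder_def by blast
  obtain \<rho> where \<rho>: "diffeo W D4 \<rho>" using W unfolding rounded_cylinder_def by blast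
  have "diffeo (reflect ` W) W reflect"
  proof (rule diffeoI[where g = reflect])
    show "bij_betw reflect (reflect ` W) W"
      by (rule bij_betw_byWitness[where f' = reflect]) auto
  qed (auto intro: smooth_onI_Cinf_on[OF Cinf_on_reflect])
  from diffeo_compose[OF this \<rho>] show "\<exists>\<rho>. diffeo (reflect ` W) D4 \<rho>" by blast
qed

text \<open>What the arc has to know about the slide between two roundings: a point is unmoved in
  space, or it stays on its ray and within \<open>e\<close> of the sphere, where the straightened
  arc is radial.\<close>

definition radially_related :: "real \<Rightarrow> 'a::real_normed_vector \<Rightarrow> 'a \<Rightarrow> bool" where
  "radially_related e x y \<longleftrightarrow> y = x \<or> (\<exists>k>0. y = k *\<^sub>R x) \<and> 1 - e \<le> norm x \<and> 1 - e \<le> norm y"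

lemma radially_related_trans:
  assumes "radially_related e x y" "radially_related e y z" shows "radially_related e x z"
proof (cases "y = x \<or> z = y")
  case False
  then obtain k l where "k > 0" "y = k *\<^sub>R x" "l > 0" "z = l *\<^sub>R y" "1 - e \<le> norm x" "1 - e \<le> norm z"
    using assms unfolding radially_related_def by blast
  then have "l * k > 0" "z = (l * k) *\<^sub>R x" "1 - e \<le> norm x" "1 - e \<le> norm z" by auto
  then show ?thesis unfolding radially_related_def by blast
qed (use assms in auto)

lemma (in corner_displacement) move_radially_related:
  "radially_related (2 * e) (xs p) (xs (corner_move e d p))"
proof (cases "w p = 0")
  case False
  note mc = move_coords[OF False] and ws = w_support[OF False]
  have n: "norm (xs p) > 0" using ws(3) e by linarith
  have le: "\<bar>w p / 2\<bar> \<le> e / 8" using w_le[of p] \<delta> by simp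
  then have "w p / 2 < norm (xs p)" using ws(3) e by linarith
  then have "0 < 1 - w p / 2 / norm (xs p)" using n by (simp add: field_simps)
  moreover have "1 - 2 * e \<le> norm (xs p)" using ws(3) e by linarith
  moreover have "1 - 2 * e \<le> norm (xs (corner_move e d p))" unfolding mc(3) using ws(3) e le by linarith
  ultimately show ?thesis unfolding radially_related_def using mc(2) by blast
qed (simp add: move_id radially_related_def)

text \<open>Profiles exist only for \<open>\<bar>u\<bar> < 1/2\<close>, but both equal
  \<open>\<bar>u\<bar>\<close> as soon as \<open>\<bar>u\<bar> \<ge> 2 * \<delta>\<close>, so the
  difference vanishes well before the ends and extends by \<open>0\<close>.\<close>

lemma profile_difference:
  fixes f g :: "real \<Rightarrow> real" and u \<delta> :: real
  assumes \<delta>: "0 < \<delta>" "\<delta> \<le> 1 / 16" and f: "Cinf_on f {-1/2<..<1/2}" "Cinf_on g {-1/2<..<1/2}"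
    and f': "\<And>u. \<bar>u\<bar> < 1/2 \<Longrightarrow> \<bar>u\<bar> \<le> f u" "\<And>u. \<bar>u\<bar> < 1/2 \<Longrightarrow> f u \<le> max \<bar>u\<bar> (2 * \<delta>)"
    and g': "\<And>u. \<bar>u\<bar> < 1/2 \<Longrightarrow> \<bar>u\<bar> \<le> g u" "\<And>u. \<bar>u\<bar> < 1/2 \<Longrightarrow> g u \<le> max \<bar>u\<bar> (2 * \<delta>)"
  defines "d \<equiv> \<lambda>u. if \<bar>u\<bar> < 1/2 then g u - f u else 0"
  shows "Cinf_on d UNIV" "\<bar>d u\<bar> \<le> 2 * \<delta>" "2 * \<delta> \<le> \<bar>u\<bar> \<Longrightarrow> d u = 0"
proof -
  have d0: "d u = 0" if "2 * \<delta> \<le> \<bar>u\<bar>" for u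
    using f'(1,2)[of u] g'(1,2)[of u] that by (auto simp: d_def)
  show "2 * \<delta> \<le> \<bar>u\<bar> \<Longrightarrow> d u = 0" by (rule d0)
  show "\<bar>d u\<bar> \<le> 2 * \<delta>"
  proof (cases "2 * \<delta> \<le> \<bar>u\<bar>")
    case False
    then have "\<bar>u\<bar> < 1 / 2" using \<delta> by simp
    then show ?thesis using f'(1,2)[of u] g'(1,2)[of u] False by (simp add: d_def abs_le_iff)
  qed (use d0 \<delta> in simp)
  show "Cinf_on d UNIV"
  proof (rule Cinf_on_local)
    fix u :: real
    have 1: "Cinf_on d {-1/2<..<1/2}"
      by (rule Cinf_on_cong[OF Cinf_on_diff[OF f(2,1)]]) (auto simp: d_def abs_if)
    have 2: "Cinf_on d (- {- (2 * \<delta>)..2 * \<delta>})"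
    proof (rule Cinf_on_cong[OF Cinf_on_const[of _ 0]])
      show "0 = d u" if "u \<in> - {- (2 * \<delta>)..2 * \<delta>}" for u
        by (rule d0[symmetric]) (use that in \<open>auto simp: abs_if\<close>)
    qed (simp add: open_Compl)
    show "\<exists>V. u \<in> V \<and> Cinf_on d V"
    proof (cases "\<bar>u\<bar> < 1/2")
      case True
      then show ?thesis using 1 by (intro exI[of _ "{-1/2<..<1/2}"]) (auto simp: abs_if split: if_splits)
    next
      case False
      then show ?thesis using 2 \<delta> by (intro exI[of _ "- {- (2 * \<delta>)..2 * \<delta>}"]) (auto simp: abs_if split: if_splits)
    qed
  qed simp
qed

text \<open>The lower corner is treated by \<open>corner_move\<close> and the upper one by a
  conjugate of such a move under \<open>reflect\<close>. Each is the identity on the other half of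
  the cylinder, so the two halves are treated separately. The threshold \<open>\<delta>0\<close>
  depends on \<open>e\<close> and an absolute constant, not on the profiles.\<close>

lemma rounded_cylinders_diffeomorphic:
  assumes e: "0 < e" "e \<le> 1/4"
  obtains \<delta>0 where "\<delta>0 > 0"
    "\<And>\<delta> W1 W2. 0 < \<delta> \<Longrightarrow> \<delta> \<le> \<delta>0 \<Longrightarrow> rounded_cylinder \<delta> W1 \<Longrightarrow> rounded_cylinder \<delta> W2 \<Longrightarrow>
       \<exists>M. oriented_diffeo W1 W2 M \<and> (\<forall>p\<in>W1. radially_related (2 * e) (xs p) (xs (M p)))"
proof -
  obtain K where K: "K > 0" "\<And>e s t. e > 0 \<Longrightarrow> \<bar>plateau e s - plateau e t\<bar> \<le> K / e * \<bar>s - t\<bar>"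
    using plateau_lipschitz by blast
  define \<delta>0 where "\<delta>0 = e / (64 * K + 64)"
  have \<delta>0: "\<delta>0 > 0" using K(1) e by (simp add: \<delta>0_def)
  have "\<exists>M. oriented_diffeo W1 W2 M \<and> (\<forall>p\<in>W1. radially_related (2 * e) (xs p) (xs (M p)))"
    if \<delta>: "0 < \<delta>" "\<delta> \<le> \<delta>0" and W: "rounded_cylinder \<delta> W1" "rounded_cylinder \<delta> W2" for \<delta> W1 W2
  proof -
    have \<delta>e: "(64 * K + 64) * \<delta> \<le> e"
      using \<delta>(2) K(1) by (simp add: \<delta>0_def pos_le_divide_eq mult.commute)
    moreover have "64 * \<delta> \<le> (64 * K + 64) * \<delta>" using K(1) \<delta>(1) by (intro mult_right_mono) auto
    ultimately have \<delta>8: "8 * \<delta> \<le> e" "\<delta> \<le> 1 / 16" using \<delta>(1) e by linarith+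
    have RW: "rounded_cylinder \<delta> (reflect ` W1)" "rounded_cylinder \<delta> (reflect ` W2)"
      using W by (auto intro: rounded_cylinder_reflect)
    obtain f1 where f1: "Cinf_on f1 {-1/2<..<1/2}"
      "\<And>u. \<bar>u\<bar> < 1/2 \<Longrightarrow> \<bar>u\<bar> \<le> f1 u" "\<And>u. \<bar>u\<bar> < 1/2 \<Longrightarrow> f1 u \<le> max \<bar>u\<bar> (2 * \<delta>)"
      "\<And>p. \<bar>tau p\<bar> < 1/2 \<Longrightarrow> sig p \<le> 1/2 \<Longrightarrow> p \<in> W1 \<longleftrightarrow> f1 (tau p) \<le> sig p"
      using rounded_cylinder_profile[OF W(1) \<delta>(1) \<delta>8(2)] by blast
    obtain f2 where f2: "Cinf_on f2 {-1/2<..<1/2}"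
      "\<And>u. \<bar>u\<bar> < 1/2 \<Longrightarrow> \<bar>u\<bar> \<le> f2 u" "\<And>u. \<bar>u\<bar> < 1/2 \<Longrightarrow> f2 u \<le> max \<bar>u\<bar> (2 * \<delta>)"
      "\<And>p. \<bar>tau p\<bar> < 1/2 \<Longrightarrow> sig p \<le> 1/2 \<Longrightarrow> p \<in> W2 \<longleftrightarrow> f2 (tau p) \<le> sig p"
      using rounded_cylinder_profile[OF W(2) \<delta>(1) \<delta>8(2)] by blast
    obtain g1 where g1: "Cinf_on g1 {-1/2<..<1/2}"
      "\<And>u. \<bar>u\<bar> < 1/2 \<Longrightarrow> \<bar>u\<bar> \<le> g1 u" "\<And>u. \<bar>u\<bar> < 1/2 \<Longrightarrow> g1 u \<le> max \<bar>u\<bar> (2 * \<delta>)"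
      "\<And>p. \<bar>tau p\<bar> < 1/2 \<Longrightarrow> sig p \<le> 1/2 \<Longrightarrow> p \<in> reflect ` W1 \<longleftrightarrow> g1 (tau p) \<le> sig p"
      using rounded_cylinder_profile[OF RW(1) \<delta>(1) \<delta>8(2)] by blast
    obtain g2 where g2: "Cinf_on g2 {-1/2<..<1/2}"
      "\<And>u. \<bar>u\<bar> < 1/2 \<Longrightarrow> \<bar>u\<bar> \<le> g2 u" "\<And>u. \<bar>u\<bar> < 1/2 \<Longrightarrow> g2 u \<le> max \<bar>u\<bar> (2 * \<delta>)"
      "\<And>p. \<bar>tau p\<bar> < 1/2 \<Longrightarrow> sig p \<le> 1/2 \<Longrightarrow> p \<in> reflect ` W2 \<longleftrightarrow> g2 (tau p) \<le> sig p"
      using rounded_cylinder_profile[OF RW(2) \<delta>(1) \<delta>8(2)] by blast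
    define d where "d = (\<lambda>u. if \<bar>u\<bar> < 1/2 then f2 u - f1 u else 0)"
    define d' where "d' = (\<lambda>u. if \<bar>u\<bar> < 1/2 then g2 u - g1 u else 0)"
    have "Cinf_on d UNIV" "\<And>u. \<bar>d u\<bar> \<le> 2 * \<delta>" "\<And>u. 2 * \<delta> \<le> \<bar>u\<bar> \<Longrightarrow> d u = 0"
      unfolding d_def using profile_difference[OF \<delta>(1) \<delta>8(2) f1(1) f2(1) f1(2,3) f2(2,3)] by blast+
    then interpret A: corner_displacement e \<delta> K d
      by unfold_locales (use K e \<delta>(1) \<delta>8(1) \<delta>e in auto)
    have "Cinf_on d' UNIV" "\<And>u. \<bar>d' u\<bar> \<le> 2 * \<delta>" "\<And>u. 2 * \<delta> \<le> \<bar>u\<bar> \<Longrightarrow> d' u = 0"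
      unfolding d'_def using profile_difference[OF \<delta>(1) \<delta>8(2) g1(1) g2(1) g1(2,3) g2(2,3)] by blast+
    then interpret B: corner_displacement e \<delta> K d'
      by unfold_locales (use K e \<delta>(1) \<delta>8(1) \<delta>e in auto)
    have A_swap: "\<And>p. p \<in> W1 \<Longrightarrow> p $ 1 \<le> 1/2 \<Longrightarrow> corner_move e d p \<in> W2 \<and> corner_move e d p $ 1 \<le> 1/2"
      "\<And>q. q \<in> W2 \<Longrightarrow> q $ 1 \<le> 1/2 \<Longrightarrow> \<exists>p\<in>W1. p $ 1 \<le> 1/2 \<and> corner_move e d p = q"
      unfolding d_def
      by (rule corner_move_swaps(1)[OF A.corner_displacement_axioms[unfolded d_def] W f1(2-4) f2(2-4)]
            corner_move_swaps(2)[OF A.corner_displacement_axioms[unfolded d_def] W f1(2-4) f2(2-4)]; assumption)+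
    have B_swap: "\<And>p. p \<in> reflect ` W1 \<Longrightarrow> p $ 1 \<le> 1/2 \<Longrightarrow> corner_move e d' p \<in> reflect ` W2 \<and> corner_move e d' p $ 1 \<le> 1/2"
      "\<And>q. q \<in> reflect ` W2 \<Longrightarrow> q $ 1 \<le> 1/2 \<Longrightarrow> \<exists>p\<in>reflect ` W1. p $ 1 \<le> 1/2 \<and> corner_move e d' p = q"
      unfolding d'_def
      by (rule corner_move_swaps(1)[OF B.corner_displacement_axioms[unfolded d'_def] RW g1(2-4) g2(2-4)]
            corner_move_swaps(2)[OF B.corner_displacement_axioms[unfolded d'_def] RW g1(2-4) g2(2-4)]; assumption)+
    define M0 where "M0 = corner_move e d"
    define M1 where "M1 p = reflect (corner_move e d' (reflect p))" for p
    have M0_id: "M0 p = p" if "p $ 1 \<ge> 1/2 \<or> norm (xs p) < 1 - e" for p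
      using that A.w_support(3,4)[of p] e unfolding M0_def by (intro A.move_id) force
    have M1_id: "M1 p = p" if "p $ 1 \<le> 1/2 \<or> norm (xs p) < 1 - e" for p
    proof -
      have "corner_move e d' (reflect p) = reflect p"
        using that B.w_support(3,4)[of "reflect p"] e by (intro B.move_id) force
      then show ?thesis by (simp add: M1_def)
    qed
    define M where "M p = M1 (M0 p)" for p
    have M_mem: "M p \<in> W2" if p: "p \<in> W1" for p
    proof (cases "p $ 1 \<le> 1/2")
      case True
      then show ?thesis using A_swap(1)[OF p True] M1_id[of "M0 p"] by (simp add: M_def M0_def)
    next
      case False
      have "reflect p \<in> reflect ` W1" "reflect p $ 1 \<le> 1/2" using p False by auto
      from B_swap(1)[OF this] have "M1 p \<in> W2" by (simp add: M1_def mem_reflect_image)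
      then show ?thesis using M0_id[of p] False by (simp add: M_def)
    qed
    have M_onto: "q \<in> M ` W1" if q: "q \<in> W2" for q
    proof (cases "q $ 1 \<le> 1/2")
      case True
      then obtain p where "p \<in> W1" "M0 p = q" using A_swap(2)[OF q True] unfolding M0_def by blast
      then show ?thesis using M1_id[of q] True by (intro image_eqI[of _ _ p]) (simp_all add: M_def)
    next
      case False
      have "reflect q \<in> reflect ` W2" "reflect q $ 1 \<le> 1/2" using q False by auto
      from B_swap(2)[OF this] obtain p where p: "p \<in> reflect ` W1" "p $ 1 \<le> 1/2" "corner_move e d' p = reflect q"
        by blast
      have "reflect p \<in> W1" using p(1) by (simp add: mem_reflect_image)
      moreover have "M (reflect p) = q"
        using M0_id[of "reflect p"] p(2,3) by (simp add: M_def M1_def)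
      ultimately show ?thesis by (metis image_eqI)
    qed
    have M_image: "M ` W1 = W2" using M_mem M_onto by blast
    have M_smooth: "Cinf_on M UNIV"
      unfolding M_def[abs_def] M1_def M0_def
      by (intro Cinf_on_compose[OF Cinf_on_reflect] Cinf_on_compose[OF B.smooth_move] A.smooth_move) auto
    obtain m0 where m0: "m0 > 0" "\<And>p q. m0 * norm (p - q) \<le> norm (M0 p - M0 q)"
      using A.move_lower_bound unfolding M0_def by blast
    obtain m1 where m1: "m1 > 0" "\<And>p q. m1 * norm (p - q) \<le> norm (corner_move e d' p - corner_move e d' q)"
      using B.move_lower_bound by blast
    have M_lower: "m1 * m0 * norm (p - q) \<le> norm (M p - M q)" for p q
    proof -
      have "m1 * (m0 * norm (p - q)) \<le> m1 * norm (M0 p - M0 q)" using m0(2) m1(1) by (intro mult_left_mono) auto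
      also have "\<dots> \<le> norm (M p - M q)" using m1(2)[of "reflect (M0 p)" "reflect (M0 q)"] by (simp add: M_def M1_def)
      finally show ?thesis by (simp add: mult.assoc)
    qed
    have mm: "m1 * m0 > 0" using m0(1) m1(1) by simp
    have inj: "inj_on M W1"
    proof (rule inj_onI)
      fix p q assume "M p = M q"
      then have "m1 * m0 * norm (p - q) \<le> 0" using M_lower[of p q] by simp
      then show "p = q" using m0(1) m1(1) by (simp add: mult_le_0_iff)
    qed
    have dM: "diffeo W1 W2 M"
      using diffeo_if_nondegenerate[OF compact_rounded_cylinder[OF W(1)] inj
          nondegenerate_on_if_lower_bound[OF M_smooth mm M_lower]] M_image by simp
    have "oriented_diffeo W1 W2 M"
    proof (rule oriented_diffeo_if_positive_somewhere[OF dM])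
      show "convex W1" using W(1) by (simp add: rounded_cylinder_def)
      show "pt (1 / 2) 0 \<in> interior W1" using rounded_cylinder_interior[OF W(1)] \<delta>8 by simp
      have "open {p. norm (xs p) < 1 - e}"
        by (intro open_Collect_less continuous_intros linear_continuous_on[OF bounded_linear_xs])
      then have "det (jacobian M (at (pt (1 / 2) 0))) = 1"
        by (rule jacobian_eq_id) (use e M0_id M1_id in \<open>auto simp: M_def\<close>)
      then show "det (jacobian M (at (pt (1 / 2) 0))) > 0" by simp
    qed
    moreover have "radially_related (2 * e) (xs p) (xs (M p))" for p
    proof (rule radially_related_trans)
      show "radially_related (2 * e) (xs p) (xs (M0 p))" unfolding M0_def by (rule A.move_radially_related)
      show "radially_related (2 * e) (xs (M0 p)) (xs (M p))"
        using B.move_radially_related[of "reflect (M0 p)"] by (simp add: M_def M1_def)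
    qed
    ultimately show ?thesis by blast
  qed
  then show ?thesis using that[OF \<delta>0] by blast
qed

section \<open>Unwinding the isotopies\<close>

lemma corner_rounding_rounded_cylinder:
  "corner_rounding \<delta> W \<rho> \<Longrightarrow> rounded_cylinder \<delta> W \<and> oriented_diffeo W D4 \<rho>"
  unfolding corner_rounding_def rounded_cylinder_def oriented_diffeo_def by blast

lemma spinning_isotopy_oriented:
  assumes "spinning_isotopy a \<phi>" shows "oriented_diffeo cylinder cylinder (lift \<phi>)"
proof (rule lift_oriented_if_start_id)
  have \<phi>: "smooth_on ({0..1} \<times> D3) (\<lambda>(t, x). \<phi> t x)" "\<And>t. t \<in> {0..1} \<Longrightarrow> diffeo D3 D3 (\<phi> t)"
    using assms by (auto simp: spinning_isotopy_def)
  show "diffeo cylinder cylinder (lift \<phi>)"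
  proof (rule diffeo_lift[OF smooth_on_lift[OF \<phi>(1)]])
    fix t :: real assume t: "t \<in> {0..1}"
    show "nondegenerate_on D3 (\<phi> t)" by (rule diffeo_nondegenerate[OF \<phi>(2)[OF t]]) simp
    show "bij_betw (\<phi> t) D3 D3" using \<phi>(2)[OF t] by (simp add: diffeo_def)
  qed
  show "\<phi> 0 x = x" if "x \<in> D3" for x using assms that by (simp add: spinning_isotopy_def)
qed

text \<open>\<open>B\<close> is \<open>\<Phi>\<close> after the inverse of \<open>Q\<close>, with
  \<open>\<Phi> t x = \<phi> t (Z x)\<close>. Near the sphere it preserves level and radius, hence
  membership in a rotationally symmetric \<open>W\<close>; deeper inside, both \<open>p\<close> and
  \<open>B p\<close> are too far from the corners to be cut off. The trace pulls back to a product
  set because \<open>Q\<close> moves points only along rays and only in the shell where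
  \<open>Z x \<in> a\<close> depends on the ray of \<open>x\<close> alone.\<close>

lemma spun_trace_unspun:
  assumes a: "properly_embedded_arc a" and \<phi>: "spinning_isotopy a \<phi>"
    and Z: "Cinf_on Z UNIV" "m > 0" "\<And>x y. m * norm (x - y) \<le> norm (Z x - Z y)"
      "\<And>x. norm x = 1 \<Longrightarrow> Z x = x" "\<And>x. norm x \<le> 1/2 \<Longrightarrow> Z x = x"
    and e1: "0 < e1" "e1 \<le> 1"
    and ray: "\<And>x k. k > 0 \<Longrightarrow> 1 - e1 < norm x \<Longrightarrow> norm x \<le> 1 \<Longrightarrow> 1 - e1 < norm (k *\<^sub>R x) \<Longrightarrow>
        norm (k *\<^sub>R x) \<le> 1 \<Longrightarrow> Z (k *\<^sub>R x) \<in> a \<longleftrightarrow> Z x \<in> a"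
  obtains B e where "oriented_diffeo cylinder cylinder B" "e > 0"
    "\<And>\<delta> W p. 0 < \<delta> \<Longrightarrow> \<delta> \<le> e \<Longrightarrow> rounded_cylinder \<delta> W \<Longrightarrow> p \<in> cylinder \<Longrightarrow> B p \<in> W \<longleftrightarrow> p \<in> W"
    "\<And>p. p \<in> cylinder \<Longrightarrow> B p \<in> spun_trace a \<phi> \<longleftrightarrow> Z (xs p) \<in> a"
proof -
  have Zinj: "x = y" if "Z x = Z y" for x y
    using Z(3)[of x y] that Z(2) by (simp add: mult_le_0_iff)
  have Zbij: "bij_betw Z D3 D3"
  proof (rule cball_onto_if_sphere_fixed)
    show "continuous_on D3 Z" using Cinf_on_continuous_on[OF Z(1)] continuous_on_subset by blast
    show "inj_on Z D3" using Zinj by (rule inj_onI)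
  qed (use Z(4,5) in auto)
  have dZ: "diffeo cylinder cylinder (lift (\<lambda>_. Z))"
  proof (rule diffeo_lift[OF smooth_on_lift])
    have "smooth_on ({0..1::real} \<times> D3) (\<lambda>p. Z (snd p))"
      by (rule smooth_on_compose[OF smooth_onI_Cinf_on[OF Z(1) order_refl] smooth_on_bounded_linear[OF bounded_linear_snd]]) simp
    then show "smooth_on ({0..1::real} \<times> D3) (\<lambda>(t, x). Z x)" by (simp add: case_prod_beta')
    show "nondegenerate_on D3 Z" by (rule nondegenerate_on_if_lower_bound[OF Z(1-3)])
  qed (rule Zbij)
  have "oriented_diffeo cylinder cylinder (lift (\<lambda>_. Z))"
  proof (rule oriented_diffeo_if_positive_somewhere[OF dZ convex_cylinder])
    show "pt (1 / 2) 0 \<in> interior cylinder" by (rule mem_interior_cylinder) auto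
    have "open {p. norm (xs p) < 1 / 2}"
      by (intro open_Collect_less continuous_intros linear_continuous_on[OF bounded_linear_xs])
    then have "det (jacobian (lift (\<lambda>_. Z)) (at (pt (1 / 2) 0))) = 1"
      by (rule jacobian_eq_id) (use Z(5) in \<open>auto simp: lift_def\<close>)
    then show "det (jacobian (lift (\<lambda>_. Z)) (at (pt (1 / 2) 0))) > 0" by simp
  qed
  from oriented_diffeo_compose[OF this spinning_isotopy_oriented[OF \<phi>]]
  have o\<Phi>: "oriented_diffeo cylinder cylinder (lift (\<lambda>t x. \<phi> t (Z x)))"
    by (simp add: lift_def[abs_def])
  define \<Phi> where "\<Phi> t x = \<phi> t (Z x)" for t x
  interpret boundary_fixing_family \<Phi>
  proof
    show "Defs.diffeo cylinder cylinder (lift \<Phi>)" using o\<Phi> unfolding oriented_diffeo_def \<Phi>_def[abs_def] by blast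
    show "\<Phi> t x = x" if "t \<in> {0..1}" "norm x = 1" for t x
      using \<phi> that Z(4) by (simp add: \<Phi>_def spinning_isotopy_def)
  qed
  obtain Q e where Q: "oriented_diffeo cylinder cylinder (lift Q)" "e > 0"
    "\<And>t x. t \<in> {0..1} \<Longrightarrow> norm x \<le> 1 \<Longrightarrow> \<exists>k>0. Q t x = k *\<^sub>R x"
    "\<And>t x. t \<in> {0..1} \<Longrightarrow> norm x \<le> 1 - e1 \<Longrightarrow> Q t x = x"
    "\<And>t x. t \<in> {0..1} \<Longrightarrow> 1 - e1 < norm x \<Longrightarrow> norm x \<le> 1 \<Longrightarrow> 1 - e1 < norm (Q t x)"
    "\<And>t x. t \<in> {0..1} \<Longrightarrow> norm x \<le> 1 \<Longrightarrow> 1 - e \<le> norm (Q t x) \<Longrightarrow> norm (\<Phi> t x) = norm (Q t x)"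
    "\<And>t x. t \<in> {0..1} \<Longrightarrow> norm x \<le> 1 \<Longrightarrow> norm (Q t x) < 1 - e \<Longrightarrow> norm (\<Phi> t x) < 1 - e"
    using radial_normalisation[OF e1] by blast
  have Qbij: "bij_betw (lift Q) cylinder cylinder" using Q(1) by (simp add: oriented_diffeo_def diffeo_def)
  define B where "B p = lift \<Phi> (inv_into cylinder (lift Q) p)" for p
  have oB: "oriented_diffeo cylinder cylinder B"
    unfolding B_def[abs_def]
    by (rule oriented_diffeo_compose[OF oriented_diffeo_inv_into[OF Q(1)]]) (use o\<Phi> in \<open>simp add: \<Phi>_def[abs_def]\<close>)
  \<comment> \<open>Writing points as \<open>pt t (Q t x)\<close> makes the inverse of
    \<open>Q\<close> disappear: \<open>B\<close> sends them to
    \<open>pt t (\<Phi> t x)\<close>.\<close>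
  have rep: "\<exists>t x. t \<in> {0..1} \<and> norm x \<le> 1 \<and> p = pt t (Q t x) \<and> norm (Q t x) \<le> 1 \<and> B p = pt t (\<Phi> t x) \<and> norm (\<Phi> t x) \<le> 1"
    if p: "p \<in> cylinder" for p
  proof -
    define r where "r = inv_into cylinder (lift Q) p"
    have r: "r \<in> cylinder" "lift Q r = p"
      using Qbij p by (auto simp: r_def bij_betw_def inv_into_into f_inv_into_f)
    have tx: "r $ 1 \<in> {0..1}" "norm (xs r) \<le> 1" using r(1) by (auto simp: mem_cylinder)
    have "p = pt (r $ 1) (Q (r $ 1) (xs r))" using r(2) by (simp add: lift_def)
    moreover from this have "norm (Q (r $ 1) (xs r)) \<le> 1" using p by (metis pt_mem_cylinder)
    moreover have "B p = pt (r $ 1) (\<Phi> (r $ 1) (xs r))" by (simp add: B_def r_def[symmetric] lift_def)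
    ultimately show ?thesis using tx norm_le_1[OF tx] by blast
  qed
  have memW: "B p \<in> W \<longleftrightarrow> p \<in> W"
    if \<delta>: "0 < \<delta>" "\<delta> \<le> e" and W: "rounded_cylinder \<delta> W" and p: "p \<in> cylinder" for \<delta> W p
  proof -
    obtain t x where tx: "t \<in> {0..1}" "norm x \<le> 1" "p = pt t (Q t x)" "norm (Q t x) \<le> 1"
      "B p = pt t (\<Phi> t x)" "norm (\<Phi> t x) \<le> 1" using rep[OF p] by blast
    show ?thesis
    proof (cases "1 - e \<le> norm (Q t x)")
      case True
      show ?thesis using rounded_cylinder_rotate[OF W Q(6)[OF tx(1,2) True], of t] tx(3,5) by metis
    next
      case False
      then have n: "norm (Q t x) < 1 - e" by simp
      have "pt t (Q t x) \<in> W" "pt t (\<Phi> t x) \<in> W"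
        using tx n Q(7)[OF tx(1,2) n] \<delta>
        by (auto intro!: rounded_cylinder_mem_if_far[OF W] simp: pt_mem_cylinder)
      then show ?thesis using tx(3,5) by metis
    qed
  qed
  have trace: "B p \<in> spun_trace a \<phi> \<longleftrightarrow> Z (xs p) \<in> a" if p: "p \<in> cylinder" for p
  proof -
    obtain t x where tx: "t \<in> {0..1}" "norm x \<le> 1" "p = pt t (Q t x)" "norm (Q t x) \<le> 1"
      "B p = pt t (\<Phi> t x)" "norm (\<Phi> t x) \<le> 1" using rep[OF p] by blast
    have inj\<phi>: "inj_on (\<phi> t) D3"
      using \<phi> tx(1) by (simp add: spinning_isotopy_def diffeo_def bij_betw_def)
    have aD: "a \<subseteq> D3" using a unfolding properly_embedded_arc_def by blast
    have ZD: "Z x \<in> D3" using Zbij tx(2) by (auto simp: bij_betw_def)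
    have "pt t (\<Phi> t x) \<in> spun_trace a \<phi> \<longleftrightarrow> \<phi> t (Z x) \<in> \<phi> t ` a"
    proof
      assume "pt t (\<Phi> t x) \<in> spun_trace a \<phi>"
      then obtain s y where "pt t (\<Phi> t x) = pt s (\<phi> s y)" "y \<in> a" unfolding spun_trace_def by blast
      then show "\<phi> t (Z x) \<in> \<phi> t ` a" by (auto simp: pt_eq_iff \<Phi>_def)
    next
      assume "\<phi> t (Z x) \<in> \<phi> t ` a"
      then show "pt t (\<Phi> t x) \<in> spun_trace a \<phi>" unfolding spun_trace_def \<Phi>_def using tx(1) by blast
    qed
    also have "\<dots> \<longleftrightarrow> Z x \<in> a" by (rule inj_on_image_mem_iff[OF inj\<phi> ZD aD])
    also have "\<dots> \<longleftrightarrow> Z (Q t x) \<in> a"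
    proof (cases "norm x \<le> 1 - e1")
      case True
      then show ?thesis using Q(4)[OF tx(1)] by simp
    next
      case False
      then have n: "1 - e1 < norm x" by simp
      obtain k where k: "k > 0" "Q t x = k *\<^sub>R x" using Q(3)[OF tx(1,2)] by blast
      show ?thesis using ray[OF k(1) n tx(2)] Q(5)[OF tx(1) n tx(2)] tx(4) unfolding k(2) by blast
    qed
    finally have "pt t (\<Phi> t x) \<in> spun_trace a \<phi> \<longleftrightarrow> Z (Q t x) \<in> a" .
    moreover have "xs p = Q t x" using arg_cong[OF tx(3), of xs] by simp
    ultimately show ?thesis by (simp only: tx(5))
  qed
  show ?thesis by (rule that[OF oB Q(2) memW trace])
qed

theorem proposition3p2:
  fixes a :: "(real^3) set" and \<phi> \<psi> :: "real \<Rightarrow> real^3 \<Rightarrow> real^3"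
  assumes "properly_embedded_arc a"
    and "spinning_isotopy a \<phi>"
    and "spinning_isotopy a \<psi>"
  shows "\<forall>\<^sub>F \<delta> in at_right 0. \<forall>D D'.
           deform_spun_slice_disk \<delta> a \<phi> D \<longrightarrow> deform_spun_slice_disk \<delta> a \<psi> D' \<longrightarrow>
           slice_disks_diffeomorphic D D'"
proof -
  obtain Z p q m ea where Z: "Cinf_on Z UNIV" "m > 0" "\<And>x y. m * norm (x - y) \<le> norm (Z x - Z y)"
    "\<And>x. norm x = 1 \<Longrightarrow> Z x = x" "\<And>x. norm x \<le> 1/2 \<Longrightarrow> Z x = x"
    and pq: "norm p = 1" "norm q = 1" and ea: "ea > 0"
    and zone: "\<And>x. 1 - ea < norm x \<Longrightarrow> norm x \<le> 1 \<Longrightarrow> Z x \<in> a \<longleftrightarrow> x = norm x *\<^sub>R p \<or> x = norm x *\<^sub>R q"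
    by (rule straighten_arc[OF assms(1)]) (rule that, assumption+)
  \<comment> \<open>The cap at \<open>1\<close> ensures that the shell
    \<open>1 - e1 < norm x\<close> does not contain the centre, so its points have a ray.\<close>
  define e1 where "e1 = min ea 1"
  have e1: "0 < e1" "e1 \<le> 1" "e1 \<le> ea" using ea by (auto simp: e1_def)
  have ray: "Z (k *\<^sub>R x) \<in> a \<longleftrightarrow> Z x \<in> a"
    if k: "k > 0" and x: "1 - e1 < norm x" "norm x \<le> 1" "1 - e1 < norm (k *\<^sub>R x)" "norm (k *\<^sub>R x) \<le> 1" for x k
  proof -
    have "norm (k *\<^sub>R x) *\<^sub>R v = k *\<^sub>R (norm x *\<^sub>R v)" for v :: "real^3" using k by simp
    then have "k *\<^sub>R x = norm (k *\<^sub>R x) *\<^sub>R v \<longleftrightarrow> x = norm x *\<^sub>R v" for v :: "real^3"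
      using k by (simp only: scaleR_cancel_left) simp
    then show ?thesis using zone[of x] zone[of "k *\<^sub>R x"] x e1(3) by simp
  qed
  obtain B e where B: "oriented_diffeo cylinder cylinder B" "e > 0"
    "\<And>\<delta> W p. 0 < \<delta> \<Longrightarrow> \<delta> \<le> e \<Longrightarrow> rounded_cylinder \<delta> W \<Longrightarrow> p \<in> cylinder \<Longrightarrow> B p \<in> W \<longleftrightarrow> p \<in> W"
    "\<And>p. p \<in> cylinder \<Longrightarrow> B p \<in> spun_trace a \<phi> \<longleftrightarrow> Z (xs p) \<in> a"
    using spun_trace_unspun[OF assms(1,2) Z e1(1,2) ray] by blast
  obtain C e' where C: "oriented_diffeo cylinder cylinder C" "e' > 0"
    "\<And>\<delta> W p. 0 < \<delta> \<Longrightarrow> \<delta> \<le> e' \<Longrightarrow> rounded_cylinder \<delta> W \<Longrightarrow> p \<in> cylinder \<Longrightarrow> C p \<in> W \<longleftrightarrow> p \<in> W"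
    "\<And>p. p \<in> cylinder \<Longrightarrow> C p \<in> spun_trace a \<psi> \<longleftrightarrow> Z (xs p) \<in> a"
    using spun_trace_unspun[OF assms(1,3) Z e1(1,2) ray] by blast
  \<comment> \<open>The slide at scale \<open>e1 / 4\<close> moves in space only points of depth at
    most \<open>e1 / 2\<close>, strictly inside the shell where \<open>ray\<close> applies.\<close>
  have e4: "0 < e1 / 4" "e1 / 4 \<le> 1 / 4" using e1 by auto
  obtain \<delta>0 where \<delta>0: "\<delta>0 > 0"
    "\<And>\<delta> W1 W2. 0 < \<delta> \<Longrightarrow> \<delta> \<le> \<delta>0 \<Longrightarrow> rounded_cylinder \<delta> W1 \<Longrightarrow> rounded_cylinder \<delta> W2 \<Longrightarrow>
       \<exists>M. oriented_diffeo W1 W2 M \<and> (\<forall>p\<in>W1. radially_related (2 * (e1 / 4)) (xs p) (xs (M p)))"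
    using rounded_cylinders_diffeomorphic[OF e4] by blast
  define b where "b = min \<delta>0 (min e e')"
  have b: "b > 0" "b \<le> \<delta>0" "b \<le> e" "b \<le> e'" using \<delta>0(1) B(2) C(2) by (auto simp: b_def)
  have main: "slice_disks_diffeomorphic D D'"
    if \<delta>: "\<delta> \<in> {0<..<b}" and D: "deform_spun_slice_disk \<delta> a \<phi> D" "deform_spun_slice_disk \<delta> a \<psi> D'" for \<delta> D D'
  proof -
    have \<delta>': "0 < \<delta>" "\<delta> \<le> \<delta>0" "\<delta> \<le> e" "\<delta> \<le> e'" using \<delta> b by auto
    obtain W1 r1 where 1: "corner_rounding \<delta> W1 r1" "D = r1 ` (W1 \<inter> spun_trace a \<phi>)"
      using D(1) unfolding deform_spun_slice_disk_def by blast
    obtain W2 r2 where 2: "corner_rounding \<delta> W2 r2" "D' = r2 ` (W2 \<inter> spun_trace a \<psi>)"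
      using D(2) unfolding deform_spun_slice_disk_def by blast
    have W: "rounded_cylinder \<delta> W1" "rounded_cylinder \<delta> W2" and r: "oriented_diffeo W1 D4 r1" "oriented_diffeo W2 D4 r2"
      using corner_rounding_rounded_cylinder[OF 1(1)] corner_rounding_rounded_cylinder[OF 2(1)] by auto
    \<comment> \<open>Membership in \<open>W\<close> and in the trace is reflected as well as
      preserved, so a map of the cylinder onto itself restricts to maps onto \<open>W\<close> and
      onto the part of the trace in \<open>W\<close>.\<close>
    have restrict: "oriented_diffeo W W F \<and> F ` {p \<in> W. Z (xs p) \<in> a} = W \<inter> T"
      if F: "oriented_diffeo cylinder cylinder F" "\<And>p. p \<in> cylinder \<Longrightarrow> F p \<in> W \<longleftrightarrow> p \<in> W"
        "\<And>p. p \<in> cylinder \<Longrightarrow> F p \<in> T \<longleftrightarrow> Z (xs p) \<in> a" and W: "rounded_cylinder \<delta> W" for F W T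
    proof -
      note sub = rounded_cylinder_subset[OF W]
      have im: "F ` cylinder = cylinder" using F(1) by (simp add: oriented_diffeo_def diffeo_def bij_betw_def)
      have FW: "F ` W = W"
      proof
        show "F ` W \<subseteq> W" using F(2) sub by blast
        show "W \<subseteq> F ` W"
        proof
          fix p assume "p \<in> W"
          then obtain s where "s \<in> cylinder" "p = F s" using sub im by blast
          then show "p \<in> F ` W" using F(2) \<open>p \<in> W\<close> by blast
        qed
      qed
      moreover have "F ` {p \<in> W. Z (xs p) \<in> a} = W \<inter> T"
      proof
        show "F ` {p \<in> W. Z (xs p) \<in> a} \<subseteq> W \<inter> T" using FW F(3) sub by blast
        show "W \<inter> T \<subseteq> F ` {p \<in> W. Z (xs p) \<in> a}"
        proof
          fix p assume p: "p \<in> W \<inter> T"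
          then obtain s where s: "s \<in> W" "p = F s" using FW by blast
          then have "Z (xs s) \<in> a" using F(3)[of s] p sub by blast
          then show "p \<in> F ` {p \<in> W. Z (xs p) \<in> a}" using s by blast
        qed
      qed
      ultimately show ?thesis using oriented_diffeo_subset[OF F(1) sub] by blast
    qed
    have B1: "oriented_diffeo W1 W1 B" "B ` {p \<in> W1. Z (xs p) \<in> a} = W1 \<inter> spun_trace a \<phi>"
      using restrict[OF B(1) B(3)[OF \<delta>'(1,3) W(1)] B(4) W(1)] by auto
    have C2: "oriented_diffeo W2 W2 C" "C ` {p \<in> W2. Z (xs p) \<in> a} = W2 \<inter> spun_trace a \<psi>"
      using restrict[OF C(1) C(3)[OF \<delta>'(1,4) W(2)] C(4) W(2)] by auto
    obtain M where M: "oriented_diffeo W1 W2 M"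
      "\<And>p. p \<in> W1 \<Longrightarrow> radially_related (2 * (e1 / 4)) (xs p) (xs (M p))"
      using \<delta>0(2)[OF \<delta>'(1,2) W] by blast
    have Mim: "M ` W1 = W2" using M(1) by (simp add: oriented_diffeo_def diffeo_def bij_betw_def)
    have Mtrace: "Z (xs (M s)) \<in> a \<longleftrightarrow> Z (xs s) \<in> a" if s: "s \<in> W1" for s
    proof (cases "xs (M s) = xs s")
      case False
      then obtain k where k: "k > 0" "xs (M s) = k *\<^sub>R xs s" "1 - e1 / 2 \<le> norm (xs s)" "1 - e1 / 2 \<le> norm (xs (M s))"
        using M(2)[OF s] by (auto simp: radially_related_def)
      have "norm (xs s) \<le> 1" using s rounded_cylinder_subset[OF W(1)] by (auto simp: mem_cylinder)
      moreover have "norm (xs (M s)) \<le> 1"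
        using s Mim rounded_cylinder_subset[OF W(2)] mem_cylinder by blast
      ultimately show ?thesis unfolding k(2) using k e1(1) by (intro ray) auto
    qed simp
    have M12: "M ` {p \<in> W1. Z (xs p) \<in> a} = {p \<in> W2. Z (xs p) \<in> a}"
    proof
      show "M ` {p \<in> W1. Z (xs p) \<in> a} \<subseteq> {p \<in> W2. Z (xs p) \<in> a}" using Mim Mtrace by blast
      show "{p \<in> W2. Z (xs p) \<in> a} \<subseteq> M ` {p \<in> W1. Z (xs p) \<in> a}"
      proof
        fix p assume p: "p \<in> {p \<in> W2. Z (xs p) \<in> a}"
        then obtain s where s: "s \<in> W1" "p = M s" using Mim by blast
        then show "p \<in> M ` {p \<in> W1. Z (xs p) \<in> a}" using Mtrace[OF s(1)] p by blast
      qed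
    qed
    have inv_im: "inv_into S F ` F ` A = A" if "oriented_diffeo S S' F" "A \<subseteq> S" for S S' A :: "(real^4) set" and F
      using that by (intro inv_into_image_cancel) (auto simp: oriented_diffeo_def diffeo_def bij_betw_def)
    \<comment> \<open>The route passes through the product set given by
      \<open>Z (xs p) \<in> a\<close>: undo \<open>r1\<close>, unwind \<open>\<phi>\<close>, slide
      \<open>W1\<close> to \<open>W2\<close>, wind up along \<open>\<psi>\<close>, apply
      \<open>r2\<close>.\<close>
    define f where "f = (\<lambda>p. r2 (C (M (inv_into W1 B (inv_into W1 r1 p)))))"
    have "oriented_diffeo D4 D4 f"
      unfolding f_def
      by (intro oriented_diffeo_compose[OF _ r(2)] oriented_diffeo_compose[OF _ C2(1)] oriented_diffeo_compose[OF _ M(1)]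
          oriented_diffeo_compose[OF _ oriented_diffeo_inv_into[OF B1(1)]] oriented_diffeo_inv_into[OF r(1)])
    moreover have "f ` D = D'"
    proof -
      have "f ` D = r2 ` C ` M ` inv_into W1 B ` inv_into W1 r1 ` D" by (simp add: f_def image_image)
      also have "inv_into W1 r1 ` D = B ` {p \<in> W1. Z (xs p) \<in> a}"
        unfolding 1(2) B1(2) by (rule inv_im[OF r(1)]) blast
      also have "inv_into W1 B ` \<dots> = {p \<in> W1. Z (xs p) \<in> a}" by (rule inv_im[OF B1(1)]) blast
      finally show ?thesis unfolding M12 C2(2) 2(2) .
    qed
    ultimately show ?thesis unfolding slice_disks_diffeomorphic_def by blast
  qed
  show ?thesis
    using eventually_at_right_real[OF b(1)] by (rule eventually_mono) (use main in blast)
qed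

end
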